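(* Let $K$ satisfy the kernel assumption (Existence) stated in the context, with associated function $\varphi$. Let $\rho\ge0$ and consider a sequence of triples $(N,L,\epsilon)$ with $N,L\to\infty$, $\epsilon\to0$, $\frac{N\epsilon}{L}\to\rho$, $\overline\rho=\sup\frac{N\epsilon}{L}$. Let $\mathbb P^{N,L,\epsilon}$ be the law on $D([0,\infty),\mathcal P_{\le\overline\rho})$ of the Markov jump process with generator $\mathcal Q^{N,L,\epsilon}$, with expectation $\mathbb E^{N,L,\epsilon}$. Assume that along the sequence either (i) $\displaystyle\sup\mathbb E^{N,L,\epsilon}[\mathcal M_2(c_0)]<+\infty$, where $\mathcal M_2(c)=\int x^2\,c(\mathrm dx)$; or (ii) there exists some $f\in\mathcal A$ such that $x\mapsto f(x)\varphi(x)$ is uniformly continuous and integrable on $\mathbb R_+$ and $\displaystyle\sup\mathbb E^{N,L,\epsilon}[\mathcal M_f(c_0)]<+\infty$, where $\mathcal M_f(c)=\int f(x)\,c(\mathrm dx)$. Assume also that $\epsilon\to0$ sufficiently fast, in the sense that $L\max\{\omega_{\overline\varphi}(\epsilon),\omega_K(\epsilon)\}\to0$ along the sequence, where $\overline\varphi(x)=(1+x)\varphi(x)$ in case (i) and $\overline\varphi(x)=(1+x+f(x))\varphi(x)$ in case (ii). Then the family of measures $(\mathbb P^{N,L,\epsilon})$ along the sequence is tight on the Skorokhod space $D([0,\infty),\mathcal P_{\le\overline\rho})$.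
   Context: Notation. $\mathbb R_+=[0,\infty)$; $\mathcal P(\mathbb R_+)$ is the set of Borel probability measures on $\mathbb R_+$. $\mathcal P^1$ is the set of those with finite first moment, equipped with the metric $W_1(\mu,\nu)=\int_0^\infty|T_\mu(x)-T_\nu(x)|\,\mathrm dx$, where $T_\mu(x)=\mu([x,\infty))$. $\mathcal P_{\le\rho}$ is the closed subset of $\mathcal P^1$ of measures with first moment $\le\rho$. $D([0,\infty),V)$ is the Skorokhod space of càdlàg paths in the metric space $V$; $c_0$ inside an expectation is the value of the path at time $0$. Kernel assumption (Existence). $K:(0,\infty)\times\mathbb R_+\times\mathbb R_+\to\mathbb R_+$; for all $z\ge0$, $K(\cdot,\cdot,z)$ is continuous on $(0,\infty)\times\mathbb R_+$ and $K(x,y,z)\le C_K(1+x)(1+y)\varphi(z)$ for some constant $C_K$ and some $\varphi:\mathbb R_+\to\mathbb R_+$ such that $z\mapsto\varphi(z)$ and $z\mapsto z\varphi(z)$ are uniformly continuous and integrable. Moreover the functions $z\mapsto K(x,y,z)$, $x>0,y\ge0$, are uniformly continuous with a common modulus of continuity, denoted $\omega_K$. For a uniformly continuous $h$, $\omega_h$ denotes its modulus of continuity. Admissible moments. $\mathcal A_0$ is the set of $g\in C^2(\mathbb R_+;\mathbb R_+)$ with $g,g',g''\ge0$ such that for some $C_1,C_2\ge0$: $g'(x+z)\le C_1(g'(x)+g'(z))$ and $g'(x)\le C_2\bigl(1+\frac{g(x)}{1+x}\bigr)$ for all $x,z\in\mathbb R_+$. $\mathcal A=\{g\in\mathcal A_0:\lim_{x\to\infty}g'(x)=\infty\}$.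 Particle system. For $N,L\in\mathbb N$ ($L\ge2$) and $\epsilon>0$, $V^{N,L,\epsilon}$ is the set of $\eta=(\eta_1,\dots,\eta_L)$ with $\eta_i\in\{0,\epsilon,\dots,N\epsilon\}$ and $\sum_i\eta_i=N\epsilon$. The empirical cluster distribution is $C^L[\eta](k\epsilon)=\frac1L\sum_{i=1}^L\delta_{\eta_i,k\epsilon}$ (Kronecker delta), $k=0,\dots,N$; $\hat V^{N,L,\epsilon}=C^L(V^{N,L,\epsilon})$ is viewed as a subset of $\mathcal P(\mathbb R_+)$ by identifying $c$ with $\sum_kc(k\epsilon)\delta_{k\epsilon}$. The generator is $$\mathcal Q^{N,L,\epsilon}G(c)=L\sum_{k=1}^N\sum_{l=0}^{N-k}\sum_{d=1}^k\kappa^L_\epsilon[c](k\epsilon,l\epsilon,d\epsilon)\bigl(G(c+L^{-1}\gamma^{k\epsilon,l\epsilon,d\epsilon})-G(c)\bigr),$$ $$\kappa^L_\epsilon[c](x,y,z)=\tfrac{L}{L-1}K(x,y,z)\,\epsilon\,c(x)\bigl(c(y)-L^{-1}\delta_{x,y}\bigr),\qquad \gamma^{x,y,z}=\delta_{x-z}-\delta_x+\delta_{y+z}-\delta_y .$$ The process lives on the finite state space $\hat V^{N,L,\epsilon}$. *)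

theory Defs
  imports "HOL-Probability.Probability"
begin

section \<open>Skorokhod space over a metric space\<close>

text \<open>The time axis is \<open>{0..}\<close>; paths are extensional, so that a path is determined by its
  values at nonnegative times.\<close>

definition cadlag :: "'a set \<Rightarrow> ('a \<Rightarrow> 'a \<Rightarrow> real) \<Rightarrow> (real \<Rightarrow> 'a) set" where
  "cadlag M d = {\<omega> \<in> {0..} \<rightarrow>\<^sub>E M.
     (\<forall>t\<ge>0. limitin (Metric_space.mtopology M d) \<omega> (\<omega> t) (at_right t)) \<and>
     (\<forall>t>0. \<exists>l. limitin (Metric_space.mtopology M d) \<omega> l (at_left t))}"

text \<open>The time changes and the Skorokhod metric are those of Ethier and Kurtz,
  \<^emph>\<open>Markov Processes\<close>, Section 3.5.\<close>

definition log_slopes :: "(real \<Rightarrow> real) \<Rightarrow> real set" where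
  "log_slopes \<theta> = {\<bar>ln ((\<theta> s - \<theta> t) / (s - t))\<bar> | s t. 0 \<le> t \<and> t < s}"

definition time_changes :: "(real \<Rightarrow> real) set" where
  "time_changes = {\<theta>. bij_betw \<theta> {0..} {0..} \<and> strict_mono_on {0..} \<theta> \<and> bdd_above (log_slopes \<theta>)}"

definition skorokhod_dist ::
  "('a \<Rightarrow> 'a \<Rightarrow> real) \<Rightarrow> (real \<Rightarrow> 'a) \<Rightarrow> (real \<Rightarrow> 'a) \<Rightarrow> real" where
  "skorokhod_dist d x y = (INF \<theta>\<in>time_changes. max (Sup (log_slopes \<theta>))
     (LINT u:{0..}|lborel. exp (- u) * (SUP t\<in>{0..}. min 1 (d (x (min t u)) (y (min (\<theta> t) u))))))"

definition skorokhod_topology ::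
  "'a set \<Rightarrow> ('a \<Rightarrow> 'a \<Rightarrow> real) \<Rightarrow> (real \<Rightarrow> 'a) topology" where
  "skorokhod_topology M d = Metric_space.mtopology (cadlag M d) (skorokhod_dist d)"

definition borel_measure_space :: "'a topology \<Rightarrow> 'a measure" where
  "borel_measure_space T = sigma (topspace T) {U. openin T U}"

definition tight_family :: "'a topology \<Rightarrow> ('i \<Rightarrow> 'a measure) \<Rightarrow> bool" where
  "tight_family T P \<longleftrightarrow> (\<forall>e>0. \<exists>C. compactin T C \<and> (\<forall>i. measure (P i) C \<ge> 1 - e))"


section \<open>Measures on the half-line\<close>

abbreviation borel_nonneg :: "real measure" where
  "borel_nonneg \<equiv> restrict_space borel {0..}"

definition P1 :: "real measure set" where
  "P1 = {\<mu>. prob_space \<mu> \<and> sets \<mu> = sets borel_nonneg \<and> integrable \<mu> (\<lambda>x. x)}"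

definition W1 :: "real measure \<Rightarrow> real measure \<Rightarrow> real" where
  "W1 \<mu> \<nu> = (LINT x:{0..}|lborel. \<bar>measure \<mu> {x..} - measure \<nu> {x..}\<bar>)"

definition P_le :: "real \<Rightarrow> real measure set" where
  "P_le \<rho> = {\<mu> \<in> P1. (LINT x|\<mu>. x) \<le> \<rho>}"

definition moment :: "(real \<Rightarrow> real) \<Rightarrow> real measure \<Rightarrow> ennreal" where
  "moment f \<mu> = (\<integral>\<^sup>+x. ennreal (f x) \<partial>\<mu>)"


section \<open>Kernels and admissible moments\<close>

definition existence_kernel :: "(real \<Rightarrow> real \<Rightarrow> real \<Rightarrow> real) \<Rightarrow> (real \<Rightarrow> real) \<Rightarrow> bool" where
  "existence_kernel K \<phi> \<longleftrightarrow>
     (\<forall>x>0. \<forall>y\<ge>0. \<forall>z\<ge>0. 0 \<le> K x y z) \<and>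
     (\<forall>z\<ge>0. continuous_on ({0<..} \<times> {0..}) (\<lambda>(x, y). K x y z)) \<and>
     (\<forall>z\<ge>0. 0 \<le> \<phi> z) \<and>
     (\<exists>C\<^sub>K. \<forall>x>0. \<forall>y\<ge>0. \<forall>z\<ge>0. K x y z \<le> C\<^sub>K * (1 + x) * (1 + y) * \<phi> z) \<and>
     uniformly_continuous_on {0..} \<phi> \<and> set_integrable lborel {0..} \<phi> \<and>
     uniformly_continuous_on {0..} (\<lambda>z. z * \<phi> z) \<and> set_integrable lborel {0..} (\<lambda>z. z * \<phi> z) \<and>
     (\<forall>e>0. \<exists>\<delta>>0. \<forall>x>0. \<forall>y\<ge>0. \<forall>z\<ge>0. \<forall>z'\<ge>0. \<bar>z - z'\<bar> < \<delta> \<longrightarrow> \<bar>K x y z - K x y z'\<bar> < e)"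

text \<open>The suprema below are taken in the reals. They are over bounded sets whenever the functions
  are uniformly continuous (with a common modulus), since \<open>{0..}\<close> is an interval.\<close>

definition modulus :: "(real \<Rightarrow> real) \<Rightarrow> real \<Rightarrow> real" where
  "modulus h \<delta> = Sup {\<bar>h z - h z'\<bar> | z z'. 0 \<le> z \<and> 0 \<le> z' \<and> \<bar>z - z'\<bar> \<le> \<delta>}"

definition kernel_modulus :: "(real \<Rightarrow> real \<Rightarrow> real \<Rightarrow> real) \<Rightarrow> real \<Rightarrow> real" where
  "kernel_modulus K \<delta> =
     Sup {\<bar>K x y z - K x y z'\<bar> | x y z z'. 0 < x \<and> 0 \<le> y \<and> 0 \<le> z \<and> 0 \<le> z' \<and> \<bar>z - z'\<bar> \<le> \<delta>}"

definition admissible0 :: "(real \<Rightarrow> real) set" where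
  "admissible0 = {g. \<exists>g' g''.
     (\<forall>x\<ge>0. (g has_real_derivative g' x) (at x within {0..})) \<and>
     (\<forall>x\<ge>0. (g' has_real_derivative g'' x) (at x within {0..})) \<and>
     continuous_on {0..} g'' \<and>
     (\<forall>x\<ge>0. 0 \<le> g x \<and> 0 \<le> g' x \<and> 0 \<le> g'' x) \<and>
     (\<exists>C\<^sub>1\<ge>0. \<forall>x\<ge>0. \<forall>z\<ge>0. g' (x + z) \<le> C\<^sub>1 * (g' x + g' z)) \<and>
     (\<exists>C\<^sub>2\<ge>0. \<forall>x\<ge>0. g' x \<le> C\<^sub>2 * (1 + g x / (1 + x)))}"

definition admissible :: "(real \<Rightarrow> real) set" where
  "admissible = {g \<in> admissible0. filterlim (deriv g) at_top at_top}"


section \<open>The particle system\<close>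

definition configs :: "nat \<Rightarrow> nat \<Rightarrow> real \<Rightarrow> (nat \<Rightarrow> real) set" where
  "configs N L \<epsilon> = {\<eta> \<in> {1..L} \<rightarrow>\<^sub>E {real k * \<epsilon> | k. k \<le> N}. (\<Sum>i=1..L. \<eta> i) = real N * \<epsilon>}"

text \<open>Elements of the state space are represented by their mass functions on the reals, which
  vanish off the grid \<open>{0, \<epsilon>, \<dots>, N\<epsilon>}\<close>.\<close>

definition kron :: "real \<Rightarrow> real \<Rightarrow> real" where
  "kron x y = (if x = y then 1 else 0)"

definition cluster_dist :: "nat \<Rightarrow> (nat \<Rightarrow> real) \<Rightarrow> real \<Rightarrow> real" where
  "cluster_dist L \<eta> x = (1 / real L) * (\<Sum>i=1..L. kron (\<eta> i) x)"

definition states :: "nat \<Rightarrow> nat \<Rightarrow> real \<Rightarrow> (real \<Rightarrow> real) set" where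
  "states N L \<epsilon> = cluster_dist L ` configs N L \<epsilon>"

definition as_measure :: "(real \<Rightarrow> real) \<Rightarrow> real measure" where
  "as_measure c = distr (point_measure {x. c x \<noteq> 0} (\<lambda>x. ennreal (c x))) borel_nonneg (\<lambda>x. x)"

definition rate ::
  "(real \<Rightarrow> real \<Rightarrow> real \<Rightarrow> real) \<Rightarrow> nat \<Rightarrow> real \<Rightarrow> (real \<Rightarrow> real) \<Rightarrow> real \<Rightarrow> real \<Rightarrow> real \<Rightarrow> real" where
  "rate K L \<epsilon> c x y z =
     real L / (real L - 1) * K x y z * \<epsilon> * c x * (c y - 1 / real L * kron x y)"

definition jump :: "real \<Rightarrow> real \<Rightarrow> real \<Rightarrow> real \<Rightarrow> real" where
  "jump x y z = (\<lambda>u. kron (x - z) u - kron x u + kron (y + z) u - kron y u)"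

definition gen ::
  "(real \<Rightarrow> real \<Rightarrow> real \<Rightarrow> real) \<Rightarrow> nat \<Rightarrow> nat \<Rightarrow> real \<Rightarrow>
   ((real \<Rightarrow> real) \<Rightarrow> real) \<Rightarrow> (real \<Rightarrow> real) \<Rightarrow> real" where
  "gen K N L \<epsilon> G c = real L * (\<Sum>k=1..N. \<Sum>l=0..N-k. \<Sum>d=1..k.
     rate K L \<epsilon> c (real k * \<epsilon>) (real l * \<epsilon>) (real d * \<epsilon>) *
     (G (\<lambda>u. c u + 1 / real L * jump (real k * \<epsilon>) (real l * \<epsilon>) (real d * \<epsilon>) u) - G c))"

text \<open>The semigroup \<open>exp (t Q)\<close> as a power series. From a state in \<open>states N L \<epsilon>\<close> the generator
  only charges jumps inside this finite set, so there the series is a matrix exponential.\<close>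

definition exp_semigroup ::
  "((('s \<Rightarrow> real) \<Rightarrow> 's \<Rightarrow> real)) \<Rightarrow> real \<Rightarrow> ('s \<Rightarrow> real) \<Rightarrow> 's \<Rightarrow> real" where
  "exp_semigroup Q t G c = (\<Sum>n. t ^ n / fact n * (Q ^^ n) G c)"

definition path_filtration :: "'a set \<Rightarrow> ('a \<Rightarrow> 'a \<Rightarrow> real) \<Rightarrow> real \<Rightarrow> (real \<Rightarrow> 'a) measure" where
  "path_filtration M d s = sigma (cadlag M d)
     {{\<omega> \<in> cadlag M d. \<omega> r \<in> U} | r U. 0 \<le> r \<and> r \<le> s \<and> openin (Metric_space.mtopology M d) U}"

text \<open>\<open>P\<close> is the law on the Skorokhod space over \<open>(M, d)\<close> of a Markov jump process with generator
  \<open>Q\<close> and finite state space \<open>S\<close>, embedded in \<open>M\<close> by \<open>emb\<close>. The last clause is the Markov property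
  with transition probabilities \<open>exp (t Q)\<close>. The initial distribution is arbitrary.\<close>

definition markov_jump_law ::
  "'a set \<Rightarrow> ('a \<Rightarrow> 'a \<Rightarrow> real) \<Rightarrow> 's set \<Rightarrow> ('s \<Rightarrow> 'a) \<Rightarrow> (('s \<Rightarrow> real) \<Rightarrow> 's \<Rightarrow> real) \<Rightarrow>
   (real \<Rightarrow> 'a) measure \<Rightarrow> bool" where
  "markov_jump_law M d S emb Q P \<longleftrightarrow>
     prob_space P \<and>
     sets P = sets (borel_measure_space (skorokhod_topology M d)) \<and>
     (AE \<omega> in P. \<forall>t\<ge>0. \<omega> t \<in> emb ` S) \<and>
     (\<forall>s\<ge>0. \<forall>t\<ge>0. \<forall>A \<in> sets (path_filtration M d s). \<forall>a\<in>S. \<forall>b\<in>S.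
        measure P {\<omega> \<in> A. \<omega> s = emb a \<and> \<omega> (s + t) = emb b} =
        measure P {\<omega> \<in> A. \<omega> s = emb a} * exp_semigroup Q t (\<lambda>c. if c = b then 1 else 0) a)"

end

(* A jump moves the empirical measure by at most 2z/L in W_1, so the total rate of W_1-displacement
   is controlled by Riemann sums of z phi(z) and is bounded uniformly in the sequence. Hence the
   expected displacement over a step of length h is at most C h, whatever the past. By the Markov
   property, two increments larger than eta within a window of length h occur with probability at
   most (C h / eta)^2, and there are only O(1/h) windows up to a given time. The paths then admit,
   with high probability, partitions with gaps bounded below on which they oscillate little.
   The kernel bound and the growth conditions on f make the expected sum of the positive increments
   of M_f bounded on compact time intervals, so M_f is bounded along the path, and sublevel sets of
   M_f are relatively compact in W_1 because f is superlinear. These two controls characterise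
   relative compactness in the Skorokhod space. *)
theory Submission
  imports Defs "HOL-Library.Diagonal_Subsequence" "HOL-Real_Asymp.Real_Asymp"
begin

text \<open>The obstacle is to control all times in a window at once, from expected displacements
  over fixed time steps only. A bound O(h) on the probability of one large increment per window is
  lost in the union over the windows, so two disjoint increments are needed, and their bound must
  not deteriorate as the mesh shrinks. On a dyadic grid with 2^m steps in a window of length l, the
  sum of products of displacements over pairs of distinct steps has expectation at most (C l)^2:
  there are at most 4^m pairs and each contributes at most (C l / 2^m)^2. Since the state space is
  finite, paths are constant on a short interval to the right of each time, so fine grids detect
  every violation. The constants are uniform for three reasons. Jump rates of order L meet
  displacements of order 1/L. The error of the Riemann sums is N epsilon times a modulus, that is,
  the bounded density N epsilon / L times L times the modulus. The kernel factor (1 + x)(1 + y) is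
  integrated against a state of mass one and bounded mean, leaving at most one power of the moment
  of f.\<close>

section \<open>Time changes\<close>

text \<open>The lower slope bound gives strict monotonicity, the upper one continuity, and the
  intermediate value theorem gives surjectivity. Since \<open>g\<close> may be any bound, the
  supremum of the log slopes never has to be computed.\<close>

lemma time_changesI:
  assumes "\<theta> 0 = 0"
    and slopes: "\<And>s t. 0 \<le> t \<Longrightarrow> t < s \<Longrightarrow>
      exp (- g) * (s - t) \<le> \<theta> s - \<theta> t \<and> \<theta> s - \<theta> t \<le> exp g * (s - t)"
  shows "\<theta> \<in> time_changes" "Sup (log_slopes \<theta>) \<le> g"
proof -
  have mono: "strict_mono_on {0..} \<theta>"
  proof (intro strict_mono_onI)
    fix r s :: real assume "r \<in> {0..}" "s \<in> {0..}" "r < s"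
    then have "0 < exp (- g) * (s - r)" "exp (- g) * (s - r) \<le> \<theta> s - \<theta> r"
      using slopes[of r s] by auto
    then show "\<theta> r < \<theta> s" by linarith
  qed
  have cont: "continuous_on {0..} \<theta>"
  proof (rule lipschitz_on_continuous_on)
    show "(exp g)-lipschitz_on {0..} \<theta>"
    proof (rule lipschitz_onI)
      fix x y :: real assume xy: "x \<in> {0..}" "y \<in> {0..}"
      have *: "\<bar>\<theta> s - \<theta> t\<bar> \<le> exp g * \<bar>s - t\<bar>" if "0 \<le> t" "t < s" for s t
      proof -
        have "0 < exp (- g) * (s - t)" using that by simp
        then show ?thesis using slopes[OF that] that by (simp only: abs_of_pos diff_gt_0_iff_gt) linarith
      qed
      show "dist (\<theta> x) (\<theta> y) \<le> exp g * dist x y"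
        using *[of x y] *[of y x] xy
        by (cases x y rule: linorder_cases) (auto simp: dist_real_def abs_minus_commute)
    qed simp
  qed
  have nn: "0 \<le> \<theta> t" if "0 \<le> t" for t
    using mono assms(1) that unfolding strict_mono_on_def by (cases "t = 0") force+
  have surj: "\<exists>t\<ge>0. \<theta> t = v" if "0 \<le> v" for v
  proof -
    \<comment> \<open>The lower slope bound gives \<theta> at least \<open>v + exp (- g)\<close>
      here. The added 1 keeps the point positive even for \<open>v = 0\<close>.\<close>
    let ?b = "exp g * v + 1"
    have b: "0 < ?b" using that by (simp add: add_nonneg_pos)
    have "exp (- g) * ?b = v + exp (- g)" by (simp add: distrib_left exp_minus)
    then have "v \<le> exp (- g) * ?b" by simp
    also have "\<dots> \<le> \<theta> ?b" using slopes[of 0 ?b] b assms(1) by simp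
    finally have "v \<le> \<theta> ?b" .
    then have "\<exists>t\<ge>0. t \<le> ?b \<and> \<theta> t = v"
      using b that assms(1) by (intro IVT' continuous_on_subset[OF cont]) auto
    then show ?thesis by blast
  qed
  have ls: "x \<le> g" if "x \<in> log_slopes \<theta>" for x
  proof -
    from that obtain s t where x: "x = \<bar>ln ((\<theta> s - \<theta> t) / (s - t))\<bar>" and st: "0 \<le> t" "t < s"
      unfolding log_slopes_def by blast
    let ?q = "(\<theta> s - \<theta> t) / (s - t)"
    have q: "exp (- g) \<le> ?q" "?q \<le> exp g"
      using slopes[OF st] st by (auto simp: field_simps)
    then have "0 < ?q" using exp_gt_zero[of "- g"] by linarith
    then have "- g \<le> ln ?q" "ln ?q \<le> g" using q by (simp_all add: ln_ge_iff) (metis exp_le_cancel_iff exp_ln)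
    then show ?thesis unfolding x by linarith
  qed
  have bij: "bij_betw \<theta> {0..} {0..}"
    unfolding bij_betw_def
  proof (intro conjI equalityI subsetI)
    show "inj_on \<theta> {0..}" by (rule strict_mono_on_imp_inj_on[OF mono])
    show "v \<in> {0..}" if "v \<in> \<theta> ` {0..}" for v using that nn by auto
    show "v \<in> \<theta> ` {0..}" if v: "v \<in> {0..}" for v
    proof -
      obtain t where "t \<ge> 0" "\<theta> t = v" using surj[of v] v by auto
      then show ?thesis by force
    qed
  qed
  show "\<theta> \<in> time_changes"
    unfolding time_changes_def using bij mono bdd_aboveI[of "log_slopes \<theta>" g, OF ls] by simp
  have "\<bar>ln ((\<theta> 1 - \<theta> 0) / (1 - 0))\<bar> \<in> log_slopes \<theta>"
    unfolding log_slopes_def by (intro CollectI exI[of _ "1::real"] exI[of _ "0::real"]) auto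
  then have "log_slopes \<theta> \<noteq> {}" by blast
  then show "Sup (log_slopes \<theta>) \<le> g" using ls by (intro cSup_least)
qed

lemma
  assumes "\<theta> \<in> time_changes"
  shows time_change_zero: "\<theta> 0 = 0"
    and time_change_nonneg: "0 \<le> t \<Longrightarrow> 0 \<le> \<theta> t"
    and time_change_less: "0 \<le> t \<Longrightarrow> t < s \<Longrightarrow> \<theta> t < \<theta> s"
    and time_change_le: "0 \<le> t \<Longrightarrow> t \<le> s \<Longrightarrow> \<theta> t \<le> \<theta> s"
    and time_change_surj: "0 \<le> t \<Longrightarrow> \<exists>s\<ge>0. \<theta> s = t"
    and time_change_slopes: "0 \<le> t \<Longrightarrow> t < s \<Longrightarrow>
      exp (- Sup (log_slopes \<theta>)) * (s - t) \<le> \<theta> s - \<theta> t \<and>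
      \<theta> s - \<theta> t \<le> exp (Sup (log_slopes \<theta>)) * (s - t)"
    and time_change_Sup_nonneg: "0 \<le> Sup (log_slopes \<theta>)"
proof -
  from assms have bij: "bij_betw \<theta> {0..} {0..}" and mono: "strict_mono_on {0..} \<theta>"
    and bdd: "bdd_above (log_slopes \<theta>)" by (auto simp: time_changes_def)
  show nn: "0 \<le> \<theta> t" if "0 \<le> t" for t
    using bij that by (auto simp: bij_betw_def)
  show less: "\<theta> t < \<theta> s" if "0 \<le> t" "t < s" for s t
    using mono that by (auto simp: strict_mono_on_def)
  show surj: "\<exists>s\<ge>0. \<theta> s = t" if "0 \<le> t" for t
    using bij that by (auto simp: bij_betw_def image_iff set_eq_iff) (metis atLeast_iff)
  show "\<theta> t \<le> \<theta> s" if "0 \<le> t" "t \<le> s" for s t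
    using less[of t s] that by (cases "t = s") auto
  obtain s0 where "s0 \<ge> 0" "\<theta> s0 = 0" using surj[of 0] by auto
  then show "\<theta> 0 = 0" using less[of 0 s0] nn[of 0] by (cases "s0 = 0") auto
  show "exp (- Sup (log_slopes \<theta>)) * (s - t) \<le> \<theta> s - \<theta> t \<and>
      \<theta> s - \<theta> t \<le> exp (Sup (log_slopes \<theta>)) * (s - t)" if st: "0 \<le> t" "t < s" for s t
  proof -
    let ?q = "(\<theta> s - \<theta> t) / (s - t)" and ?g = "Sup (log_slopes \<theta>)"
    have "\<bar>ln ?q\<bar> \<le> ?g"
      using st by (intro cSup_upper bdd) (auto simp: log_slopes_def)
    then have "- ?g \<le> ln ?q" "ln ?q \<le> ?g" by linarith+
    moreover have "0 < ?q" using less[OF st] st by simp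
    ultimately have "exp (- ?g) \<le> ?q" "?q \<le> exp ?g"
      by (simp_all add: ln_ge_iff) (metis exp_le_cancel_iff exp_ln)
    then show ?thesis using st by (auto simp: field_simps)
  qed
  have "\<bar>ln ((\<theta> 1 - \<theta> 0) / (1 - 0))\<bar> \<le> Sup (log_slopes \<theta>)"
    unfolding log_slopes_def
    by (intro cSup_upper bdd[unfolded log_slopes_def] CollectI exI[of _ "1::real"] exI[of _ "0::real"]) auto
  then show "0 \<le> Sup (log_slopes \<theta>)" by linarith
qed

lemma id_time_change: "(\<lambda>t. t) \<in> time_changes" "Sup (log_slopes (\<lambda>t. t)) = 0"
proof -
  show 1: "(\<lambda>t. t) \<in> time_changes" by (rule time_changesI(1)[where g = 0]) auto
  have "Sup (log_slopes (\<lambda>t. t)) \<le> 0" by (rule time_changesI(2)) auto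
  then show "Sup (log_slopes (\<lambda>t. t)) = 0" using time_change_Sup_nonneg[OF 1] by linarith
qed

text \<open>Slopes multiply under composition, so the bounds on their logarithms add; this is the
  time-change half of the triangle inequality.\<close>

lemma time_change_comp:
  assumes "\<theta> \<in> time_changes" "\<theta>' \<in> time_changes"
  shows "(\<lambda>t. \<theta>' (\<theta> t)) \<in> time_changes"
    and "Sup (log_slopes (\<lambda>t. \<theta>' (\<theta> t))) \<le> Sup (log_slopes \<theta>) + Sup (log_slopes \<theta>')"
proof -
  let ?g = "Sup (log_slopes \<theta>)" and ?g' = "Sup (log_slopes \<theta>')"
  have zero: "\<theta>' (\<theta> 0) = 0" using assms by (simp add: time_change_zero)
  have slopes: "exp (- (?g + ?g')) * (s - t) \<le> \<theta>' (\<theta> s) - \<theta>' (\<theta> t) \<and>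
      \<theta>' (\<theta> s) - \<theta>' (\<theta> t) \<le> exp (?g + ?g') * (s - t)" if st: "0 \<le> t" "t < s" for s t
  proof -
    note 1 = time_change_slopes[OF assms(1) st]
    note 2 = time_change_slopes[OF assms(2) time_change_nonneg[OF assms(1) st(1)] time_change_less[OF assms(1) st]]
    have "exp (- (?g + ?g')) * (s - t) = exp (- ?g') * (exp (- ?g) * (s - t))" by (simp add: exp_add[symmetric])
    also have "\<dots> \<le> exp (- ?g') * (\<theta> s - \<theta> t)" using 1 by (intro mult_left_mono) auto
    also have "\<dots> \<le> \<theta>' (\<theta> s) - \<theta>' (\<theta> t)" using 2 by simp
    finally have a: "exp (- (?g + ?g')) * (s - t) \<le> \<theta>' (\<theta> s) - \<theta>' (\<theta> t)" .
    have "\<theta>' (\<theta> s) - \<theta>' (\<theta> t) \<le> exp ?g' * (\<theta> s - \<theta> t)" using 2 by simp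
    also have "\<dots> \<le> exp ?g' * (exp ?g * (s - t))" using 1 by (intro mult_left_mono) auto
    also have "\<dots> = exp (?g + ?g') * (s - t)" by (simp add: exp_add)
    finally show ?thesis using a by blast
  qed
  show "(\<lambda>t. \<theta>' (\<theta> t)) \<in> time_changes"
    using zero slopes by (rule time_changesI(1))
  show "Sup (log_slopes (\<lambda>t. \<theta>' (\<theta> t))) \<le> ?g + ?g'"
    using zero slopes by (rule time_changesI(2))
qed

text \<open>The slopes of the inverse are reciprocals, and the absolute logarithm does not see this.
  It yields the symmetry of the Skorokhod metric.\<close>

lemma time_change_inverse:
  assumes "\<theta> \<in> time_changes"
  obtains \<theta>' where "\<theta>' \<in> time_changes" "Sup (log_slopes \<theta>') \<le> Sup (log_slopes \<theta>)"
    "\<And>t. 0 \<le> t \<Longrightarrow> \<theta> (\<theta>' t) = t" "\<And>t. 0 \<le> t \<Longrightarrow> \<theta>' (\<theta> t) = t"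
proof -
  let ?g = "Sup (log_slopes \<theta>)"
  obtain \<theta>' where \<theta>': "\<And>t. 0 \<le> t \<Longrightarrow> 0 \<le> \<theta>' t \<and> \<theta> (\<theta>' t) = t"
    using time_change_surj[OF assms] by metis
  have inj: "s = t" if "\<theta> s = \<theta> t" "0 \<le> s" "0 \<le> t" for s t
    using time_change_less[OF assms, of s t] time_change_less[OF assms, of t s] that
    by (cases s t rule: linorder_cases) auto
  have inv: "\<theta>' (\<theta> t) = t" if "0 \<le> t" for t
    using \<theta>'[of "\<theta> t"] that time_change_nonneg[OF assms that] inj by blast
  have zero: "\<theta>' 0 = 0" using inv[of 0] time_change_zero[OF assms] by simp
  have slopes: "exp (- ?g) * (s - t) \<le> \<theta>' s - \<theta>' t \<and> \<theta>' s - \<theta>' t \<le> exp ?g * (s - t)"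
    if st: "0 \<le> t" "t < s" for s t
  proof -
    have l: "\<theta>' t < \<theta>' s"
      using \<theta>'[of s] \<theta>'[of t] st time_change_le[OF assms, of "\<theta>' s" "\<theta>' t"] by force
    have "exp (- ?g) * (\<theta>' s - \<theta>' t) \<le> s - t" "s - t \<le> exp ?g * (\<theta>' s - \<theta>' t)"
      using time_change_slopes[OF assms _ l] \<theta>'[of s] \<theta>'[of t] st by auto
    then show ?thesis by (auto simp: exp_minus field_simps)
  qed
  show ?thesis
    using that time_changesI[OF zero slopes] \<theta>' inv by blast
qed

section \<open>The Skorokhod metric\<close>

text \<open>The integrand of \<open>skorokhod_dist\<close> without its weight, isolated because its
  measurability in the stopping time \<open>u\<close> has to be proved.\<close>

definition skorokhod_gap ::
  "('a \<Rightarrow> 'a \<Rightarrow> real) \<Rightarrow> (real \<Rightarrow> 'a) \<Rightarrow> (real \<Rightarrow> 'a) \<Rightarrow> (real \<Rightarrow> real) \<Rightarrow> real \<Rightarrow> real" where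
  "skorokhod_gap d x y \<theta> u = (SUP t\<in>{0..}. min 1 (d (x (min t u)) (y (min (\<theta> t) u))))"

section \<open>Integrability of the gap as a function of the stopping time\<close>

lemma exp_minus_atLeast:
  "set_integrable lborel {c..} (\<lambda>u::real. exp (- u))"
  "(LINT u:{c..}|lborel. exp (- u)) = exp (- c :: real)"
proof -
  have nn: "(\<integral>\<^sup>+u. ennreal (indicator {c..} u * exp (- u)) \<partial>lborel) = ennreal (exp (- c))"
  proof -
    have "(\<integral>\<^sup>+u. ennreal (exp (- u)) * indicator {c..} u \<partial>lborel) = ennreal (0 - - exp (- c))"
    proof (rule nn_integral_FTC_atLeast)
      show "((\<lambda>u::real. - exp (- u)) \<longlongrightarrow> 0) at_top"
        by (rule tendsto_eq_intros filterlim_compose[OF exp_at_bot] filterlim_uminus_at_bot_at_top | simp)+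
    qed (auto intro!: derivative_eq_intros)
    then show ?thesis by (simp add: ennreal_mult'' ennreal_indicator mult.commute)
  qed
  have "has_bochner_integral lborel (\<lambda>u. indicator {c..} u * exp (- u)) (exp (- c))"
    by (rule has_bochner_integral_nn_integral) (use nn in auto)
  then show "set_integrable lborel {c..} (\<lambda>u::real. exp (- u))"
    "(LINT u:{c..}|lborel. exp (- u)) = exp (- c :: real)"
    unfolding set_integrable_def set_lebesgue_integral_def
    by (simp_all add: has_bochner_integral_iff)
qed

text \<open>\<open>f u\<close> is the limit of the values of \<open>f\<close> at the next point of
  mesh \<open>1 / (n + 1)\<close> to the right of \<open>u\<close>, and that value depends on
  \<open>u\<close> only through a floor. The point is strictly to the right, so that convergence
  along \<open>at_right u\<close> applies.\<close>

lemma right_continuous_measurable: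
  fixes f :: "real \<Rightarrow> real"
  assumes "\<And>u. 0 \<le> u \<Longrightarrow> (f \<longlongrightarrow> f u) (at_right u)"
  shows "(\<lambda>u. indicator {0..} u * f u) \<in> borel_measurable borel"
proof (rule borel_measurable_LIMSEQ_real)
  let ?q = "\<lambda>n u. (real_of_int \<lfloor>real (Suc n) * u\<rfloor> + 1) / real (Suc n)"
  fix u :: real
  show "(\<lambda>n. indicator {0..} u * f (?q n u)) \<longlonglongrightarrow> indicator {0..} u * f u"
  proof (cases "0 \<le> u")
    case True
    have q: "u < ?q n u" "?q n u \<le> u + 1 / real (Suc n)" for n
    proof -
      have "real (Suc n) * u < real_of_int \<lfloor>real (Suc n) * u\<rfloor> + 1" by linarith
      then show "u < ?q n u" by (simp add: field_simps)
      have "real_of_int \<lfloor>real (Suc n) * u\<rfloor> + 1 \<le> real (Suc n) * u + 1" by linarith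
      then have "?q n u \<le> (real (Suc n) * u + 1) / real (Suc n)" by (intro divide_right_mono) auto
      then show "?q n u \<le> u + 1 / real (Suc n)" by (simp add: field_simps)
    qed
    have "(\<lambda>n. u + 1 / real (Suc n)) \<longlonglongrightarrow> u"
      using tendsto_add[OF tendsto_const LIMSEQ_inverse_real_of_nat, of u] by (simp add: inverse_eq_divide)
    then have "(\<lambda>n. ?q n u) \<longlonglongrightarrow> u"
      using q(2) less_imp_le[OF q(1)]
      by (intro tendsto_sandwich[of "\<lambda>_. u" "\<lambda>n. ?q n u" sequentially "\<lambda>n. u + 1 / real (Suc n)"])
        (auto simp del: of_nat_Suc)
    then have "filterlim (\<lambda>n. ?q n u) (at_right u) sequentially"
      using q(1) unfolding filterlim_at by (auto simp: less_imp_neq[THEN not_sym])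
    from filterlim_compose[OF assms[OF True] this] show ?thesis by (intro tendsto_mult_left) auto
  qed simp
next
  fix n
  have "(\<lambda>i::int. f ((real_of_int i + 1) / real (Suc n))) \<in> measurable (count_space UNIV) borel" by simp
  moreover have "(\<lambda>u::real. \<lfloor>real (Suc n) * u\<rfloor>) \<in> measurable borel (count_space UNIV)" by measurable
  ultimately have "(\<lambda>u. f ((real_of_int \<lfloor>real (Suc n) * u\<rfloor> + 1) / real (Suc n))) \<in> borel_measurable borel"
    using measurable_compose by fast
  then show "(\<lambda>u. indicator {0..} u * f ((real_of_int \<lfloor>real (Suc n) * u\<rfloor> + 1) / real (Suc n)))
      \<in> borel_measurable borel" by measurable
qed

lemma min_one_triangle:
  "a \<le> b + c \<Longrightarrow> 0 \<le> b \<Longrightarrow> 0 \<le> c \<Longrightarrow> min 1 a \<le> min 1 b + min 1 (c::real)"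
  by (auto simp: min_def)

context Metric_space
begin

lemma cadlag_mem: "x \<in> cadlag M d \<Longrightarrow> 0 \<le> t \<Longrightarrow> x t \<in> M"
  by (auto simp: cadlag_def PiE_iff)

lemma cadlag_right:
  assumes "x \<in> cadlag M d" "0 \<le> t" "0 < e"
  obtains h where "h > 0" "\<And>s. t \<le> s \<Longrightarrow> s < t + h \<Longrightarrow> d (x t) (x s) < e"
proof -
  have "limitin mtopology x (x t) (at_right t)" using assms by (simp add: cadlag_def)
  then have "\<forall>\<^sub>F s in at_right t. d (x s) (x t) < e"
    using assms(3) unfolding limitin_metric by (auto elim: eventually_mono)
  then obtain b where b: "b > t" "\<And>s. t < s \<Longrightarrow> s < b \<Longrightarrow> d (x s) (x t) < e"
    by (auto simp: eventually_at_right_field)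
  show ?thesis
  proof (rule that[of "b - t"])
    fix s assume "t \<le> s" "s < t + (b - t)"
    then show "d (x t) (x s) < e"
      using b assms cadlag_mem[OF assms(1)] by (cases "t = s") (auto simp: commute)
  qed (use b in auto)
qed

lemma cadlagI:
  assumes "x \<in> {0..} \<rightarrow>\<^sub>E M"
    and "\<And>t e. 0 \<le> t \<Longrightarrow> 0 < e \<Longrightarrow> \<exists>h>0. \<forall>s. t < s \<and> s < t + h \<longrightarrow> d (x s) (x t) < e"
    and "\<And>t. 0 < t \<Longrightarrow> \<exists>l. limitin mtopology x l (at_left t)"
  shows "x \<in> cadlag M d"
proof -
  have "limitin mtopology x (x t) (at_right t)" if t: "0 \<le> t" for t
    unfolding limitin_metric
  proof (intro conjI allI impI)
    show "x t \<in> M" using assms(1) t by auto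
    fix e :: real assume "e > 0"
    from assms(2)[OF t this] obtain h where "h > 0" "\<forall>s. t < s \<and> s < t + h \<longrightarrow> d (x s) (x t) < e" by blast
    then show "\<forall>\<^sub>F s in at_right t. x s \<in> M \<and> d (x s) (x t) < e"
      using assms(1) t unfolding eventually_at_right_field
      by (intro exI[of _ "t + h"]) (auto simp: PiE_iff)
  qed
  then show ?thesis using assms by (simp add: cadlag_def)
qed

lemma gap_bdd: "bdd_above ((\<lambda>t. min 1 (d (x (min t u)) (y (min (\<theta> t) u)))) ` A)"
  by (rule bdd_aboveI[of _ 1]) auto

lemma gap_upper: "0 \<le> t \<Longrightarrow> min 1 (d (x (min t u)) (y (min (\<theta> t) u))) \<le> skorokhod_gap d x y \<theta> u"
  unfolding skorokhod_gap_def by (intro cSUP_upper gap_bdd) auto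

lemma gap_least:
  "(\<And>t. 0 \<le> t \<Longrightarrow> min 1 (d (x (min t u)) (y (min (\<theta> t) u))) \<le> B) \<Longrightarrow> skorokhod_gap d x y \<theta> u \<le> B"
  unfolding skorokhod_gap_def by (intro cSUP_least) auto

lemma gap_bounds: "0 \<le> skorokhod_gap d x y \<theta> u" "skorokhod_gap d x y \<theta> u \<le> 1"
  using gap_upper[of 0 x u y \<theta>] nonneg by (auto intro: gap_least order_trans[rotated])

lemma min_dist_diff:
  assumes "a \<in> M" "b \<in> M" "a' \<in> M" "b' \<in> M"
  shows "\<bar>min 1 (d a b) - min 1 (d a' b')\<bar> \<le> d a a' + d b b'"
proof -
  have "d a b \<le> d a a' + d a' b" "d a' b \<le> d a' b' + d b' b" "d a' b' \<le> d a' a + d a b'" "d a b' \<le> d a b + d b b'"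
    using assms by (auto intro: triangle)
  then show ?thesis
    unfolding commute[of b' b] commute[of a' a] by (auto simp: min_def abs_if)
qed

text \<open>For fixed \<open>t\<close> the truncated distance is right-continuous in
  \<open>u\<close>, hence measurable. Right continuity in \<open>t\<close> reduces the supremum to
  rational \<open>t\<close>, a countable family.\<close>

lemma gap_measurable:
  assumes x: "x \<in> cadlag M d" and y: "y \<in> cadlag M d" and \<theta>: "\<theta> \<in> time_changes"
  shows "(\<lambda>u. indicator {0..} u * skorokhod_gap d x y \<theta> u) \<in> borel_measurable borel"
proof -
  let ?m = "\<lambda>t u. min 1 (d (x (min t u)) (y (min (\<theta> t) u)))"
  let ?Q = "{q \<in> \<rat>. 0 \<le> q} :: real set"
  have Q: "countable ?Q" "?Q \<noteq> {}" using countable_rat by (auto intro: countable_subset[of _ \<rat>])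
  have right: "((\<lambda>u. ?m t u) \<longlongrightarrow> ?m t u) (at_right u)" if t: "0 \<le> t" and u: "0 \<le> u" for t u
  proof (rule tendstoI)
    fix e :: real assume "e > 0"
    then have e: "e / 2 > 0" by simp
    have tu: "0 \<le> min t u" "0 \<le> min (\<theta> t) u" using t u time_change_nonneg[OF \<theta>] by auto
    obtain h1 where h1: "h1 > 0" "\<And>s. min t u \<le> s \<Longrightarrow> s < min t u + h1 \<Longrightarrow> d (x (min t u)) (x s) < e / 2"
      using cadlag_right[OF x tu(1) e] by metis
    obtain h2 where h2: "h2 > 0"
      "\<And>s. min (\<theta> t) u \<le> s \<Longrightarrow> s < min (\<theta> t) u + h2 \<Longrightarrow> d (y (min (\<theta> t) u)) (y s) < e / 2"
      using cadlag_right[OF y tu(2) e] by metis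
    have "dist (?m t v) (?m t u) < e" if v: "u < v" "v < u + min h1 h2" for v
    proof -
      have "\<bar>?m t u - ?m t v\<bar> \<le> d (x (min t u)) (x (min t v)) + d (y (min (\<theta> t) u)) (y (min (\<theta> t) v))"
        using tu v u t time_change_nonneg[OF \<theta> t] by (intro min_dist_diff cadlag_mem[OF x] cadlag_mem[OF y]) auto
      also have "\<dots> < e / 2 + e / 2"
        using v h1(1) h2(1) by (intro add_strict_mono h1(2) h2(2)) (auto simp: min_def split: if_splits)
      finally show ?thesis by (simp add: dist_real_def abs_minus_commute)
    qed
    then show "\<forall>\<^sub>F v in at_right u. dist (?m t v) (?m t u) < e"
      unfolding eventually_at_right_field using h1(1) h2(1) by (intro exI[of _ "u + min h1 h2"]) auto
  qed
  have "skorokhod_gap d x y \<theta> u = (SUP t\<in>?Q. ?m t u)" if u: "0 \<le> u" for u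
  proof (rule antisym)
    show "(SUP t\<in>?Q. ?m t u) \<le> skorokhod_gap d x y \<theta> u"
      using Q gap_upper by (intro cSUP_least) auto
    show "skorokhod_gap d x y \<theta> u \<le> (SUP t\<in>?Q. ?m t u)"
    proof (rule gap_least, rule field_le_epsilon)
      fix t e :: real assume t: "0 \<le> t" and "e > 0"
      then have e: "e / 2 > 0" by simp
      have tu: "0 \<le> min t u" "0 \<le> min (\<theta> t) u" using t u time_change_nonneg[OF \<theta>] by auto
      obtain h1 where h1: "h1 > 0" "\<And>s. min t u \<le> s \<Longrightarrow> s < min t u + h1 \<Longrightarrow> d (x (min t u)) (x s) < e / 2"
        using cadlag_right[OF x tu(1) e] by metis
      obtain h2 where h2: "h2 > 0"
        "\<And>s. min (\<theta> t) u \<le> s \<Longrightarrow> s < min (\<theta> t) u + h2 \<Longrightarrow> d (y (min (\<theta> t) u)) (y s) < e / 2"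
        using cadlag_right[OF y tu(2) e] by metis
      let ?g = "Sup (log_slopes \<theta>)"
      \<comment> \<open>A rational to the right of \<open>t\<close>; the factor
        \<open>exp (- ?g)\<close> compensates the largest slope of \<theta>, so that \<theta> moves
        by less than \<open>h2\<close>.\<close>
      have "t < t + min h1 (exp (- ?g) * h2)" using h1 h2 by simp
      then obtain q where q: "q \<in> \<rat>" "t < q" "q < t + min h1 (exp (- ?g) * h2)"
        using Rats_dense_in_real by blast
      have "\<theta> q - \<theta> t \<le> exp ?g * (q - t)" using time_change_slopes[OF \<theta> t q(2)] by simp
      also have "\<dots> < exp ?g * (exp (- ?g) * h2)" using q by (intro mult_strict_left_mono) auto
      also have "\<dots> = h2" by (simp add: exp_minus)
      finally have \<theta>q: "\<theta> q < \<theta> t + h2" by simp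
      have \<theta>tq: "\<theta> t < \<theta> q" using time_change_less[OF \<theta> t q(2)] .
      have "\<bar>?m t u - ?m q u\<bar> \<le> d (x (min t u)) (x (min q u)) + d (y (min (\<theta> t) u)) (y (min (\<theta> q) u))"
        using tu q(2) u t \<theta>tq time_change_nonneg[OF \<theta> t]
        by (intro min_dist_diff cadlag_mem[OF x] cadlag_mem[OF y]) auto
      also have "\<dots> < e / 2 + e / 2"
        using q \<theta>q \<theta>tq h1(1) h2(1) by (intro add_strict_mono h1(2) h2(2)) (auto simp: min_def split: if_splits)
      finally have "\<bar>?m t u - ?m q u\<bar> < e" by simp
      then have "?m t u \<le> ?m q u + e" unfolding abs_less_iff by simp
      also have "?m q u \<le> (SUP t\<in>?Q. ?m t u)"
        using q t by (intro cSUP_upper gap_bdd) auto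
      finally show "?m t u \<le> (SUP t\<in>?Q. ?m t u) + e" by simp
    qed
  qed
  then have eq: "(\<lambda>u. indicator {0..} u * skorokhod_gap d x y \<theta> u) =
      (\<lambda>u. indicator {0..} u * (SUP t\<in>?Q. indicator {0..} u * ?m t u))"
    by (auto simp: fun_eq_iff indicator_def)
  have m: "(\<lambda>u. indicator {0..} u * ?m t u) \<in> borel_measurable borel" if "t \<in> ?Q" for t
    using that by (intro right_continuous_measurable right) auto
  have [measurable]: "(\<lambda>u. SUP t\<in>?Q. indicator {0..} u * ?m t u) \<in> borel_measurable borel"
    by (rule borel_measurable_cSUP[OF Q(1) m]) (auto intro!: bdd_aboveI[of _ 1] simp: indicator_def)
  show ?thesis unfolding eq by measurable
qed

lemma gap_integrable:
  assumes "x \<in> cadlag M d" "y \<in> cadlag M d" "\<theta> \<in> time_changes"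
  shows "set_integrable lborel {0..} (\<lambda>u. exp (- u) * skorokhod_gap d x y \<theta> u)"
proof -
  note [measurable] = gap_measurable[OF assms]
  show ?thesis
  proof (rule set_integrable_bound[OF exp_minus_atLeast(1)[of 0]])
    have "(\<lambda>u. exp (- u) * (indicator {0..} u * skorokhod_gap d x y \<theta> u)) \<in> borel_measurable lborel"
      by measurable
    then show "set_borel_measurable lborel {0..} (\<lambda>u. exp (- u) * skorokhod_gap d x y \<theta> u)"
      unfolding set_borel_measurable_def by (simp add: mult_ac)
    show "AE u in lborel. u \<in> {0..} \<longrightarrow> norm (exp (- u) * skorokhod_gap d x y \<theta> u) \<le> norm (exp (- u))"
      using gap_bounds by (auto simp: abs_mult)
  qed
qed

definition gap_integral :: "(real \<Rightarrow> 'a) \<Rightarrow> (real \<Rightarrow> 'a) \<Rightarrow> (real \<Rightarrow> real) \<Rightarrow> real" where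
  "gap_integral x y \<theta> = (LINT u:{0..}|lborel. exp (- u) * skorokhod_gap d x y \<theta> u)"

lemma gap_integral_nonneg: "0 \<le> gap_integral x y \<theta>"
  unfolding gap_integral_def set_lebesgue_integral_def
  by (intro integral_nonneg_AE) (auto simp: gap_bounds)

lemma gap_integral_mono:
  assumes "x \<in> cadlag M d" "y \<in> cadlag M d" "\<theta> \<in> time_changes" "set_integrable lborel {0..} f"
    and "\<And>u. 0 \<le> u \<Longrightarrow> exp (- u) * skorokhod_gap d x y \<theta> u \<le> f u"
  shows "gap_integral x y \<theta> \<le> (LINT u:{0..}|lborel. f u)"
  unfolding gap_integral_def using assms by (intro set_integral_mono gap_integrable) auto

lemma skorokhod_dist_eq:
  "skorokhod_dist d x y = (INF \<theta>\<in>time_changes. max (Sup (log_slopes \<theta>)) (gap_integral x y \<theta>))"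
  unfolding skorokhod_dist_def gap_integral_def skorokhod_gap_def ..

lemma skorokhod_dist_bdd: "bdd_below ((\<lambda>\<theta>. max (Sup (log_slopes \<theta>)) (gap_integral x y \<theta>)) ` A)"
  by (rule bdd_belowI[of _ 0]) (auto simp: gap_integral_nonneg le_max_iff_disj)

lemma skorokhod_dist_le:
  "\<theta> \<in> time_changes \<Longrightarrow> Sup (log_slopes \<theta>) \<le> e \<Longrightarrow> gap_integral x y \<theta> \<le> e \<Longrightarrow> skorokhod_dist d x y \<le> e"
  unfolding skorokhod_dist_eq by (rule cINF_lower2[OF skorokhod_dist_bdd]) auto

lemma skorokhod_dist_lessD:
  assumes "skorokhod_dist d x y < e"
  obtains \<theta> where "\<theta> \<in> time_changes" "Sup (log_slopes \<theta>) < e" "gap_integral x y \<theta> < e"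
  using assms id_time_change(1) unfolding skorokhod_dist_eq
  by (subst (asm) cINF_less_iff) (auto simp: skorokhod_dist_bdd)

lemma skorokhod_dist_nonneg: "0 \<le> skorokhod_dist d x y"
  unfolding skorokhod_dist_eq using id_time_change(1)
  by (intro cINF_greatest) (auto simp: gap_integral_nonneg le_max_iff_disj)

text \<open>If the gap were at least \<open>r'\<close> at every stopping time past
  \<open>T'\<close>, its weighted integral would be at least \<open>r' * exp (- T')\<close>, more
  than \<eta> allows. So some \<open>u\<close> past \<open>T'\<close> has a gap below
  \<open>r'\<close>, and stopping there does not affect the times up to \<open>T\<close>.\<close>

lemma skorokhod_dist_close:
  assumes "x \<in> cadlag M d" "0 \<le> T" "0 < r"
  obtains \<eta> where "\<eta> > 0"
    "\<And>y. y \<in> cadlag M d \<Longrightarrow> skorokhod_dist d x y < \<eta> \<Longrightarrow>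
      \<exists>\<theta>\<in>time_changes. \<forall>t. 0 \<le> t \<and> t \<le> T \<longrightarrow> \<bar>\<theta> t - t\<bar> < r \<and> d (x t) (y (\<theta> t)) < r"
proof -
  \<comment> \<open>A radius below 1 makes the truncation \<open>min 1\<close> in the gap
    inactive.\<close>
  define r' where "r' = min r (1 / 2)"
  have r': "0 < r'" "r' \<le> r" "r' < 1" using assms by (auto simp: r'_def)
  \<comment> \<open>Slopes within \<open>exp g\<close> displace a time \<open>t\<close> in
    \<open>[0, T]\<close> by at most \<open>r' * t / (T + 1)\<close>, which is less than
    \<open>r'\<close>; \<open>T + 1\<close> covers the case \<open>T = 0\<close>.\<close>
  define g where "g = ln (1 + r' / (T + 1))"
  have g: "0 < g" "exp g = 1 + r' / (T + 1)" using r' assms by (auto simp: g_def add_pos_pos)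
  \<comment> \<open>The time change may carry \<open>t \<le> T\<close> beyond \<open>T\<close>, but
    by less than \<open>r'\<close>.\<close>
  define T' where "T' = T + r'"
  define \<eta> where "\<eta> = min g (r' * exp (- T' - 1))"
  show ?thesis
  proof (rule that)
    show "\<eta> > 0" using g r' by (simp add: \<eta>_def)
    fix y assume y: "y \<in> cadlag M d" and "skorokhod_dist d x y < \<eta>"
    then obtain \<theta> where \<theta>: "\<theta> \<in> time_changes" "Sup (log_slopes \<theta>) < \<eta>" "gap_integral x y \<theta> < \<eta>"
      using skorokhod_dist_lessD by blast
    have near: "\<bar>\<theta> t - t\<bar> < r'" if t: "0 \<le> t" "t \<le> T" for t
    proof (cases "t = 0")
      case True then show ?thesis using r' time_change_zero[OF \<theta>(1)] by simp
    next
      case False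
      then have t0: "0 < t" using t by simp
      have S: "Sup (log_slopes \<theta>) \<le> g" using \<theta>(2) by (simp add: \<eta>_def)
      have "exp (- g) * t \<le> exp (- Sup (log_slopes \<theta>)) * t" "exp (Sup (log_slopes \<theta>)) * t \<le> exp g * t"
        using S t by (auto intro!: mult_right_mono)
      with time_change_slopes[OF \<theta>(1) order.refl t0] time_change_zero[OF \<theta>(1)]
      have b: "exp (- g) * t \<le> \<theta> t" "\<theta> t \<le> exp g * t" by auto
      have q: "r' / (T + 1) * t < r'"
      proof -
        have "r' * t < r' * (T + 1)" using t r' by (intro mult_strict_left_mono) auto
        then have "r' * t / (T + 1) < r'" using assms(2) by (subst pos_divide_less_eq) auto
        then show ?thesis by simp
      qed
      have "exp g * t < t + r'" unfolding g(2) using q by (simp add: distrib_right)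
      moreover have "t - r' < exp (- g) * t"
      proof -
        have "1 - r' / (T + 1) \<le> exp (- g)"
        proof -
          let ?a = "r' / (T + 1)"
          have a: "0 \<le> ?a" using r' assms by auto
          have "1 + - ?a \<le> exp (- ?a)" by (rule exp_ge_add_one_self)
          also have "- ?a \<le> - g" using ln_add_one_self_le_self[OF a] by (simp add: g_def)
          then have "exp (- ?a) \<le> exp (- g)" by simp
          finally show ?thesis by simp
        qed
        then have "(1 - r' / (T + 1)) * t \<le> exp (- g) * t" using t by (intro mult_right_mono)
        then show ?thesis using q by (simp add: left_diff_distrib)
      qed
      ultimately show ?thesis using b by linarith
    qed
    have "\<exists>u\<ge>T'. skorokhod_gap d x y \<theta> u < r'"
    proof (rule ccontr)
      assume "\<not> ?thesis"
      then have *: "r' \<le> skorokhod_gap d x y \<theta> u" if "T' \<le> u" for u using that by force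
      have "r' * exp (- T') = (LINT u:{T'..}|lborel. r' * exp (- u))"
        by (simp add: exp_minus_atLeast set_integral_mult_right)
      also have "\<dots> = (LINT u:{0..}|lborel. indicator {T'..} u * (r' * exp (- u)))"
        unfolding set_lebesgue_integral_def using r' assms(2) T'_def
        by (intro Bochner_Integration.integral_cong) (auto simp: indicator_def)
      also have "\<dots> \<le> gap_integral x y \<theta>"
        unfolding gap_integral_def
      proof (rule set_integral_mono[OF _ gap_integrable[OF assms(1) y \<theta>(1)]])
        have "set_integrable lborel {T'..} (\<lambda>u. r' * exp (- u))" using exp_minus_atLeast by auto
        then show "set_integrable lborel {0..} (\<lambda>u. indicator {T'..} u * (r' * exp (- u)))"
          unfolding set_integrable_def by (rule Bochner_Integration.integrable_cong[THEN iffD1, rotated 2])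
            (use r' assms(2) T'_def in \<open>auto simp: indicator_def\<close>)
        fix u :: real assume "u \<in> {0..}"
        show "indicator {T'..} u * (r' * exp (- u)) \<le> exp (- u) * skorokhod_gap d x y \<theta> u"
          using *[of u] gap_bounds[of x y \<theta> u] by (auto simp: indicator_def mult.commute)
      qed
      also have "\<dots> < r' * exp (- T' - 1)" using \<theta>(3) by (simp add: \<eta>_def)
      also have "\<dots> \<le> r' * exp (- T')" using r' by (intro mult_left_mono) auto
      finally show False by simp
    qed
    then obtain u where u: "T' \<le> u" "skorokhod_gap d x y \<theta> u < r'" by blast
    have "\<bar>\<theta> t - t\<bar> < r \<and> d (x t) (y (\<theta> t)) < r" if t: "0 \<le> t" "t \<le> T" for t
    proof -
      have "\<theta> t \<le> u" "t \<le> u" using near[OF t] t u(1) r' by (auto simp: T'_def)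
      then have "min 1 (d (x t) (y (\<theta> t))) < r'"
        using gap_upper[OF t(1), of x u y \<theta>] u(2) by (simp add: min_absorb1)
      then show ?thesis using near[OF t] r' by (auto simp: min_def split: if_splits)
    qed
    then show "\<exists>\<theta>\<in>time_changes. \<forall>t. 0 \<le> t \<and> t \<le> T \<longrightarrow> \<bar>\<theta> t - t\<bar> < r \<and> d (x t) (y (\<theta> t)) < r"
      using \<theta>(1) by blast
  qed
qed

section \<open>The metric axioms\<close>

lemma skorokhod_dist_refl:
  assumes "x \<in> cadlag M d" shows "skorokhod_dist d x x = 0"
proof -
  have "skorokhod_gap d x x (\<lambda>t. t) u = 0" if "0 \<le> u" for u
    using gap_bounds[of x x "\<lambda>t. t" u] cadlag_mem[OF assms] that
    by (intro antisym gap_least) auto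
  then have "(\<lambda>u. indicator {0..} u *\<^sub>R (exp (- u) * skorokhod_gap d x x (\<lambda>t. t) u)) = (\<lambda>u. 0)"
    by (auto simp: indicator_def)
  then have "gap_integral x x (\<lambda>t. t) = 0"
    unfolding gap_integral_def set_lebesgue_integral_def by simp
  then have "skorokhod_dist d x x \<le> 0"
    by (intro skorokhod_dist_le[OF id_time_change(1)]) (auto simp: id_time_change)
  then show ?thesis using skorokhod_dist_nonneg[of x x] by linarith
qed

text \<open>The paths cannot be compared at \<open>s\<close> directly, because a time change may
  move \<open>s\<close> to the left, across a jump. They are compared at \<open>s + h / 2\<close>,
  where both are still close to their values at \<open>s\<close> and a displacement below
  \<open>h / 2\<close> stays to the right of \<open>s\<close>.\<close>

lemma skorokhod_dist_eq_0D:
  assumes x: "x \<in> cadlag M d" and y: "y \<in> cadlag M d" and "skorokhod_dist d x y = 0"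
  shows "x = y"
proof -
  have "x s = y s" if s: "0 \<le> s" for s
  proof -
    have "d (x s) (y s) \<le> e" if e: "e > 0" for e
    proof -
      have e3: "e / 3 > 0" using e by simp
      obtain h1 where h1: "h1 > 0" "\<And>t. s \<le> t \<Longrightarrow> t < s + h1 \<Longrightarrow> d (x s) (x t) < e / 3"
        using cadlag_right[OF x s e3] by metis
      obtain h2 where h2: "h2 > 0" "\<And>t. s \<le> t \<Longrightarrow> t < s + h2 \<Longrightarrow> d (y s) (y t) < e / 3"
        using cadlag_right[OF y s e3] by metis
      define h where "h = min h1 h2"
      have h: "h > 0" using h1 h2 by (simp add: h_def)
      have r: "0 < min (e / 3) (h / 2)" "0 \<le> s + h / 2" using e h s by auto
      obtain \<theta> where \<theta>: "\<theta> \<in> time_changes"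
        "\<And>t. 0 \<le> t \<and> t \<le> s + h / 2 \<Longrightarrow> \<bar>\<theta> t - t\<bar> < min (e / 3) (h / 2) \<and> d (x t) (y (\<theta> t)) < min (e / 3) (h / 2)"
        using skorokhod_dist_close[OF x r(2,1)] assms(3) y by metis
      let ?t = "s + h / 2"
      have t: "\<bar>\<theta> ?t - ?t\<bar> < h / 2" "d (x ?t) (y (\<theta> ?t)) < e / 3" using \<theta>(2)[of ?t] r s by auto
      have "d (x s) (x ?t) < e / 3" using h by (intro h1) (auto simp: h_def)
      moreover have "d (y s) (y (\<theta> ?t)) < e / 3"
      proof (rule h2(2))
        have "h \<le> h2" by (simp add: h_def)
        then show "s \<le> \<theta> ?t" "\<theta> ?t < s + h2" using t(1) h by linarith+
      qed
      moreover have "0 \<le> \<theta> ?t" using t(1) s by linarith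
      ultimately show ?thesis
        using t(2) triangle[OF cadlag_mem[OF x s] cadlag_mem[OF x r(2)] cadlag_mem[OF y, of "\<theta> ?t"]]
          triangle[OF cadlag_mem[OF x s] cadlag_mem[OF y, of "\<theta> ?t"] cadlag_mem[OF y s]]
          commute[of "y s" "y (\<theta> ?t)"]
        by linarith
    qed
    then have "d (x s) (y s) \<le> 0" by (rule field_le_epsilon[of _ 0, simplified])
    then show ?thesis using cadlag_mem[OF x s] cadlag_mem[OF y s] nonneg[of "x s" "y s"] zero by force
  qed
  then show ?thesis
    using x y unfolding cadlag_def by (intro PiE_ext[of x "{0..}" "\<lambda>_. M" y]) auto
qed

text \<open>The inverse time change runs through the same pairs of times, so the gap is unchanged at
  every \<open>u\<close>.\<close>

lemma skorokhod_dist_commute_le: "skorokhod_dist d y x \<le> skorokhod_dist d x y"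
proof (rule field_le_epsilon)
  fix e :: real assume "e > 0"
  then obtain \<theta> where \<theta>: "\<theta> \<in> time_changes" "Sup (log_slopes \<theta>) < skorokhod_dist d x y + e"
    "gap_integral x y \<theta> < skorokhod_dist d x y + e"
    using skorokhod_dist_lessD[of x y "skorokhod_dist d x y + e"] by auto
  obtain \<theta>' where \<theta>': "\<theta>' \<in> time_changes" "Sup (log_slopes \<theta>') \<le> Sup (log_slopes \<theta>)"
    "\<And>t. 0 \<le> t \<Longrightarrow> \<theta> (\<theta>' t) = t" "\<And>t. 0 \<le> t \<Longrightarrow> \<theta>' (\<theta> t) = t"
    using time_change_inverse[OF \<theta>(1)] by metis
  have "skorokhod_gap d y x \<theta>' u = skorokhod_gap d x y \<theta> u" for u
  proof (rule antisym; rule gap_least)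
    fix t :: real assume "0 \<le> t"
    then show "min 1 (d (y (min t u)) (x (min (\<theta>' t) u))) \<le> skorokhod_gap d x y \<theta> u"
      using gap_upper[OF time_change_nonneg[OF \<theta>'(1)], of t x u y \<theta>] \<theta>'(3)[of t] by (simp add: commute)
  next
    fix t :: real assume "0 \<le> t"
    then show "min 1 (d (x (min t u)) (y (min (\<theta> t) u))) \<le> skorokhod_gap d y x \<theta>' u"
      using gap_upper[OF time_change_nonneg[OF \<theta>(1)], of t y u x \<theta>'] \<theta>'(4)[of t] by (simp add: commute)
  qed
  then have "gap_integral y x \<theta>' = gap_integral x y \<theta>" by (simp add: gap_integral_def)
  then show "skorokhod_dist d y x \<le> skorokhod_dist d x y + e"
    using \<theta> \<theta>' by (intro skorokhod_dist_le[OF \<theta>'(1)]) auto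
qed

lemma skorokhod_dist_triangle:
  assumes x: "x \<in> cadlag M d" and y: "y \<in> cadlag M d" and z: "z \<in> cadlag M d"
  shows "skorokhod_dist d x z \<le> skorokhod_dist d x y + skorokhod_dist d y z"
proof (rule field_le_epsilon)
  fix e :: real assume "e > 0"
  then have e: "e / 2 > 0" by simp
  let ?a = "skorokhod_dist d x y" and ?b = "skorokhod_dist d y z"
  obtain \<theta> where \<theta>: "\<theta> \<in> time_changes" "Sup (log_slopes \<theta>) < ?a + e / 2" "gap_integral x y \<theta> < ?a + e / 2"
    using skorokhod_dist_lessD[of x y "?a + e / 2"] e by auto
  obtain \<theta>' where \<theta>': "\<theta>' \<in> time_changes" "Sup (log_slopes \<theta>') < ?b + e / 2" "gap_integral y z \<theta>' < ?b + e / 2"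
    using skorokhod_dist_lessD[of y z "?b + e / 2"] e by auto
  let ?c = "\<lambda>t. \<theta>' (\<theta> t)"
  note c = time_change_comp[OF \<theta>(1) \<theta>'(1)]
  have "gap_integral x z ?c \<le> (LINT u:{0..}|lborel. exp (- u) * skorokhod_gap d x y \<theta> u + exp (- u) * skorokhod_gap d y z \<theta>' u)"
  proof (rule gap_integral_mono[OF x z c(1)])
    show "set_integrable lborel {0..} (\<lambda>u. exp (- u) * skorokhod_gap d x y \<theta> u + exp (- u) * skorokhod_gap d y z \<theta>' u)"
      using gap_integrable[OF x y \<theta>(1)] gap_integrable[OF y z \<theta>'(1)] by (rule set_integral_add(1))
    fix u :: real assume u: "0 \<le> u"
    have "skorokhod_gap d x z ?c u \<le> skorokhod_gap d x y \<theta> u + skorokhod_gap d y z \<theta>' u"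
    proof (rule gap_least)
      fix t :: real assume t: "0 \<le> t"
      note n = time_change_nonneg[OF \<theta>(1) t] time_change_nonneg[OF \<theta>'(1) time_change_nonneg[OF \<theta>(1) t]]
      have "d (x (min t u)) (z (min (?c t) u)) \<le>
          d (x (min t u)) (y (min (\<theta> t) u)) + d (y (min (\<theta> t) u)) (z (min (?c t) u))"
        using n t u by (intro triangle cadlag_mem[OF x] cadlag_mem[OF y] cadlag_mem[OF z]) auto
      then have "min 1 (d (x (min t u)) (z (min (?c t) u))) \<le>
          min 1 (d (x (min t u)) (y (min (\<theta> t) u))) + min 1 (d (y (min (\<theta> t) u)) (z (min (?c t) u)))"
        by (rule min_one_triangle[OF _ nonneg nonneg])
      also have "\<dots> \<le> skorokhod_gap d x y \<theta> u + skorokhod_gap d y z \<theta>' u"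
        using t n by (intro add_mono gap_upper) auto
      finally show "min 1 (d (x (min t u)) (z (min (?c t) u))) \<le> skorokhod_gap d x y \<theta> u + skorokhod_gap d y z \<theta>' u" .
    qed
    then show "exp (- u) * skorokhod_gap d x z ?c u \<le>
        exp (- u) * skorokhod_gap d x y \<theta> u + exp (- u) * skorokhod_gap d y z \<theta>' u"
      by (simp add: distrib_left[symmetric])
  qed
  also have "\<dots> = gap_integral x y \<theta> + gap_integral y z \<theta>'"
    unfolding gap_integral_def by (rule set_integral_add(2)[OF gap_integrable[OF x y \<theta>(1)] gap_integrable[OF y z \<theta>'(1)]])
  finally have "gap_integral x z ?c < ?a + ?b + e" using \<theta>(3) \<theta>'(3) by (simp add: field_simps)
  then show "skorokhod_dist d x z \<le> ?a + ?b + e"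
    using \<theta> \<theta>' c by (intro skorokhod_dist_le[OF c(1)]) auto
qed

lemma Metric_space_skorokhod: "Metric_space (cadlag M d) (skorokhod_dist d)"
proof
  show "0 \<le> skorokhod_dist d x y" for x y by (rule skorokhod_dist_nonneg)
next
  fix x y
  show "skorokhod_dist d x y = skorokhod_dist d y x"
    by (intro antisym skorokhod_dist_commute_le)
next
  fix x y assume "x \<in> cadlag M d" "y \<in> cadlag M d"
  then show "skorokhod_dist d x y = 0 \<longleftrightarrow> x = y"
    using skorokhod_dist_refl skorokhod_dist_eq_0D by blast
qed (rule skorokhod_dist_triangle)

section \<open>Closed sets of paths and measurability of evaluation\<close>

interpretation sk: Metric_space "cadlag M d" "skorokhod_dist d"
  by (rule Metric_space_skorokhod)

lemma skorokhod_topology_eq: "skorokhod_topology M d = sk.mtopology"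
  by (simp add: skorokhod_topology_def)

text \<open>A path outside the set leaves \<open>F\<close> at some \<open>u0\<close> and, by right
  continuity, keeps its distance from \<open>F\<close> for a while. The test point is
  \<open>u = u0 + k / 2\<close> rather than \<open>u0\<close>: a small time change then cannot push
  it out of \<open>[a, b)\<close>, even if \<open>u0 = a\<close>.\<close>

lemma closedin_path_in:
  assumes F: "closedin mtopology F" and ab: "0 \<le> a"
  shows "closedin sk.mtopology {x \<in> cadlag M d. \<forall>u\<in>{a..<b}. x u \<in> F}" (is "closedin _ ?S")
  unfolding sk.closedin_metric
proof (intro conjI allI impI)
  fix x assume x': "x \<in> cadlag M d - ?S"
  then have x: "x \<in> cadlag M d" by simp
  from x' obtain u0 where u0: "a \<le> u0" "u0 < b" "x u0 \<notin> F" by auto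
  have "x u0 \<in> M" using u0 ab by (intro cadlag_mem[OF x]) auto
  then obtain r where r: "r > 0" "disjnt F (mball (x u0) r)"
    using F u0(3) unfolding closedin_metric by blast
  have u0': "0 \<le> u0" "0 < r / 2" using u0 ab r by auto
  obtain h where h: "h > 0" "\<And>s. u0 \<le> s \<Longrightarrow> s < u0 + h \<Longrightarrow> d (x u0) (x s) < r / 2"
    using cadlag_right[OF x u0'] by metis
  define k where "k = min h (b - u0)"
  have k: "k > 0" "k \<le> h" "u0 + k \<le> b" using h u0 by (auto simp: k_def)
  define u where "u = u0 + k / 2"
  have u: "a < u" "u < b" "0 \<le> u" using k u0 ab by (auto simp: u_def)
  have du: "d (x u0) (x u) < r / 2" using k by (intro h(2)) (auto simp: u_def)
  define q where "q = min (r / 2) (k / 2)"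
  have q: "q > 0" using r k by (simp add: q_def)
  obtain \<eta> where \<eta>: "\<eta> > 0"
    "\<And>y. y \<in> cadlag M d \<Longrightarrow> skorokhod_dist d x y < \<eta> \<Longrightarrow>
      \<exists>\<theta>\<in>time_changes. \<forall>t. 0 \<le> t \<and> t \<le> u \<longrightarrow> \<bar>\<theta> t - t\<bar> < q \<and> d (x t) (y (\<theta> t)) < q"
    using skorokhod_dist_close[OF x u(3) q] by metis
  show "\<exists>r>0. disjnt ?S (sk.mball x r)"
    unfolding disjnt_iff
  proof (rule exI[of _ \<eta>], intro conjI \<eta>(1) allI notI, elim conjE)
    fix y assume y: "y \<in> ?S" "y \<in> sk.mball x \<eta>"
    then obtain \<theta> where \<theta>: "\<theta> \<in> time_changes" "\<bar>\<theta> u - u\<bar> < q" "d (x u) (y (\<theta> u)) < q"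
      using \<eta>(2)[of y] u(3) by (auto simp: sk.in_mball)
    have "u - k / 2 < \<theta> u" "\<theta> u < u + k / 2" using \<theta>(2) unfolding q_def by linarith+
    then have \<theta>u: "a \<le> \<theta> u" "\<theta> u < b" using u0 k by (auto simp: u_def)
    have "y (\<theta> u) \<in> F" using y \<theta>u by auto
    moreover have "y (\<theta> u) \<in> mball (x u0) r"
      unfolding in_mball
    proof (intro conjI)
      show 1: "x u0 \<in> M" "y (\<theta> u) \<in> M"
        using y \<theta>u u0 ab by (auto intro!: cadlag_mem[OF x] cadlag_mem[of y])
      have "d (x u) (y (\<theta> u)) < r / 2" using \<theta>(3) by (simp add: q_def)
      then show "d (x u0) (y (\<theta> u)) < r"
        using triangle[OF 1(1) cadlag_mem[OF x u(3)] 1(2)] du by simp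
    qed
    ultimately show False using r(2) by (auto simp: disjnt_iff)
  qed
qed auto

lemma sets_borel_skorokhod:
  "closedin sk.mtopology A \<Longrightarrow> A \<in> sets (borel_measure_space (skorokhod_topology M d))"
  "space (borel_measure_space (skorokhod_topology M d)) = cadlag M d"
proof -
  have pow: "{U. openin sk.mtopology U} \<subseteq> Pow (cadlag M d)"
    using openin_subset by fastforce
  show sp: "space (borel_measure_space (skorokhod_topology M d)) = cadlag M d"
    unfolding borel_measure_space_def skorokhod_topology_eq using pow by (simp add: space_measure_of_conv)
  assume A: "closedin sk.mtopology A"
  then have "cadlag M d - A \<in> sets (borel_measure_space (skorokhod_topology M d))"
    unfolding borel_measure_space_def skorokhod_topology_eq using pow
    by (auto simp: closedin_def intro!: sigma_sets.Basic)
  from sets.compl_sets[OF this] show "A \<in> sets (borel_measure_space (skorokhod_topology M d))"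
    using closedin_subset[OF A] by (simp add: sp double_diff)
qed

text \<open>Evaluation at a fixed time is not continuous. The event is exhausted by the paths that stay in
  a closed subset of \<open>U\<close> for a short time after \<open>s\<close>, and these form closed sets.\<close>

lemma evaluation_measurable:
  assumes U: "openin mtopology U" and s: "0 \<le> s"
  shows "{x \<in> cadlag M d. x s \<in> U} \<in> sets (borel_measure_space (skorokhod_topology M d))"
proof -
  let ?F = "\<lambda>k. {m \<in> M. mball m (1 / real (Suc k)) \<subseteq> U}"
  let ?A = "\<lambda>k l. {x \<in> cadlag M d. \<forall>u\<in>{s..<s + 1 / real (Suc l)}. x u \<in> ?F k}"
  have F: "closedin mtopology (?F k)" for k
    unfolding closedin_metric
  proof (intro conjI allI impI)
    fix m assume m: "m \<in> M - ?F k"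
    then obtain z where z: "z \<in> mball m (1 / real (Suc k))" "z \<notin> U" by blast
    let ?r = "1 / real (Suc k) - d m z"
    have r: "?r > 0" using z by (simp add: in_mball)
    have "disjnt (?F k) (mball m ?r)"
      unfolding disjnt_iff
    proof (intro allI notI, elim conjE)
      fix y assume y: "y \<in> ?F k" "y \<in> mball m ?r"
      have "d y z \<le> d m y + d m z" using y z m triangle[of y m z] by (auto simp: in_mball commute)
      then have "z \<in> mball y (1 / real (Suc k))" using y z by (auto simp: in_mball)
      then show False using y z by auto
    qed
    then show "\<exists>r>0. disjnt (?F k) (mball m r)" using r by blast
  qed auto
  have "{x \<in> cadlag M d. x s \<in> U} = (\<Union>k. \<Union>l. ?A k l)"
  proof (intro set_eqI iffI)
    fix x assume x: "x \<in> {x \<in> cadlag M d. x s \<in> U}"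
    then have xc: "x \<in> cadlag M d" by simp
    from x U obtain r where r: "r > 0" "mball (x s) r \<subseteq> U" by (auto simp: openin_mtopology)
    then obtain k where k: "1 / real (Suc k) < r / 2"
      using nat_approx_posE[of "r / 2"] by auto
    have "0 < r / 2" using r by simp
    then obtain h where h: "h > 0" "\<And>t. s \<le> t \<Longrightarrow> t < s + h \<Longrightarrow> d (x s) (x t) < r / 2"
      using cadlag_right[OF xc s] by metis
    obtain l where l: "1 / real (Suc l) < h" using nat_approx_posE[OF h(1)] by auto
    have "x \<in> ?A k l"
    proof (intro CollectI conjI ballI xc)
      fix u assume u: "u \<in> {s..<s + 1 / real (Suc l)}"
      show "x u \<in> M" using u s by (intro cadlag_mem[OF xc]) auto
      have du: "d (x s) (x u) < r / 2" using u l by (intro h(2)) auto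
      show "mball (x u) (1 / real (Suc k)) \<subseteq> U"
      proof
        fix z assume z: "z \<in> mball (x u) (1 / real (Suc k))"
        then have "d (x s) z < r"
          using triangle[OF cadlag_mem[OF xc s], of "x u" z] du k by (auto simp: in_mball)
        then have "z \<in> mball (x s) r" using z cadlag_mem[OF xc s] by (auto simp: in_mball)
        then show "z \<in> U" using r(2) by blast
      qed
    qed
    then show "x \<in> (\<Union>k. \<Union>l. ?A k l)" by blast
  next
    fix x assume "x \<in> (\<Union>k. \<Union>l. ?A k l)"
    then obtain k l where x: "x \<in> ?A k l" by blast
    then have "x s \<in> ?F k" by auto
    then have "x s \<in> U" by (auto simp: subset_iff in_mball)
    then show "x \<in> {x \<in> cadlag M d. x s \<in> U}" using x by blast
  qed
  moreover have "?A k l \<in> sets (borel_measure_space (skorokhod_topology M d))" for k l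
    by (intro sets_borel_skorokhod closedin_path_in F s)
  ultimately show ?thesis by auto
qed

end

section \<open>Relative compactness of sets of paths\<close>

text \<open>McShane extension from finitely many nodes: the lower envelope of the cones of slope
  \<open>l\<close> over the prescribed values.\<close>

lemma lipschitz_interpolation:
  fixes a g :: "nat \<Rightarrow> real"
  assumes "\<And>i j. i \<le> I \<Longrightarrow> j \<le> I \<Longrightarrow> \<bar>g i - g j\<bar> \<le> l * \<bar>a i - a j\<bar>" "0 \<le> l"
  obtains h where "\<And>i. i \<le> I \<Longrightarrow> h (a i) = g i" "\<And>s t. \<bar>h s - h t\<bar> \<le> l * \<bar>s - t\<bar>"
proof -
  define h where "h t = Min ((\<lambda>i. g i + l * \<bar>t - a i\<bar>) ` {..I})" for t
  have le: "h t \<le> g i + l * \<bar>t - a i\<bar>" if "i \<le> I" for i t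
    unfolding h_def using that by (intro Min_le) auto
  have ex: "\<exists>i\<le>I. h t = g i + l * \<bar>t - a i\<bar>" for t
  proof -
    have "h t \<in> (\<lambda>i. g i + l * \<bar>t - a i\<bar>) ` {..I}" unfolding h_def by (intro Min_in) auto
    then show ?thesis by auto
  qed
  have one: "h s \<le> h t + l * \<bar>s - t\<bar>" for s t
  proof -
    obtain i where i: "i \<le> I" "h t = g i + l * \<bar>t - a i\<bar>" using ex by blast
    have "l * \<bar>s - a i\<bar> \<le> l * (\<bar>t - a i\<bar> + \<bar>s - t\<bar>)" using assms(2) by (intro mult_left_mono) auto
    then show ?thesis using le[OF i(1), of s] i(2) by (simp add: distrib_left)
  qed
  show ?thesis
  proof (rule that)
    fix i assume i: "i \<le> I"
    obtain j where j: "j \<le> I" "h (a i) = g j + l * \<bar>a i - a j\<bar>" using ex by blast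
    then show "h (a i) = g i" using le[OF i, of "a i"] assms(1)[OF i j(1)] by auto
  next
    fix s t
    show "\<bar>h s - h t\<bar> \<le> l * \<bar>s - t\<bar>" using one[of s t] one[of t s] by (simp add: abs_minus_commute abs_le_iff)
  qed
qed

text \<open>The lower bound keeps limits of partitions nondegenerate. The upper bound confines the
  node of index \<open>i\<close> to \<open>[0, 2 * i * \<delta>]\<close>, so that nodes converge
  along subsequences.\<close>

definition spaced :: "real \<Rightarrow> (nat \<Rightarrow> real) \<Rightarrow> bool" where
  "spaced \<delta> \<tau> \<longleftrightarrow> \<tau> 0 = 0 \<and> (\<forall>i. \<delta> \<le> \<tau> (Suc i) - \<tau> i \<and> \<tau> (Suc i) - \<tau> i \<le> 2 * \<delta>)"

lemma spaced_diff:
  assumes "spaced \<delta> \<tau>" "0 \<le> \<delta>" "i < j" shows "\<delta> \<le> \<tau> j - \<tau> i"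
proof -
  have "\<delta> \<le> \<tau> (i + Suc k) - \<tau> i" for k
  proof (induction k)
    case (Suc k)
    have "\<delta> \<le> \<tau> (Suc (i + Suc k)) - \<tau> (i + Suc k)" using assms unfolding spaced_def by blast
    then show ?case using Suc assms(2) by simp
  qed (use assms in \<open>auto simp: spaced_def\<close>)
  from this[of "j - i - 1"] show ?thesis using assms(3) by simp
qed

lemma spaced_mono: "spaced \<delta> \<tau> \<Longrightarrow> 0 \<le> \<delta> \<Longrightarrow> i \<le> j \<Longrightarrow> \<tau> i \<le> \<tau> j"
  using spaced_diff[of \<delta> \<tau> i j] by (cases "i = j") auto

lemma spaced_bounds: "spaced \<delta> \<tau> \<Longrightarrow> real i * \<delta> \<le> \<tau> i \<and> \<tau> i \<le> 2 * real i * \<delta>"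
proof (induction i)
  case (Suc i)
  have "\<delta> \<le> \<tau> (Suc i) - \<tau> i" "\<tau> (Suc i) - \<tau> i \<le> 2 * \<delta>" using Suc.prems unfolding spaced_def by blast+
  then show ?case using Suc by (simp add: algebra_simps)
qed (simp add: spaced_def)

lemma spaced_nonneg: "spaced \<delta> \<tau> \<Longrightarrow> 0 \<le> \<delta> \<Longrightarrow> 0 \<le> \<tau> i"
  using spaced_bounds[of \<delta> \<tau> i] mult_nonneg_nonneg[of "real i" \<delta>] by simp

lemma spaced_index:
  assumes "spaced \<delta> \<tau>" "0 < \<delta>" "0 \<le> t"
  obtains i where "\<tau> i \<le> t" "t < \<tau> (Suc i)"
proof -
  obtain n :: nat where "t < real n * \<delta>" using reals_Archimedean3[OF assms(2)] by blast
  then have "t < \<tau> (Suc n)"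
    using spaced_bounds[OF assms(1), of n] spaced_diff[OF assms(1), of n "Suc n"] assms(2) by auto
  then have ex: "\<exists>n. t < \<tau> (Suc n)" by blast
  let ?i = "LEAST n. t < \<tau> (Suc n)"
  have "t < \<tau> (Suc ?i)" using ex by (rule LeastI_ex)
  moreover have "\<tau> ?i \<le> t"
  proof (cases ?i)
    case 0 then show ?thesis using assms by (simp add: spaced_def)
  next
    case (Suc m)
    then show ?thesis using not_less_Least[of m "\<lambda>n. t < \<tau> (Suc n)"] by simp
  qed
  ultimately show ?thesis using that by blast
qed

context Metric_space
begin

interpretation sk: Metric_space "cadlag M d" "skorokhod_dist d"
  by (rule Metric_space_skorokhod)

lemma limitin_dist_le:
  assumes "limitin mtopology f l F" "F \<noteq> bot" "a \<in> M" "\<forall>\<^sub>F x in F. d a (f x) \<le> c"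
  shows "d a l \<le> c"
proof -
  have "\<forall>\<^sub>F x in F. f x \<in> M \<and> d (f x) l < 1" using assms(1) unfolding limitin_metric by simp
  then have "\<forall>\<^sub>F x in F. f x \<in> M" by (rule eventually_mono) simp
  then have "\<forall>\<^sub>F x in F. f x \<in> mcball a c"
    using assms(4) by eventually_elim (use assms(3) in \<open>auto simp: in_mcball\<close>)
  then have "l \<in> mcball a c"
    using assms(1,2) by (intro limitin_closedin[OF assms(1) closedin_mcball]) auto
  then show ?thesis by (simp add: in_mcball)
qed

text \<open>The time change is the identity plus a Lipschitz function interpolating \<open>T i - \<tau> i\<close> at
  \<open>\<tau> i\<close>, so its slopes are close to 1. Stopping at a time \<open>u\<close> within \<open>\<beta>\<close> of some \<open>T i\<close>
  may separate the two paths; such \<open>u\<close> contribute little to the integral.\<close>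

lemma skorokhod_dist_partition_le:
  fixes T \<tau> :: "nat \<Rightarrow> real"
  assumes x: "x \<in> cadlag M d" and y: "y \<in> cadlag M d"
    and sp: "spaced \<delta> \<tau>" "spaced \<delta> T" "0 < \<delta>"
    and E: "0 < E" "E = 1 / real (Suc k)"
    and I: "real k + 1 \<le> real I * \<delta>"
    and \<beta>: "0 < \<beta>" "2 * \<beta> \<le> (1 - exp (- E)) * \<delta>" "(real I + 1) * (2 * \<beta>) \<le> E"
    and near: "\<And>i. i \<le> I \<Longrightarrow> \<bar>\<tau> i - T i\<bar> < \<beta>" "\<And>i. i \<le> I \<Longrightarrow> d (x (\<tau> i)) (p i) < E"
    and p: "\<And>i. i \<le> I \<Longrightarrow> p i \<in> M"
    and xosc: "\<And>i s. \<tau> i \<le> real k \<Longrightarrow> \<tau> i \<le> s \<Longrightarrow> s < \<tau> (Suc i) \<Longrightarrow> d (x (\<tau> i)) (x s) \<le> E"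
    and yosc: "\<And>i s. T i \<le> s \<Longrightarrow> s < T (Suc i) \<Longrightarrow> s < real k \<Longrightarrow> d (p i) (y s) \<le> E"
  shows "skorokhod_dist d x y \<le> 5 * E"
proof -
  \<comment> \<open>Adding an \<open>l\<close>-Lipschitz function to the identity gives slopes
    between \<open>1 - l = exp (- E)\<close> and \<open>1 + l\<close>, and the latter is at most
    \<open>exp E\<close>.\<close>
  define l where "l = 1 - exp (- E)"
  have l: "0 \<le> l" "l \<le> exp E - 1"
    using E(1) exp_ge_add_one_self[of E] exp_ge_add_one_self[of "- E"] unfolding l_def by (simp, linarith)
  \<comment> \<open>Two shifts differ by less than \<open>2 * \<beta> \<le> l * \<delta>\<close>,
    and distinct nodes are at least \<delta> apart.\<close>
  have "\<bar>(T i - \<tau> i) - (T j - \<tau> j)\<bar> \<le> l * \<bar>\<tau> i - \<tau> j\<bar>" if ij: "i \<le> I" "j \<le> I" for i j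
  proof (cases "i = j")
    case False
    then have "\<delta> \<le> \<bar>\<tau> i - \<tau> j\<bar>"
      using spaced_diff[OF sp(1), of i j] spaced_diff[OF sp(1), of j i] sp(3)
      by (cases i j rule: linorder_cases) auto
    then have "l * \<delta> \<le> l * \<bar>\<tau> i - \<tau> j\<bar>" using l(1) by (rule mult_left_mono)
    then show ?thesis using near(1)[OF ij(1)] near(1)[OF ij(2)] \<beta>(2) unfolding l_def by linarith
  qed simp
  then obtain g where g: "\<And>i. i \<le> I \<Longrightarrow> g (\<tau> i) = T i - \<tau> i" "\<And>s t. \<bar>g s - g t\<bar> \<le> l * \<bar>s - t\<bar>"
    using lipschitz_interpolation[of I "\<lambda>i. T i - \<tau> i" l \<tau>] l(1) by metis
  define \<theta> where "\<theta> t = t + g t" for t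
  have \<theta>T: "\<theta> (\<tau> i) = T i" if "i \<le> I" for i using g(1)[OF that] by (simp add: \<theta>_def)
  have zero: "\<theta> 0 = 0" using \<theta>T[of 0] sp by (simp add: spaced_def)
  have slopes: "exp (- E) * (s - t) \<le> \<theta> s - \<theta> t \<and> \<theta> s - \<theta> t \<le> exp E * (s - t)" if "0 \<le> t" "t < s" for s t
  proof -
    have "\<bar>g s - g t\<bar> \<le> l * (s - t)" using g(2)[of s t] that by simp
    moreover have "l * (s - t) \<le> (exp E - 1) * (s - t)" using l(2) that by (intro mult_right_mono) auto
    moreover have "exp (- E) * (s - t) = (s - t) - l * (s - t)" "exp E * (s - t) = (s - t) + (exp E - 1) * (s - t)"
      by (simp_all add: l_def algebra_simps)
    ultimately show ?thesis unfolding \<theta>_def by (intro conjI) linarith+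
  qed
  note tc = time_changesI[OF zero slopes]
  define B where "B i = {T i - \<beta>..T i + \<beta>}" for i
  \<comment> \<open>A majorant of the weighted gap: its terms treat good stopping times, those past
    \<open>k\<close>, and those near a node. Their integrals are at most \<open>3 * E\<close>,
    \<open>E\<close> and \<open>E\<close>.\<close>
  define f where "f u = 3 * E * exp (- u) + indicator {real k..} u * exp (- u) + (\<Sum>i\<le>I. indicator (B i) u)" for u
  have gap: "skorokhod_gap d x y \<theta> u \<le> 3 * E" if u: "0 \<le> u" "u < real k" "\<And>i. i \<le> I \<Longrightarrow> u \<notin> B i" for u
  proof -
    obtain i where i: "T i \<le> u" "u < T (Suc i)" using spaced_index[OF sp(2,3) u(1)] by blast
    have iI: "Suc i \<le> I"
    proof (rule ccontr)
      assume "\<not> Suc i \<le> I"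
      then have "T I \<le> T i" using spaced_mono[OF sp(2)] sp(3) by simp
      then show False using spaced_bounds[OF sp(2), of I] I i(1) u(2) by linarith
    qed
    have "T i + \<beta> < u" "u < T (Suc i) - \<beta>" using u(3)[of i] u(3)[of "Suc i"] i iI \<beta>(1) by (auto simp: B_def)
    then have \<tau>u: "\<tau> i < u" "u < \<tau> (Suc i)" using near(1)[of i] near(1)[of "Suc i"] iI by (auto simp: abs_less_iff)
    \<comment> \<open>The route is \<open>x a\<close>, \<open>x (\<tau> j)\<close>,
      \<open>p j\<close>, \<open>y b\<close>, with cost at most \<open>E\<close> for each
      leg.\<close>
    have piece: "d (x a) (y b) \<le> 3 * E"
      if "j \<le> i" "\<tau> j \<le> a" "a < \<tau> (Suc j)" "T j \<le> b" "b < T (Suc j)" "a \<le> u" "b \<le> u" for a b j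
    proof -
      have nn: "0 \<le> \<tau> j" "0 \<le> T j" using spaced_nonneg sp by auto
      have m: "x a \<in> M" "x (\<tau> j) \<in> M" "p j \<in> M" "y b \<in> M"
        using nn that iI by (auto intro!: cadlag_mem[OF x] cadlag_mem[OF y] p)
      have "d (x (\<tau> j)) (x a) \<le> E" using that u by (intro xosc) auto
      moreover have "d (x (\<tau> j)) (p j) < E" using that iI by (intro near) auto
      moreover have "d (p j) (y b) \<le> E" using that u by (intro yosc) auto
      ultimately show ?thesis
        using triangle[OF m(1,2,4)] triangle[OF m(2,3,4)] commute[of "x a" "x (\<tau> j)"] by linarith
    qed
    show ?thesis
    proof (rule gap_least)
      fix t :: real assume t: "0 \<le> t"
      \<comment> \<open>Both stopped clocks lie in pieces with the same index. If neither is
        stopped, this holds because \<theta> maps nodes to nodes; otherwise the index is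
        \<open>i\<close>, because \<open>u\<close> lies inside the pieces of index \<open>i\<close>
        of both partitions.\<close>
      have "\<exists>j\<le>i. \<tau> j \<le> min t u \<and> min t u < \<tau> (Suc j) \<and> T j \<le> min (\<theta> t) u \<and> min (\<theta> t) u < T (Suc j)"
      proof (cases "t \<le> u \<and> \<theta> t \<le> u")
        case True
        obtain j where j: "\<tau> j \<le> t" "t < \<tau> (Suc j)" using spaced_index[OF sp(1,3) t] by blast
        have ji: "j \<le> i"
        proof (rule ccontr)
          assume "\<not> j \<le> i"
          then have "\<tau> (Suc i) \<le> \<tau> j" using spaced_mono[OF sp(1)] sp(3) by simp
          then show False using j True \<tau>u by linarith
        qed
        have "\<theta> (\<tau> j) \<le> \<theta> t" "\<theta> t < \<theta> (\<tau> (Suc j))"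
          using j spaced_nonneg[OF sp(1)] sp(3) t time_change_le[OF tc(1)] time_change_less[OF tc(1)] by auto
        then show ?thesis using j ji iI True \<theta>T[of j] \<theta>T[of "Suc j"] by (intro exI[of _ j]) auto
      next
        case False
        have a: "\<tau> i \<le> t \<or> \<theta> t < T i"
          using time_change_less[OF tc(1) t, of "\<tau> i"] \<theta>T[of i] iI by force
        have b: "T i \<le> \<theta> t \<or> t < \<tau> i"
          using time_change_le[OF tc(1) spaced_nonneg[OF sp(1)], of i t] \<theta>T[of i] iI sp(3) by force
        have "\<tau> i \<le> min t u" "T i \<le> min (\<theta> t) u"
          using False a b i \<tau>u by auto
        then show ?thesis using i \<tau>u by (intro exI[of _ i]) auto
      qed
      then obtain j where "j \<le> i" "\<tau> j \<le> min t u" "min t u < \<tau> (Suc j)" "T j \<le> min (\<theta> t) u" "min (\<theta> t) u < T (Suc j)"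
        by blast
      from piece[OF this] show "min 1 (d (x (min t u)) (y (min (\<theta> t) u))) \<le> 3 * E" by (simp add: min_le_iff_disj)
    qed
  qed
  have int1: "set_integrable lborel {0..} (\<lambda>u. 3 * E * exp (- u))" "(LINT u:{0..}|lborel. 3 * E * exp (- u)) = 3 * E"
    using exp_minus_atLeast[of 0] by (simp_all add: set_integral_mult_right)
  have eqk: "(\<lambda>u. indicator {0..} u *\<^sub>R (indicator {real k..} u * exp (- u))) = (\<lambda>u. indicator {real k..} u *\<^sub>R exp (- u :: real))"
    by (auto simp: indicator_def)
  have int2: "set_integrable lborel {0..} (\<lambda>u. indicator {real k..} u * exp (- u))"
    "(LINT u:{0..}|lborel. indicator {real k..} u * exp (- u)) = exp (- real k)"
    using exp_minus_atLeast[of "real k"] unfolding set_integrable_def set_lebesgue_integral_def eqk by simp_all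
  have eqB: "(\<lambda>u. indicator {0..} u *\<^sub>R indicator (B i) u) = (indicator ({0..} \<inter> B i) :: real \<Rightarrow> real)" for i
    by (auto simp: indicator_def)
  have mB: "emeasure lborel ({0..} \<inter> B i) \<le> ennreal (2 * \<beta>)" for i
  proof -
    have "emeasure lborel ({0..} \<inter> B i) \<le> emeasure lborel (B i)" by (intro emeasure_mono) (auto simp: B_def)
    then show ?thesis using \<beta>(1) by (simp add: B_def)
  qed
  have int3: "set_integrable lborel {0..} (\<lambda>u. indicator (B i) u :: real)"
    "(LINT u:{0..}|lborel. indicator (B i) u) \<le> 2 * \<beta>" for i
  proof -
    have fin: "emeasure lborel ({0..} \<inter> B i) < \<infinity>" using mB[of i] by (simp add: le_less_trans)
    show "set_integrable lborel {0..} (\<lambda>u. indicator (B i) u :: real)"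
      unfolding set_integrable_def eqB using fin by (intro integrable_real_indicator) (auto simp: B_def)
    have "measure lborel ({0..} \<inter> B i) \<le> 2 * \<beta>"
      using mB[of i] \<beta>(1) unfolding measure_def by (intro enn2real_leI) auto
    then show "(LINT u:{0..}|lborel. indicator (B i) u) \<le> 2 * \<beta>"
      unfolding set_lebesgue_integral_def eqB by simp
  qed
  have int4: "set_integrable lborel {0..} (\<lambda>u. \<Sum>i\<le>I. indicator (B i) u :: real)"
    "(LINT u:{0..}|lborel. (\<Sum>i\<le>I. indicator (B i) u)) \<le> (real I + 1) * (2 * \<beta>)"
  proof -
    show "set_integrable lborel {0..} (\<lambda>u. \<Sum>i\<le>I. indicator (B i) u :: real)"
      using int3(1) unfolding set_integrable_def scaleR_sum_right by (intro Bochner_Integration.integrable_sum)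
    have "(LINT u:{0..}|lborel. (\<Sum>i\<le>I. indicator (B i) u :: real)) = (\<Sum>i\<le>I. (LINT u:{0..}|lborel. indicator (B i) u))"
      using int3(1) unfolding set_integrable_def set_lebesgue_integral_def scaleR_sum_right
      by (intro Bochner_Integration.integral_sum)
    also have "\<dots> \<le> (\<Sum>i\<le>I. 2 * \<beta>)" by (intro sum_mono int3)
    finally show "(LINT u:{0..}|lborel. (\<Sum>i\<le>I. indicator (B i) u)) \<le> (real I + 1) * (2 * \<beta>)" by (simp add: add.commute)
  qed
  have int12: "set_integrable lborel {0..} (\<lambda>u. 3 * E * exp (- u) + indicator {real k..} u * exp (- u))"
    by (rule set_integral_add(1)[OF int1(1) int2(1)])
  have "gap_integral x y \<theta> \<le> (LINT u:{0..}|lborel. f u)"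
  proof (rule gap_integral_mono[OF x y tc(1)])
    show "set_integrable lborel {0..} f"
      unfolding f_def by (rule set_integral_add(1)[OF int12 int4(1)])
    fix u :: real assume u: "0 \<le> u"
    have eu: "exp (- u) \<le> 1" using u by simp
    show "exp (- u) * skorokhod_gap d x y \<theta> u \<le> f u"
    proof (cases "u < real k \<and> (\<forall>i\<le>I. u \<notin> B i)")
      case True
      then have "exp (- u) * skorokhod_gap d x y \<theta> u \<le> exp (- u) * (3 * E)"
        using u by (intro mult_left_mono gap) auto
      also have "\<dots> \<le> f u" unfolding f_def by (auto intro!: add_nonneg_nonneg sum_nonneg simp: mult.commute)
      finally show ?thesis .
    next
      case False
      have l: "exp (- u) * skorokhod_gap d x y \<theta> u \<le> exp (- u)"
        using gap_bounds[of x y \<theta> u] by simp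
      from False consider "real k \<le> u" | i where "i \<le> I" "u \<in> B i" by force
      then show ?thesis
      proof cases
        case 1
        have "0 \<le> (\<Sum>i\<le>I. indicator (B i) u :: real)" by (intro sum_nonneg) auto
        moreover have "0 \<le> 3 * E * exp (- u)" "indicator {real k..} u * exp (- u) = exp (- u)" using E(1) 1 by auto
        ultimately show ?thesis using l unfolding f_def by linarith
      next
        case 2
        have "1 = (indicator (B i) u :: real)" using 2 by simp
        also have "\<dots> \<le> (\<Sum>i\<le>I. indicator (B i) u)" using 2 by (intro member_le_sum) auto
        finally have "1 \<le> (\<Sum>i\<le>I. indicator (B i) u :: real)" .
        moreover have "0 \<le> 3 * E * exp (- u)" "0 \<le> indicator {real k..} u * exp (- u)" using E(1) by auto
        ultimately show ?thesis using l eu unfolding f_def by linarith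
      qed
    qed
  qed
  also have "\<dots> = 3 * E + exp (- real k) + (LINT u:{0..}|lborel. (\<Sum>i\<le>I. indicator (B i) u))"
    unfolding f_def set_integral_add(2)[OF int12 int4(1)] set_integral_add(2)[OF int1(1) int2(1)] int1(2) int2(2) ..
  also have "\<dots> \<le> 3 * E + E + E"
  proof -
    have "1 + real k \<le> exp (real k)" by (rule exp_ge_add_one_self)
    then have "exp (- real k) \<le> E" by (simp add: E(2) exp_minus field_simps)
    then show ?thesis using int4(2) \<beta>(3) by linarith
  qed
  finally show ?thesis using tc E(1) by (intro skorokhod_dist_le[OF tc(1)]) auto
qed

text \<open>For each \<open>k\<close> the step function with value \<open>p k i\<close> on \<open>[T k i, T k (i + 1))\<close> approximates the
  limit within \<open>1 / (k + 1)\<close> up to time \<open>k\<close>; the limit path is obtained by letting \<open>k\<close> grow, so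
  no time changes have to be composed.\<close>

lemma skorokhod_limit:
  fixes x :: "nat \<Rightarrow> real \<Rightarrow> 'a" and \<tau> :: "nat \<Rightarrow> nat \<Rightarrow> nat \<Rightarrow> real"
  assumes x: "\<And>n. x n \<in> cadlag M d"
    and K: "\<And>k::nat. compactin mtopology (K k)" "\<And>n k t. 0 \<le> t \<Longrightarrow> t \<le> real k \<Longrightarrow> x n t \<in> K k"
    and \<delta>: "\<And>k. 0 < \<delta> k" and sp: "\<And>n k. spaced (\<delta> k) (\<tau> n k)"
    and osc: "\<And>n k i s. \<tau> n k i \<le> real k \<Longrightarrow> \<tau> n k i \<le> s \<Longrightarrow> s < \<tau> n k (Suc i) \<Longrightarrow>
      d (x n (\<tau> n k i)) (x n s) \<le> 1 / real (Suc k)"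
    and T: "\<And>k i. (\<lambda>n. \<tau> n k i) \<longlonglongrightarrow> T k i"
    and p: "\<And>k i. limitin mtopology (\<lambda>n. x n (\<tau> n k i)) (p k i) sequentially"
  obtains y where "y \<in> cadlag M d" "(\<lambda>n. skorokhod_dist d (x n) y) \<longlonglongrightarrow> 0"
proof -
  let ?E = "\<lambda>k. 1 / real (Suc k)"
  have spT: "spaced (\<delta> k) (T k)" for k
    unfolding spaced_def
  proof (intro conjI allI)
    show "T k 0 = 0" using T[of k 0] sp by (simp add: spaced_def LIMSEQ_const_iff)
    have dT: "(\<lambda>n. \<tau> n k (Suc i) - \<tau> n k i) \<longlonglongrightarrow> T k (Suc i) - T k i" for i by (intro tendsto_diff T)
    show "\<delta> k \<le> T k (Suc i) - T k i" "T k (Suc i) - T k i \<le> 2 * \<delta> k" for i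
      using sp unfolding spaced_def by (auto intro!: LIMSEQ_le_const[OF dT] LIMSEQ_le_const2[OF dT])
  qed
  have pM: "p k i \<in> M" for k i using p limitin_mspace by blast
  have KM: "K k \<subseteq> M" for k using K(1) compactin_subset_topspace by fastforce
  have Kc: "closedin mtopology (K k)" for k
    using K(1) Hausdorff_space_mtopology compactin_imp_closedin by blast
  have xM: "0 \<le> t \<Longrightarrow> x n t \<in> M" for n t using cadlag_mem[OF x] .
  \<comment> \<open>Strict inequalities are required because the nodes may approach
    \<open>T k i\<close> from either side.\<close>
  have E1: "\<forall>\<^sub>F n in sequentially. d (x n t) (p k i) < ?E k + e"
    if t: "T k i < t" "t < T k (Suc i)" "T k i < real k" and e: "0 < e" for t k i e
  proof -
    have "\<forall>\<^sub>F n in sequentially. d (x n (\<tau> n k i)) (p k i) < e"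
      using p[of k i] e unfolding limitin_metric by (auto elim: eventually_mono)
    with order_tendstoD(2)[OF T t(1)] order_tendstoD(1)[OF T t(2)] order_tendstoD(2)[OF T t(3)]
    show ?thesis
    proof eventually_elim
      case (elim n)
      have nn: "0 \<le> \<tau> n k i" using spaced_nonneg[OF sp] \<delta> less_imp_le by blast
      have "d (x n (\<tau> n k i)) (x n t) \<le> ?E k" using elim by (intro osc) auto
      moreover have "d (x n t) (p k i) \<le> d (x n t) (x n (\<tau> n k i)) + d (x n (\<tau> n k i)) (p k i)"
        using nn elim by (intro triangle xM pM) auto
      ultimately show ?case using elim(4) commute[of "x n t" "x n (\<tau> n k i)"] by linarith
    qed
  qed
  \<comment> \<open>The step functions of two levels nearly agree. The time is moved slightly to the
    right, into the interior of both pieces, where \<open>E1\<close> applies to both.\<close>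
  have E2: "d (p k i) (p l j) \<le> ?E k + ?E l"
    if t: "T k i \<le> t" "t < T k (Suc i)" "t < real k" "T l j \<le> t" "t < T l (Suc j)" "t < real l" for t k l i j
  proof (rule field_le_epsilon)
    fix e :: real assume "0 < e"
    then have e: "0 < e / 2" by simp
    define t' where "t' = (t + min (T k (Suc i)) (T l (Suc j))) / 2"
    have t': "t < t'" "t' < T k (Suc i)" "t' < T l (Suc j)" using t by (auto simp: t'_def min_def)
    have "0 \<le> T k i" using spaced_nonneg[OF spT] \<delta> less_imp_le by blast
    then have t'0: "0 \<le> t'" using t t' by linarith
    have "\<forall>\<^sub>F n in sequentially. d (x n t') (p k i) < ?E k + e / 2"
      "\<forall>\<^sub>F n in sequentially. d (x n t') (p l j) < ?E l + e / 2"
      using E1[OF _ _ _ e, of k i t'] E1[OF _ _ _ e, of l j t'] t t' by linarith+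
    then have "\<forall>\<^sub>F n in sequentially. d (p k i) (p l j) \<le> ?E k + ?E l + e"
    proof eventually_elim
      case (elim n)
      have "d (p k i) (p l j) \<le> d (p k i) (x n t') + d (x n t') (p l j)"
        by (rule triangle[OF pM xM[OF t'0] pM])
      then show ?case using elim commute[of "p k i" "x n t'"] by linarith
    qed
    then show "d (p k i) (p l j) \<le> ?E k + ?E l + e" by simp
  qed
  \<comment> \<open>The extra unit of time absorbs nodes of the approximating paths that lie
    slightly past \<open>t\<close>.\<close>
  have pK: "p k i \<in> K m" if t: "T k i \<le> t" "t + 1 \<le> real m" for t k i m
  proof (rule limitin_closedin[OF p Kc])
    have "T k i < t + 1" using t by simp
    then show "\<forall>\<^sub>F n in sequentially. x n (\<tau> n k i) \<in> K m"
      using order_tendstoD(2)[OF T, of k i "t + 1"] 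
      by (auto elim!: eventually_mono intro!: K(2) spaced_nonneg[OF sp] less_imp_le[OF \<delta>] simp: order.trans[OF less_imp_le t(2)])
  qed simp
  \<comment> \<open>The value at \<open>t\<close> is a cluster point of the step values at
    \<open>t\<close> as the level grows. Compactness of \<open>K m\<close> supplies it, in place of
    completeness of \<open>M\<close>; \<open>E2\<close> shows that it is close to every step
    value.\<close>
  have "\<exists>l\<in>M. (\<forall>k i. T k i \<le> t \<and> t < T k (Suc i) \<and> t < real k \<longrightarrow> d (p k i) l \<le> ?E k) \<and>
      (\<forall>m. t + 1 \<le> real m \<longrightarrow> l \<in> K m)" if t: "0 \<le> t" for t
  proof -
    have "\<exists>i. T k i \<le> t \<and> t < T k (Suc i)" for k using spaced_index[OF spT \<delta> t] by metis
    then obtain ix where ix: "\<And>k. T k (ix k) \<le> t \<and> t < T k (Suc (ix k))" by metis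
    obtain m0 :: nat where m0: "t + 1 \<le> real m0" using real_arch_simple by blast
    let ?q = "\<lambda>m. p (m0 + m) (ix (m0 + m))"
    have qK: "?q m \<in> K m'" if "t + 1 \<le> real m'" for m m' using pK[OF _ that] ix by blast
    then have "range ?q \<subseteq> K m0" using m0 by blast
    then obtain l r where lr: "l \<in> K m0" "strict_mono r" "limitin mtopology (?q \<circ> r) l sequentially"
      using K(1)[of m0] unfolding compactin_sequentially by meson
    have "d (p k i) l \<le> ?E k" if ki: "T k i \<le> t \<and> t < T k (Suc i) \<and> t < real k" for k i
    proof (rule field_le_epsilon)
      fix e :: real assume e: "0 < e"
      show "d (p k i) l \<le> ?E k + e"
      proof (rule limitin_dist_le[OF lr(3) _ pM])
        obtain n0 where n0: "?E n0 < e" using nat_approx_posE[OF e] by metis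
        show "\<forall>\<^sub>F n in sequentially. d (p k i) ((?q \<circ> r) n) \<le> ?E k + e"
          using eventually_ge_at_top[of n0]
        proof eventually_elim
          case (elim n)
          have "n0 \<le> m0 + r n" using elim seq_suble[OF lr(2), of n] by simp
          then have "?E (m0 + r n) \<le> ?E n0" by (intro divide_left_mono) auto
          moreover have "t < real (m0 + r n)" using m0 by simp
          ultimately show ?case using E2[of k i t "m0 + r n" "ix (m0 + r n)"] ki ix[of "m0 + r n"] n0 by (simp add: less_imp_le)
        qed
      qed simp
    qed
    moreover have "l \<in> K m" if "t + 1 \<le> real m" for m
      by (rule limitin_closedin[OF lr(3) Kc]) (use qK[OF that] in auto)
    ultimately show ?thesis using lr(1) KM by blast
  qed
  then obtain Y where Y: "\<And>t. 0 \<le> t \<Longrightarrow> Y t \<in> M"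
    "\<And>t k i. 0 \<le> t \<Longrightarrow> T k i \<le> t \<Longrightarrow> t < T k (Suc i) \<Longrightarrow> t < real k \<Longrightarrow> d (p k i) (Y t) \<le> ?E k"
    "\<And>t m. 0 \<le> t \<Longrightarrow> t + 1 \<le> real m \<Longrightarrow> Y t \<in> K m" by metis
  define y where "y = restrict Y {0..}"
  have yY: "y t = Y t" if "0 \<le> t" for t using that by (simp add: y_def)
  have small: "\<exists>k. t < real k \<and> 2 * ?E k < e" if "0 < e" for t e :: real
  proof -
    have "0 < e / 2" using that by simp
    then obtain n where n: "?E n < e / 2" using nat_approx_posE by metis
    obtain m :: nat where m: "t < real m" using reals_Archimedean2 by blast
    have "?E (max n m) \<le> ?E n" by (intro divide_left_mono) auto
    then show ?thesis using n m by (intro exI[of _ "max n m"]) auto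
  qed
  have ycad: "y \<in> cadlag M d"
  proof (rule cadlagI)
    show "y \<in> {0..} \<rightarrow>\<^sub>E M" using Y(1) by (auto simp: y_def)
  next
    fix t e :: real assume t: "0 \<le> t" and e: "0 < e"
    obtain k where k: "t < real k" "2 * ?E k < e" using small[OF e] by blast
    obtain i where i: "T k i \<le> t" "t < T k (Suc i)" using spaced_index[OF spT \<delta> t] by blast
    show "\<exists>h>0. \<forall>s. t < s \<and> s < t + h \<longrightarrow> d (y s) (y t) < e"
    proof (intro exI[of _ "min (T k (Suc i)) (real k) - t"] conjI allI impI)
      show "0 < min (T k (Suc i)) (real k) - t" using i k by simp
      fix s assume s: "t < s \<and> s < t + (min (T k (Suc i)) (real k) - t)"
      have "d (p k i) (Y s) \<le> ?E k" by (rule Y(2)) (use s i t in auto)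
      moreover have "d (p k i) (Y t) \<le> ?E k" by (rule Y(2)) (use i t k in auto)
      ultimately
      show "d (y s) (y t) < e"
        using triangle[OF Y(1) pM Y(1), of s t k i] commute[of "Y s" "p k i"] s t k(2) by (simp add: yY)
    qed
  next
    fix t :: real assume t: "0 < t"
    obtain m :: nat where m: "t + 1 \<le> real m" using real_arch_simple by blast
    \<comment> \<open>Nonnegative times increasing to \<open>t\<close>. The candidate left limit is
      a cluster point of the path along them, again obtained from compactness.\<close>
    let ?s = "\<lambda>n. t - t / (real n + 2)"
    have s: "0 \<le> ?s n" "?s n < t" for n using t by (auto simp: field_simps)
    have "Y (?s n) \<in> K m" for n using s[of n] m by (intro Y(3)) linarith+
    then have "range (\<lambda>n. Y (?s n)) \<subseteq> K m" by blast
    then obtain l r where lr: "l \<in> K m" "strict_mono r" "limitin mtopology ((\<lambda>n. Y (?s n)) \<circ> r) l sequentially"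
      using K(1)[of m] unfolding compactin_sequentially by meson
    have "(\<lambda>n. t / (real n + 2)) \<longlonglongrightarrow> 0" by real_asymp
    then have "(\<lambda>n. ?s n) \<longlonglongrightarrow> t - 0" by (intro tendsto_diff) auto
    then have slim: "(\<lambda>n. ?s (r n)) \<longlonglongrightarrow> t" using LIMSEQ_subseq_LIMSEQ[OF _ lr(2)] by (fastforce simp: o_def)
    show "\<exists>l. limitin mtopology y l (at_left t)"
    proof (intro exI[of _ l], unfold limitin_metric, intro conjI allI impI)
      show "l \<in> M" using lr(1) KM by blast
      fix e :: real assume e: "0 < e"
      obtain k where k: "t < real k" "2 * ?E k < e" using small[OF e] by blast
      \<comment> \<open>A piece that covers a left neighbourhood of \<open>t\<close>: if
        \<open>t\<close> is itself a node, the previous piece is taken.\<close>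
      have "\<exists>i. T k i < t \<and> t \<le> T k (Suc i)"
      proof -
        obtain j where j: "T k j \<le> t" "t < T k (Suc j)" using spaced_index[OF spT \<delta>] t by (metis less_imp_le)
        show ?thesis
        proof (cases "T k j < t")
          case False
          then have jt: "T k j = t" using j by simp
          then obtain i where i: "j = Suc i" using t spT[of k] by (cases j) (auto simp: spaced_def)
          have "T k i < T k j" using spaced_diff[OF spT[of k], of i j] \<delta>[of k] i by simp
          then show ?thesis using jt i by auto
        qed (use j in auto)
      qed
      then obtain i where i: "T k i < t" "t \<le> T k (Suc i)" by blast
      have T0: "0 \<le> T k i" using spaced_nonneg[OF spT] \<delta> less_imp_le by blast
      have near: "d (p k i) (Y s) \<le> ?E k" if "T k i \<le> s" "s < t" for s
        using that i k T0 by (intro Y(2)) auto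
      have pl: "d (p k i) l \<le> ?E k"
      proof (rule limitin_dist_le[OF lr(3) _ pM])
        show "\<forall>\<^sub>F n in sequentially. d (p k i) (((\<lambda>n. Y (?s n)) \<circ> r) n) \<le> ?E k"
          using order_tendstoD(1)[OF slim i(1)] by eventually_elim (use near s in auto)
      qed simp
      have "y s \<in> M \<and> d (y s) l < e" if "T k i < s" "s < t" for s
      proof -
        have "d (p k i) (Y s) \<le> ?E k" using near that by simp
        then show ?thesis
          using triangle[OF Y(1) pM, of s l k i] pl k(2) commute[of "Y s" "p k i"] that T0 \<open>l \<in> M\<close>
          by (simp add: yY Y(1))
      qed
      then show "\<forall>\<^sub>F s in at_left t. y s \<in> M \<and> d (y s) l < e"
        unfolding eventually_at_left_field using i(1) by blast
    qed
  qed
  moreover have "(\<lambda>n. skorokhod_dist d (x n) y) \<longlonglongrightarrow> 0"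
  proof (rule tendstoI)
    fix e :: real assume "0 < e"
    then have "0 < e / 5" by simp
    then obtain k where k: "?E k < e / 5" using nat_approx_posE by metis
    define E where "E = ?E k"
    have E: "0 < E" "E < e / 5" using k by (auto simp: E_def)
    obtain I :: nat where I: "real k + 1 < real I * \<delta> k" using reals_Archimedean3[OF \<delta>] by blast
    define \<beta> where "\<beta> = min ((1 - exp (- E)) * \<delta> k / 2) (E / ((real I + 1) * 2))"
    have \<beta>: "0 < \<beta>" "2 * \<beta> \<le> (1 - exp (- E)) * \<delta> k" "(real I + 1) * (2 * \<beta>) \<le> E"
    proof -
      show "0 < \<beta>" using E \<delta>[of k] by (auto simp: \<beta>_def)
      have "\<beta> \<le> (1 - exp (- E)) * \<delta> k / 2" "\<beta> \<le> E / ((real I + 1) * 2)"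
        unfolding \<beta>_def by (rule min.cobounded1, rule min.cobounded2)
      then show "2 * \<beta> \<le> (1 - exp (- E)) * \<delta> k" "(real I + 1) * (2 * \<beta>) \<le> E"
        by (linarith, simp add: field_simps)
    qed
    have "\<forall>\<^sub>F n in sequentially. \<bar>\<tau> n k i - T k i\<bar> < \<beta> \<and> d (x n (\<tau> n k i)) (p k i) < E" for i
    proof (rule eventually_conj)
      show "\<forall>\<^sub>F n in sequentially. \<bar>\<tau> n k i - T k i\<bar> < \<beta>"
        using tendstoD[OF T[of k i] \<beta>(1)] by (simp add: dist_real_def)
      show "\<forall>\<^sub>F n in sequentially. d (x n (\<tau> n k i)) (p k i) < E"
        using p[of k i] E unfolding limitin_metric by (auto elim: eventually_mono)
    qed
    then have "\<forall>\<^sub>F n in sequentially. \<forall>i\<in>{..I}. \<bar>\<tau> n k i - T k i\<bar> < \<beta> \<and> d (x n (\<tau> n k i)) (p k i) < E"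
      by (intro eventually_ball_finite) auto
    then show "\<forall>\<^sub>F n in sequentially. dist (skorokhod_dist d (x n) y) 0 < e"
    proof eventually_elim
      case (elim n)
      have "skorokhod_dist d (x n) y \<le> 5 * E"
      proof (rule skorokhod_dist_partition_le[OF x ycad sp spT \<delta> E(1) E_def _ \<beta>, where p = "p k"])
        show "real k + 1 \<le> real I * \<delta> k" using I by simp
        fix i s assume "\<tau> n k i \<le> real k" "\<tau> n k i \<le> s" "s < \<tau> n k (Suc i)"
        then show "d (x n (\<tau> n k i)) (x n s) \<le> E" unfolding E_def by (rule osc)
      next
        fix i s assume s: "T k i \<le> s" "s < T k (Suc i)" "s < real k"
        have "0 \<le> T k i" using spaced_nonneg[OF spT] \<delta> less_imp_le by blast
        then show "d (p k i) (y s) \<le> E" using s Y(2)[of s k i] by (simp add: E_def yY)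
      qed (use elim pM in auto)
      then show ?case using E skorokhod_dist_nonneg[of "x n" y] by (simp add: dist_real_def)
    qed
  qed
  ultimately show ?thesis using that by blast
qed

text \<open>Along a sequence in \<open>X\<close>, the node of a given level and index ranges over a
  bounded interval and the path values there over a compact set. A diagonal subsequence makes all of
  them converge, and \<open>skorokhod_limit\<close> produces the limit path.\<close>

theorem skorokhod_relatively_compact:
  assumes X: "X \<subseteq> cadlag M d"
    and K: "\<And>k::nat. compactin mtopology (K k)" "\<And>x k t. x \<in> X \<Longrightarrow> 0 \<le> t \<Longrightarrow> t \<le> real k \<Longrightarrow> x t \<in> K k"
    and \<delta>: "\<And>k. 0 < \<delta> k"
    and part: "\<And>x k. x \<in> X \<Longrightarrow> \<exists>\<tau>. spaced (\<delta> k) \<tau> \<and>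
      (\<forall>i s. \<tau> i \<le> real k \<longrightarrow> \<tau> i \<le> s \<longrightarrow> s < \<tau> (Suc i) \<longrightarrow> d (x (\<tau> i)) (x s) \<le> 1 / real (Suc k))"
  shows "compactin sk.mtopology (sk.mtopology closure_of X)"
proof -
  have "\<exists>l r. l \<in> cadlag M d \<and> strict_mono r \<and> limitin sk.mtopology (\<sigma> \<circ> r) l sequentially"
    if "range \<sigma> \<subseteq> X" for \<sigma> :: "nat \<Rightarrow> real \<Rightarrow> 'a"
  proof -
    have \<sigma>: "\<sigma> n \<in> X" for n using that by blast
    then have "\<forall>n k. \<exists>\<tau>. spaced (\<delta> k) \<tau> \<and>
      (\<forall>i s. \<tau> i \<le> real k \<longrightarrow> \<tau> i \<le> s \<longrightarrow> s < \<tau> (Suc i) \<longrightarrow> d (\<sigma> n (\<tau> i)) (\<sigma> n s) \<le> 1 / real (Suc k))"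
      using part by blast
    then obtain \<tau> where \<tau>: "\<And>n k. spaced (\<delta> k) (\<tau> n k)"
      "\<And>n k i s. \<tau> n k i \<le> real k \<Longrightarrow> \<tau> n k i \<le> s \<Longrightarrow> s < \<tau> n k (Suc i) \<Longrightarrow>
        d (\<sigma> n (\<tau> n k i)) (\<sigma> n s) \<le> 1 / real (Suc k)" by metis
    \<comment> \<open>The natural number \<open>m\<close> codes a pair of a level and a node index,
      so that one diagonal extraction treats all pairs.\<close>
    define Q where "Q m r \<longleftrightarrow> (\<exists>t p. (\<lambda>n. \<tau> (r n) (fst (prod_decode m)) (snd (prod_decode m))) \<longlonglongrightarrow> t \<and>
      limitin mtopology (\<lambda>n. \<sigma> (r n) (\<tau> (r n) (fst (prod_decode m)) (snd (prod_decode m)))) p sequentially)"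
      for m r
    interpret subseqs Q
    proof
      fix m :: nat and s :: "nat \<Rightarrow> nat" assume s: "strict_mono s"
      obtain k i where ki: "prod_decode m = (k, i)" by fastforce
      obtain b :: nat where b: "2 * real i * \<delta> k \<le> real b" using real_arch_simple by blast
      have bnd: "0 \<le> \<tau> n k i" "\<tau> n k i \<le> real b" for n
        using spaced_nonneg[OF \<tau>(1) less_imp_le[OF \<delta>]] spaced_bounds[OF \<tau>(1)] b order_trans by blast+
      have "\<forall>n. \<tau> (s n) k i \<in> {0..real b}" using bnd by auto
      then obtain t r1 where r1: "strict_mono r1" "((\<lambda>n. \<tau> (s n) k i) \<circ> r1) \<longlonglongrightarrow> t"
        using compact_imp_seq_compact[OF compact_Icc] unfolding seq_compact_def by metis
      have "range (\<lambda>n. \<sigma> (s (r1 n)) (\<tau> (s (r1 n)) k i)) \<subseteq> K b" using K(2)[OF \<sigma>] bnd by auto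
      then obtain p r2 where r2: "strict_mono r2"
        "limitin mtopology ((\<lambda>n. \<sigma> (s (r1 n)) (\<tau> (s (r1 n)) k i)) \<circ> r2) p sequentially"
        using K(1)[of b] unfolding compactin_sequentially by meson
      have "Q m (s \<circ> (r1 \<circ> r2))"
        using LIMSEQ_subseq_LIMSEQ[OF r1(2) r2(1)] r2(2) unfolding Q_def ki by (auto simp: o_def)
      then show "\<exists>r'. strict_mono r' \<and> Q m (s \<circ> r')" using strict_mono_o[OF r1(1) r2(1)] by blast
    qed
    have "Q m (diagseq \<circ> ((+) (Suc m)))" for m
    proof (rule diagseq_holds)
      fix r s :: "nat \<Rightarrow> nat" and n assume r: "strict_mono r" and "Q n s"
      from this(2) obtain t p where
        1: "(\<lambda>m. \<tau> (s m) (fst (prod_decode n)) (snd (prod_decode n))) \<longlonglongrightarrow> t" and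
        2: "limitin mtopology (\<lambda>m. \<sigma> (s m) (\<tau> (s m) (fst (prod_decode n)) (snd (prod_decode n)))) p sequentially"
        unfolding Q_def by blast
      from LIMSEQ_subseq_LIMSEQ[OF 1 r] limitin_subsequence[OF r 2]
      show "Q n (s \<circ> r)" unfolding Q_def o_def by blast
    qed
    then have "\<exists>t p. (\<lambda>n. \<tau> (diagseq n) k i) \<longlonglongrightarrow> t \<and>
        limitin mtopology (\<lambda>n. \<sigma> (diagseq n) (\<tau> (diagseq n) k i)) p sequentially" for k i
    proof -
      assume *: "\<And>m. Q m (diagseq \<circ> ((+) (Suc m)))"
      let ?m = "prod_encode (k, i)"
      from *[of ?m] obtain t p where
        1: "(\<lambda>n. \<tau> (diagseq (n + Suc ?m)) k i) \<longlonglongrightarrow> t" and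
        2: "limitin mtopology (\<lambda>n. \<sigma> (diagseq (n + Suc ?m)) (\<tau> (diagseq (n + Suc ?m)) k i)) p sequentially"
        unfolding Q_def by (auto simp: add.commute)
      from 1 have "(\<lambda>n. \<tau> (diagseq n) k i) \<longlonglongrightarrow> t" by (rule LIMSEQ_offset)
      moreover from 2 have "limitin mtopology (\<lambda>n. \<sigma> (diagseq n) (\<tau> (diagseq n) k i)) p sequentially"
        by (rule limitin_sequentially_offset_rev)
      ultimately show ?thesis by blast
    qed
    then obtain T p where
      T: "\<And>k i. (\<lambda>n. \<tau> (diagseq n) k i) \<longlonglongrightarrow> T k i" and
      p: "\<And>k i. limitin mtopology (\<lambda>n. \<sigma> (diagseq n) (\<tau> (diagseq n) k i)) (p k i) sequentially" by metis
    obtain y where y: "y \<in> cadlag M d" "(\<lambda>n. skorokhod_dist d (\<sigma> (diagseq n)) y) \<longlonglongrightarrow> 0"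
    proof (rule skorokhod_limit[of "\<lambda>n. \<sigma> (diagseq n)" K \<delta> "\<lambda>n. \<tau> (diagseq n)" T p])
      show "\<sigma> (diagseq n) \<in> cadlag M d" for n using \<sigma> X by blast
    qed (use K \<sigma> \<delta> \<tau> T p in blast)+
    have "limitin sk.mtopology (\<sigma> \<circ> diagseq) y sequentially"
      unfolding sk.limitin_metric_dist_null
      using y \<sigma> X by (auto simp: o_def subset_iff)
    then show ?thesis using y(1) subseq_diagseq by blast
  qed
  then have "\<forall>T. T \<subseteq> X \<and> infinite T \<longrightarrow> cadlag M d \<inter> sk.mtopology derived_set_of T \<noteq> {}"
    using sk.Bolzano_Weierstrass_property[OF X X] by blast
  then show ?thesis unfolding sk.compact_closure_of_eq_Bolzano_Weierstrass by blast
qed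

end

section \<open>Partitions from the absence of two successive large increments\<close>

context Metric_space
begin

text \<open>\<open>c\<close> is the last time up to which the path stays within \<eta> of
  \<open>x a\<close>. Arbitrarily close to the right of \<open>c\<close>, possibly at
  \<open>c\<close> itself, there is a point \<open>s\<close> farther than \<eta> from
  \<open>x a\<close>. The first increment of a triple \<open>a\<close>, \<open>s\<close>,
  \<open>u\<close> is then large, which forces \<open>x u\<close> to within \<eta> of
  \<open>x s\<close>, hence of \<open>x c\<close> in the limit.\<close>

lemma cut_point:
  assumes x: "x \<in> cadlag M d" and ab: "0 \<le> a" "a \<le> b" and \<eta>: "0 \<le> \<eta>"
    and triple: "\<And>s t u. a \<le> s \<Longrightarrow> s < t \<Longrightarrow> t < u \<Longrightarrow> u < b \<Longrightarrow> d (x s) (x t) \<le> \<eta> \<or> d (x t) (x u) \<le> \<eta>"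
  obtains c where "a \<le> c" "c \<le> b"
    "\<And>s u. a \<le> s \<Longrightarrow> s < c \<Longrightarrow> a \<le> u \<Longrightarrow> u < c \<Longrightarrow> d (x s) (x u) \<le> 2 * \<eta>"
    "\<And>s u. c \<le> s \<Longrightarrow> s < b \<Longrightarrow> c \<le> u \<Longrightarrow> u < b \<Longrightarrow> d (x s) (x u) \<le> 2 * \<eta>"
proof -
  define A where "A = {t \<in> {a..b}. \<forall>s. a \<le> s \<and> s < t \<longrightarrow> d (x a) (x s) \<le> \<eta>}"
  have aA: "a \<in> A" using ab by (auto simp: A_def)
  have bdd: "bdd_above A" by (rule bdd_aboveI[of _ b]) (auto simp: A_def)
  define c where "c = Sup A"
  have c: "a \<le> c" "c \<le> b"
    unfolding c_def using aA bdd by (auto intro!: cSup_upper cSup_least simp: A_def)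
  have xM: "0 \<le> t \<Longrightarrow> x t \<in> M" for t using cadlag_mem[OF x] .
  have before: "d (x a) (x s) \<le> \<eta>" if s: "a \<le> s" "s < c" for s
  proof -
    obtain t where "t \<in> A" "s < t" using s(2) aA bdd unfolding c_def by (subst (asm) less_cSup_iff) auto
    then show ?thesis using s by (auto simp: A_def)
  qed
  have after: "d (x c) (x u) \<le> \<eta>" if u: "c \<le> u" "u < b" for u
  proof (rule ccontr)
    assume "\<not> ?thesis"
    then have pos: "0 < d (x c) (x u) - \<eta>" by simp
    have c0: "0 \<le> c" using c ab by simp
    have cu: "c < u" using pos u \<eta> xM[OF c0] by (cases "c = u") auto
    obtain h where h: "h > 0" "\<And>s. c \<le> s \<Longrightarrow> s < c + h \<Longrightarrow> d (x c) (x s) < d (x c) (x u) - \<eta>"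
      using cadlag_right[OF x c0 pos] by metis
    define v where "v = (c + min (c + h) u) / 2"
    have v: "c < v" "v < c + h" "v < u" using h cu by (auto simp: v_def min_def field_simps)
    have "v \<notin> A" using v(1) bdd cSup_upper[of v A] unfolding c_def by force
    then obtain s where s: "a \<le> s" "s < v" "\<eta> < d (x a) (x s)"
      using v c u by (auto simp: A_def)
    have "c \<le> s" using before[of s] s by force
    have "a \<noteq> s" using s \<eta> xM[OF ab(1)] by auto
    have "d (x c) (x s) < d (x c) (x u) - \<eta>" using h(2)[of s] \<open>c \<le> s\<close> s v by simp
    moreover have "d (x c) (x u) \<le> d (x c) (x s) + d (x s) (x u)"
      using c0 s cu ab by (intro triangle xM) auto
    moreover have "d (x a) (x s) \<le> \<eta> \<or> d (x s) (x u) \<le> \<eta>"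
      using s v u \<open>a \<noteq> s\<close> by (intro triple) auto
    ultimately show False using s by linarith
  qed
  show ?thesis
  proof (rule that[OF c])
    fix s u assume "a \<le> s" "s < c" "a \<le> u" "u < c"
    then show "d (x s) (x u) \<le> 2 * \<eta>"
      using before[of s] before[of u] triangle[OF xM xM xM, of s a u] ab commute[of "x s" "x a"] by simp
  next
    fix s u assume "c \<le> s" "s < b" "c \<le> u" "u < b"
    then show "d (x s) (x u) \<le> 2 * \<eta>"
      using after[of s] after[of u] triangle[OF xM xM xM, of s c u] ab c commute[of "x s" "x c"] by simp
  qed
qed

text \<open>The partition is built greedily. The invariant at the current point \<open>t\<close> is that the
  oscillation over \<open>[t, t + \<delta>)\<close> is at most \<open>2\<eta>\<close>; the cut point of the window
  \<open>[t, t + 3\<delta>)\<close> tells which point of \<open>[t + \<delta>, t + 2\<delta>]\<close> preserves it.\<close>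

lemma partition_exists:
  assumes x: "x \<in> cadlag M d" and \<delta>: "0 < \<delta>" and \<eta>: "0 \<le> \<eta>"
    and triple: "\<And>s t u. 0 \<le> s \<Longrightarrow> s \<le> T + 3 * \<delta> \<Longrightarrow> s < t \<Longrightarrow> t < u \<Longrightarrow> u < s + 3 * \<delta> \<Longrightarrow>
      d (x s) (x t) \<le> \<eta> \<or> d (x t) (x u) \<le> \<eta>"
    and start: "\<And>t. 0 \<le> t \<Longrightarrow> t < \<delta> \<Longrightarrow> d (x 0) (x t) \<le> \<eta>"
  shows "\<exists>\<tau>. spaced \<delta> \<tau> \<and> (\<forall>i s. \<tau> i \<le> T \<longrightarrow> \<tau> i \<le> s \<longrightarrow> s < \<tau> (Suc i) \<longrightarrow> d (x (\<tau> i)) (x s) \<le> 2 * \<eta>)"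
proof -
  have xM: "0 \<le> t \<Longrightarrow> x t \<in> M" for t using cadlag_mem[OF x] .
  \<comment> \<open>Past \<open>T\<close> the invariant is void: no oscillation bound is claimed
    there, and nodes are laid at distance \<delta>.\<close>
  define ok where "ok t \<longleftrightarrow> 0 \<le> t \<and>
    (t \<le> T \<longrightarrow> (\<forall>s u. t \<le> s \<and> s < t + \<delta> \<and> t \<le> u \<and> u < t + \<delta> \<longrightarrow> d (x s) (x u) \<le> 2 * \<eta>))" for t
  have "\<exists>\<tau>. \<forall>n. (ok (\<tau> n) \<and> (n = 0 \<longrightarrow> \<tau> n = 0)) \<and>
    (\<delta> \<le> \<tau> (Suc n) - \<tau> n \<and> \<tau> (Suc n) - \<tau> n \<le> 2 * \<delta> \<and>
      (\<tau> n \<le> T \<longrightarrow> (\<forall>s. \<tau> n \<le> s \<and> s < \<tau> (Suc n) \<longrightarrow> d (x (\<tau> n)) (x s) \<le> 2 * \<eta>)))"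
  proof (rule dependent_nat_choice)
    have "d (x s) (x u) \<le> 2 * \<eta>" if "0 \<le> s \<and> s < \<delta> \<and> 0 \<le> u \<and> u < \<delta>" for s u
      using start[of s] start[of u] triangle[OF xM xM xM, of s 0 u] that commute[of "x s" "x 0"] by simp
    then show "\<exists>t. ok t \<and> ((0::nat) = 0 \<longrightarrow> t = 0)" by (auto simp: ok_def)
  next
    fix t and n :: nat assume "ok t \<and> (n = 0 \<longrightarrow> t = 0)"
    then have t: "0 \<le> t"
      "\<And>s u. t \<le> T \<Longrightarrow> t \<le> s \<and> s < t + \<delta> \<and> t \<le> u \<and> u < t + \<delta> \<Longrightarrow> d (x s) (x u) \<le> 2 * \<eta>"
      by (auto simp: ok_def)
    show "\<exists>t'. (ok t' \<and> (Suc n = 0 \<longrightarrow> t' = 0)) \<and> \<delta> \<le> t' - t \<and> t' - t \<le> 2 * \<delta> \<and>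
        (t \<le> T \<longrightarrow> (\<forall>s. t \<le> s \<and> s < t' \<longrightarrow> d (x t) (x s) \<le> 2 * \<eta>))"
    proof (cases "t \<le> T")
      case False
      then show ?thesis using t \<delta> by (intro exI[of _ "t + \<delta>"]) (auto simp: ok_def)
    next
      case True
      have "d (x s) (x r) \<le> \<eta> \<or> d (x r) (x u) \<le> \<eta>" if "t \<le> s" "s < r" "r < u" "u < t + 3 * \<delta>" for s r u
        using that t True by (intro triple) auto
      then obtain c where c: "t \<le> c" "c \<le> t + 3 * \<delta>"
        "\<And>s u. t \<le> s \<Longrightarrow> s < c \<Longrightarrow> t \<le> u \<Longrightarrow> u < c \<Longrightarrow> d (x s) (x u) \<le> 2 * \<eta>"
        "\<And>s u. c \<le> s \<Longrightarrow> s < t + 3 * \<delta> \<Longrightarrow> c \<le> u \<Longrightarrow> u < t + 3 * \<delta> \<Longrightarrow> d (x s) (x u) \<le> 2 * \<eta>"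
        using cut_point[OF x t(1) _ \<eta>, of "t + 3 * \<delta>"] \<delta> by (smt (verit))
      \<comment> \<open>In the outer cases \<open>[t + \<delta>, t + 2\<delta>)\<close> lies
        entirely on one side of the cut, so \<open>t + \<delta>\<close> is a valid node. If the cut
        comes early, it may lie inside \<open>[t, t + \<delta>)\<close>, and the bound on that piece
        is the invariant at \<open>t\<close>.\<close>
      consider "c < t + \<delta>" | "t + \<delta> \<le> c" "c \<le> t + 2 * \<delta>" | "t + 2 * \<delta> < c" by linarith
      then show ?thesis
      proof cases
        case 1
        have "ok (t + \<delta>)" unfolding ok_def using t(1) \<delta> 1 by (auto intro!: c(4))
        then show ?thesis using \<delta> t(2)[OF True] by (intro exI[of _ "t + \<delta>"]) auto
      next
        case 2
        have "ok c" unfolding ok_def using t(1) \<delta> 2 by (auto intro!: c(4))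
        then show ?thesis using 2 \<delta> c(3)[of t] by (intro exI[of _ c]) auto
      next
        case 3
        have "ok (t + \<delta>)" unfolding ok_def using t(1) \<delta> 3 by (auto intro!: c(3))
        then show ?thesis using 3 \<delta> c(3)[of t] by (intro exI[of _ "t + \<delta>"]) auto
      qed
    qed
  qed
  then obtain \<tau> where \<tau>: "\<And>n. (n = 0 \<longrightarrow> \<tau> n = 0) \<and>
    (\<delta> \<le> \<tau> (Suc n) - \<tau> n \<and> \<tau> (Suc n) - \<tau> n \<le> 2 * \<delta> \<and>
      (\<tau> n \<le> T \<longrightarrow> (\<forall>s. \<tau> n \<le> s \<and> s < \<tau> (Suc n) \<longrightarrow> d (x (\<tau> n)) (x s) \<le> 2 * \<eta>)))" by blast
  then show ?thesis unfolding spaced_def by (intro exI[of _ \<tau>]) blast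
qed

end

section \<open>Finite jump processes\<close>

text \<open>The generator is a sum over jump labels rather than a matrix on \<open>S\<close>. A
  target must be a state only when its rate is nonzero: in the particle system, labels whose source
  is unoccupied have rate 0 and may lead out of the state space.\<close>

locale jump_process = Metric_space M d for M :: "'a set" and d +
  fixes S :: "'s set" and emb :: "'s \<Rightarrow> 'a" and J :: "'j set" and r :: "'s \<Rightarrow> 'j \<Rightarrow> real"
    and \<tau> :: "'s \<Rightarrow> 'j \<Rightarrow> 's" and Q :: "('s \<Rightarrow> real) \<Rightarrow> 's \<Rightarrow> real" and P :: "(real \<Rightarrow> 'a) measure"
  assumes finite_S: "finite S" and inj_emb: "inj_on emb S" and emb_M: "emb ` S \<subseteq> M"
    and Q_eq: "\<And>G c. c \<in> S \<Longrightarrow> Q G c = (\<Sum>j\<in>J. r c j * (G (\<tau> c j) - G c))"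
    and r_nonneg: "\<And>c j. c \<in> S \<Longrightarrow> j \<in> J \<Longrightarrow> 0 \<le> r c j"
    and \<tau>_S: "\<And>c j. c \<in> S \<Longrightarrow> j \<in> J \<Longrightarrow> r c j \<noteq> 0 \<Longrightarrow> \<tau> c j \<in> S"
    and law: "markov_jump_law M d S emb Q P"
begin

subsection \<open>The semigroup\<close>

lemma Q_mono:
  assumes "c \<in> S" "\<And>j. j \<in> J \<Longrightarrow> r c j \<noteq> 0 \<Longrightarrow> G (\<tau> c j) - G c \<le> H j"
  shows "Q G c \<le> (\<Sum>j\<in>J. r c j * H j)"
  unfolding Q_eq[OF assms(1)]
proof (rule sum_mono)
  fix j assume "j \<in> J"
  then show "r c j * (G (\<tau> c j) - G c) \<le> r c j * H j"
    using assms r_nonneg by (cases "r c j = 0") (auto intro!: mult_left_mono)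
qed

text \<open>A crude bound for the sup norm of \<open>Q\<close> on functions on \<open>S\<close>; it
  serves to make the exponential series summable.\<close>

definition \<Lambda> :: real where "\<Lambda> = 2 * (\<Sum>c\<in>S. \<Sum>j\<in>J. r c j)"

lemma Q_power_bound:
  assumes "\<And>c. c \<in> S \<Longrightarrow> \<bar>G c\<bar> \<le> m" "a \<in> S"
  shows "\<bar>(Q ^^ n) G a\<bar> \<le> \<Lambda> ^ n * m"
  using assms(2)
proof (induction n arbitrary: a)
  case 0 then show ?case using assms(1) by simp
next
  case (Suc n)
  have m: "0 \<le> \<Lambda> ^ n * m" using Suc.IH[OF Suc.prems] by linarith
  have "\<bar>(Q ^^ Suc n) G a\<bar> \<le> (\<Sum>j\<in>J. \<bar>r a j * ((Q ^^ n) G (\<tau> a j) - (Q ^^ n) G a)\<bar>)"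
    using Q_eq[OF Suc.prems] by simp
  also have "\<dots> \<le> (\<Sum>j\<in>J. r a j * (2 * (\<Lambda> ^ n * m)))"
  proof (rule sum_mono)
    fix j assume j: "j \<in> J"
    show "\<bar>r a j * ((Q ^^ n) G (\<tau> a j) - (Q ^^ n) G a)\<bar> \<le> r a j * (2 * (\<Lambda> ^ n * m))"
    proof (cases "r a j = 0")
      case False
      then have "\<bar>(Q ^^ n) G (\<tau> a j)\<bar> \<le> \<Lambda> ^ n * m" "\<bar>(Q ^^ n) G a\<bar> \<le> \<Lambda> ^ n * m"
        using Suc.IH \<tau>_S[OF Suc.prems j] Suc.prems by auto
      then have "\<bar>(Q ^^ n) G (\<tau> a j) - (Q ^^ n) G a\<bar> \<le> 2 * (\<Lambda> ^ n * m)" by linarith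
      then show ?thesis using r_nonneg[OF Suc.prems j] by (auto simp: abs_mult intro!: mult_left_mono)
    qed simp
  qed
  also have "\<dots> = 2 * (\<Sum>j\<in>J. r a j) * (\<Lambda> ^ n * m)"
    unfolding sum_distrib_left sum_distrib_right by (intro sum.cong) auto
  also have "\<dots> \<le> \<Lambda> * (\<Lambda> ^ n * m)"
  proof (rule mult_right_mono[OF _ m])
    have "(\<Sum>j\<in>J. r a j) \<le> (\<Sum>c\<in>S. \<Sum>j\<in>J. r c j)"
      using Suc.prems finite_S by (intro member_le_sum) (auto intro!: sum_nonneg r_nonneg)
    then show "2 * (\<Sum>j\<in>J. r a j) \<le> \<Lambda>" by (simp add: \<Lambda>_def)
  qed
  finally show ?case by simp
qed

lemma Q_power_bounded: "a \<in> S \<Longrightarrow> \<bar>(Q ^^ n) G a\<bar> \<le> \<Lambda> ^ n * (\<Sum>c\<in>S. \<bar>G c\<bar>)"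
  by (rule Q_power_bound) (auto intro!: member_le_sum finite_S)

text \<open>The matrix form of the powers, evaluated at states. It makes the semigroup a sum against
  the transition probabilities, which are all that the law specifies.\<close>

lemma Q_power_linear:
  "a \<in> S \<Longrightarrow> (Q ^^ n) G a = (\<Sum>b\<in>S. G b * (Q ^^ n) (\<lambda>c. if c = b then 1 else 0) a)"
proof (induction n arbitrary: a)
  case 0
  then show ?case using finite_S by (simp add: if_distrib sum.delta cong: if_cong)
next
  case (Suc n)
  let ?I = "\<lambda>b c. if c = b then 1 else (0::real)"
  have "(Q ^^ Suc n) G a = (\<Sum>j\<in>J. r a j * ((Q ^^ n) G (\<tau> a j) - (Q ^^ n) G a))"
    using Q_eq[OF Suc.prems] by simp
  also have "\<dots> = (\<Sum>j\<in>J. \<Sum>b\<in>S. G b * (r a j * ((Q ^^ n) (?I b) (\<tau> a j) - (Q ^^ n) (?I b) a)))"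
  proof (rule sum.cong[OF refl])
    fix j assume j: "j \<in> J"
    show "r a j * ((Q ^^ n) G (\<tau> a j) - (Q ^^ n) G a) =
        (\<Sum>b\<in>S. G b * (r a j * ((Q ^^ n) (?I b) (\<tau> a j) - (Q ^^ n) (?I b) a)))"
    proof (cases "r a j = 0")
      case False
      show ?thesis
        unfolding Suc.IH[OF \<tau>_S[OF Suc.prems j False]] Suc.IH[OF Suc.prems]
        by (simp add: sum_subtractf[symmetric] sum_distrib_left algebra_simps)
    qed simp
  qed
  also have "\<dots> = (\<Sum>b\<in>S. \<Sum>j\<in>J. G b * (r a j * ((Q ^^ n) (?I b) (\<tau> a j) - (Q ^^ n) (?I b) a)))"
    by (rule sum.swap)
  also have "\<dots> = (\<Sum>b\<in>S. G b * (Q ^^ Suc n) (?I b) a)"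
    using Q_eq[OF Suc.prems] by (simp add: sum_distrib_left)
  finally show ?case .
qed

abbreviation "p t a b \<equiv> exp_semigroup Q t (\<lambda>c. if c = b then 1 else 0) a"
abbreviation "E t G a \<equiv> exp_semigroup Q t G a"

lemma semigroup_summable:
  assumes "a \<in> S" shows "summable (\<lambda>n. (Q ^^ n) G a / fact n * t ^ n)"
proof (rule summable_comparison_test')
  let ?m = "\<Sum>c\<in>S. \<bar>G c\<bar>"
  show "summable (\<lambda>n. ?m * (inverse (fact n) * (\<Lambda> * \<bar>t\<bar>) ^ n))"
    by (intro summable_mult summable_exp)
  fix n
  have "norm ((Q ^^ n) G a / fact n * t ^ n) = \<bar>(Q ^^ n) G a\<bar> * (\<bar>t\<bar> ^ n / fact n)"
    by (simp add: abs_mult power_abs)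
  also have "\<dots> \<le> \<Lambda> ^ n * ?m * (\<bar>t\<bar> ^ n / fact n)"
    using Q_power_bounded[OF assms] by (intro mult_right_mono) auto
  finally show "norm ((Q ^^ n) G a / fact n * t ^ n) \<le> ?m * (inverse (fact n) * (\<Lambda> * \<bar>t\<bar>) ^ n)"
    by (simp add: power_mult_distrib field_simps)
qed

lemma semigroup_eq: "E t G a = (\<Sum>n. (Q ^^ n) G a / fact n * t ^ n)"
  unfolding exp_semigroup_def by (intro suminf_cong) (simp add: field_simps)

lemma semigroup_sum:
  assumes "a \<in> S" shows "E t G a = (\<Sum>b\<in>S. p t a b * G b)"
proof -
  let ?I = "\<lambda>b c. if c = b then 1 else (0::real)"
  have "E t G a = (\<Sum>n. \<Sum>b\<in>S. (Q ^^ n) (?I b) a / fact n * t ^ n * G b)"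
    unfolding semigroup_eq
  proof (rule suminf_cong)
    fix n
    show "(Q ^^ n) G a / fact n * t ^ n = (\<Sum>b\<in>S. (Q ^^ n) (?I b) a / fact n * t ^ n * G b)"
      by (subst Q_power_linear[OF assms]) (simp add: sum_divide_distrib sum_distrib_right sum_distrib_left mult_ac)
  qed
  also have "\<dots> = (\<Sum>b\<in>S. \<Sum>n. (Q ^^ n) (?I b) a / fact n * t ^ n * G b)"
    by (intro suminf_sum summable_mult2 semigroup_summable assms)
  also have "\<dots> = (\<Sum>b\<in>S. p t a b * G b)"
    unfolding semigroup_eq by (intro sum.cong refl suminf_mult2[symmetric] semigroup_summable assms)
  finally show ?thesis .
qed

text \<open>Termwise differentiation. The form with \<open>Q\<close> applied to \<open>G\<close>
  inside the semigroup is chosen because drift bounds are pointwise bounds on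
  \<open>Q G\<close>.\<close>

lemma semigroup_deriv:
  assumes "a \<in> S" shows "((\<lambda>t. E t G a) has_real_derivative E t (Q G) a) (at t)"
proof -
  have "((\<lambda>t. \<Sum>n. (Q ^^ n) G a / fact n * t ^ n) has_real_derivative
      (\<Sum>n. diffs (\<lambda>n. (Q ^^ n) G a / fact n) n * t ^ n)) (at t)"
    by (rule termdiffs_strong_converges_everywhere[OF semigroup_summable[OF assms]])
  moreover have "diffs (\<lambda>n. (Q ^^ n) G a / fact n) n = (Q ^^ n) (Q G) a / fact n" for n
    unfolding diffs_def by (simp add: funpow_swap1 fact_Suc del: of_nat_Suc)
  ultimately show ?thesis by (simp add: semigroup_eq)
qed

lemma semigroup_0: "E 0 G a = G a"
  unfolding semigroup_eq powser_zero by simp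

lemma semigroup_const:
  assumes "a \<in> S" shows "E t (\<lambda>_. c) a = c"
proof -
  \<comment> \<open>\<open>Q\<close> of a constant is known to vanish only at states, hence the
    rewriting as a sum over \<open>S\<close>.\<close>
  have "E t (Q (\<lambda>_. c)) a = 0" for t
    by (subst semigroup_sum[OF assms]) (simp add: Q_eq)
  then have "E t (\<lambda>_. c) a = E 0 (\<lambda>_. c) a"
    using semigroup_deriv[OF assms, of "\<lambda>_. c"] by (intro DERIV_isconst_all) simp
  then show ?thesis by (simp add: semigroup_0)
qed

subsection \<open>The coordinate process\<close>

lemma prob: "prob_space P" using law by (simp add: markov_jump_law_def)

sublocale prob_space P by (rule prob)

lemma sets_P: "sets P = sets (borel_measure_space (skorokhod_topology M d))"
  using law by (simp add: markov_jump_law_def)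

lemma space_P: "space P = cadlag M d"
  using sets_eq_imp_space_eq[OF sets_P] sets_borel_skorokhod(2) by simp

abbreviation "\<F> s \<equiv> path_filtration M d s"

lemma filtration:
  shows space_filtration: "space (\<F> s) = cadlag M d"
    and sets_filtration: "sets (\<F> s) \<subseteq> sets P"
    and filtrationI: "0 \<le> t \<Longrightarrow> t \<le> s \<Longrightarrow> openin mtopology U \<Longrightarrow> {\<omega> \<in> cadlag M d. \<omega> t \<in> U} \<in> sets (\<F> s)"
proof -
  let ?G = "{{\<omega> \<in> cadlag M d. \<omega> t \<in> U} | t U. 0 \<le> t \<and> t \<le> s \<and> openin mtopology U}"
  have G: "?G \<subseteq> Pow (cadlag M d)" by blast
  show "space (\<F> s) = cadlag M d" unfolding path_filtration_def using G by (simp add: space_measure_of_conv)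
  have sets: "sets (\<F> s) = sigma_sets (cadlag M d) ?G" unfolding path_filtration_def using G by simp
  have "?G \<subseteq> sets P" unfolding sets_P using evaluation_measurable by blast
  from sets.sigma_sets_subset[OF this] show "sets (\<F> s) \<subseteq> sets P" unfolding sets space_P .
  show "0 \<le> t \<Longrightarrow> t \<le> s \<Longrightarrow> openin mtopology U \<Longrightarrow> {\<omega> \<in> cadlag M d. \<omega> t \<in> U} \<in> sets (\<F> s)"
    unfolding sets by (rule sigma_sets.Basic) blast
qed

lemma filtration_point:
  assumes "0 \<le> t" "t \<le> s" "m \<in> M" shows "{\<omega> \<in> cadlag M d. \<omega> t = m} \<in> sets (\<F> s)"
proof -
  have "openin mtopology (M - {m})"
    using assms(3) closedin_Hausdorff_sing_eq[OF Hausdorff_space_mtopology, of m] by (simp add: openin_closedin_eq double_diff)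
  from filtrationI[OF assms(1,2) this]
  have "space (\<F> s) - {\<omega> \<in> cadlag M d. \<omega> t \<in> M - {m}} \<in> sets (\<F> s)" by (rule sets.compl_sets)
  moreover have "space (\<F> s) - {\<omega> \<in> cadlag M d. \<omega> t \<in> M - {m}} = {\<omega> \<in> cadlag M d. \<omega> t = m}"
    using cadlag_mem assms(1) by (auto simp: space_filtration)
  ultimately show ?thesis by simp
qed

lemma S_nonempty: "S \<noteq> {}"
proof
  assume "S = {}"
  then have "AE \<omega> in P. \<forall>t\<ge>0. \<omega> t \<in> {}" using law by (simp add: markov_jump_law_def)
  then have "AE \<omega> in P. False" by (rule AE_mp) (auto intro!: AE_I2)
  then show False using AE_False by simp
qed

text \<open>The coordinate process read in \<open>S\<close>. The default state, used off the almost
  sure event, makes functions of \<open>X\<close> bounded and \<open>S\<close>-valued on every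
  path.\<close>

definition X :: "real \<Rightarrow> (real \<Rightarrow> 'a) \<Rightarrow> 's" where
  "X t \<omega> = (if \<omega> t \<in> emb ` S then the_inv_into S emb (\<omega> t) else (SOME a. a \<in> S))"

definition regular :: "(real \<Rightarrow> 'a) \<Rightarrow> bool" where
  "regular \<omega> \<longleftrightarrow> \<omega> \<in> cadlag M d \<and> (\<forall>t\<ge>0. \<omega> t \<in> emb ` S)"

lemma X_S: "X t \<omega> \<in> S"
  using S_nonempty some_in_eq[of S] the_inv_into_into[OF inj_emb _ subset_refl] by (auto simp: X_def)

lemma emb_X: "\<omega> t \<in> emb ` S \<Longrightarrow> emb (X t \<omega>) = \<omega> t"
  by (simp add: X_def f_the_inv_into_f[OF inj_emb])

lemma X_eq_iff: "\<omega> t \<in> emb ` S \<Longrightarrow> a \<in> S \<Longrightarrow> X t \<omega> = a \<longleftrightarrow> \<omega> t = emb a"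
  using emb_X X_S inj_emb by (metis inj_on_eq_iff)

lemma AE_regular: "AE \<omega> in P. regular \<omega>"
  using law AE_space by (auto simp: markov_jump_law_def regular_def space_P elim!: AE_mp)

lemma X_filtration:
  assumes "0 \<le> t" "t \<le> s" shows "X t \<in> measurable (\<F> s) (count_space S)"
  unfolding measurable_count_space_eq2[OF finite_S]
proof (intro conjI ballI)
  show "X t \<in> space (\<F> s) \<rightarrow> S" using X_S by blast
  fix a assume a: "a \<in> S"
  have pt: "{\<omega> \<in> cadlag M d. \<omega> t = emb b} \<in> sets (\<F> s)" if "b \<in> S" for b
    using that emb_M by (intro filtration_point assms) auto
  then have "(\<Union>b\<in>S. {\<omega> \<in> cadlag M d. \<omega> t = emb b}) \<in> sets (\<F> s)" by (intro sets.finite_UN finite_S)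
  from sets.compl_sets[OF this]
  have c: "{\<omega> \<in> cadlag M d. \<omega> t \<notin> emb ` S} \<in> sets (\<F> s)"
    by (rule back_subst[where P = "\<lambda>A. A \<in> sets (\<F> s)"]) (auto simp: space_filtration)
  have "X t -` {a} \<inter> space (\<F> s) = {\<omega> \<in> cadlag M d. \<omega> t = emb a} \<union>
      (if a = (SOME a. a \<in> S) then {\<omega> \<in> cadlag M d. \<omega> t \<notin> emb ` S} else {})"
    using X_eq_iff[OF _ a] a by (auto simp: space_filtration) (auto simp: X_def split: if_splits)
  then show "X t -` {a} \<inter> space (\<F> s) \<in> sets (\<F> s)" using pt[OF a] c by auto
qed

lemma X_measurable [measurable]: "0 \<le> t \<Longrightarrow> X t \<in> measurable P (count_space S)"
  using X_filtration[of t t] sets_filtration[of t] space_filtration[of t] space_P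
  by (auto simp: measurable_def)

lemma X_event:
  assumes "0 \<le> t" "t \<le> s" shows "{\<omega> \<in> space P. X t \<omega> = a} \<in> sets (\<F> s)"
proof -
  have "X t -` ({a} \<inter> S) \<inter> space (\<F> s) \<in> sets (\<F> s)"
    using assms by (intro measurable_sets[OF X_filtration]) auto
  also have "X t -` ({a} \<inter> S) \<inter> space (\<F> s) = {\<omega> \<in> space P. X t \<omega> = a}"
    using X_S by (auto simp: space_P space_filtration)
  finally show ?thesis .
qed

lemma X_fun_measurable [measurable]:
  fixes g :: "'s \<Rightarrow> real" shows "0 \<le> t \<Longrightarrow> (\<lambda>\<omega>. g (X t \<omega>)) \<in> borel_measurable P"
  by (rule measurable_compose[OF X_measurable]) auto

lemma X_fun2_measurable [measurable]:
  fixes g :: "'s \<Rightarrow> 's \<Rightarrow> real"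
  assumes "0 \<le> s" "0 \<le> t" shows "(\<lambda>\<omega>. g (X s \<omega>) (X t \<omega>)) \<in> borel_measurable P"
  by (rule measurable_compose_countable'[OF X_fun_measurable X_measurable]) (use assms finite_S countable_finite in auto)

lemma bounded_integrable:
  fixes f :: "_ \<Rightarrow> real"
  assumes "f \<in> borel_measurable P" "\<And>\<omega>. \<bar>f \<omega>\<bar> \<le> B" shows "integrable P f"
  using assms by (intro integrable_const_bound[of _ B]) auto

lemma fun2_bound:
  fixes g :: "'s \<Rightarrow> 's \<Rightarrow> real" shows "\<bar>g (X s \<omega>) (X t \<omega>)\<bar> \<le> (\<Sum>a\<in>S. \<Sum>b\<in>S. \<bar>g a b\<bar>)"
proof -
  have "\<bar>g (X s \<omega>) (X t \<omega>)\<bar> \<le> (\<Sum>b\<in>S. \<bar>g (X s \<omega>) b\<bar>)"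
    using X_S finite_S by (intro member_le_sum) auto
  also have "\<dots> \<le> (\<Sum>a\<in>S. \<Sum>b\<in>S. \<bar>g a b\<bar>)"
    using X_S finite_S by (intro member_le_sum[of "X s \<omega>" S "\<lambda>a. \<Sum>b\<in>S. \<bar>g a b\<bar>"]) (auto intro!: sum_nonneg)
  finally show ?thesis .
qed

lemma fun2_integrable:
  fixes g :: "'s \<Rightarrow> 's \<Rightarrow> real"
  assumes "0 \<le> s" "0 \<le> t" "A \<in> sets P"
  shows "integrable P (\<lambda>\<omega>. indicator A \<omega> * g (X s \<omega>) (X t \<omega>))"
  by (rule bounded_integrable[of _ "\<Sum>a\<in>S. \<Sum>b\<in>S. \<bar>g a b\<bar>"])
    (use assms fun2_bound[of g] in \<open>auto simp: abs_mult indicator_def intro!: sum_nonneg\<close>)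

lemma fun2_integrable':
  fixes g :: "'s \<Rightarrow> 's \<Rightarrow> real"
  assumes "0 \<le> s" "0 \<le> t" shows "integrable P (\<lambda>\<omega>. g (X s \<omega>) (X t \<omega>))"
  by (rule bounded_integrable[OF _ fun2_bound]) (use assms in auto)

text \<open>The Markov clause of the law transferred from path values to \<open>X\<close>; the
  events differ by null sets.\<close>

lemma markov:
  assumes st: "0 \<le> s" "0 \<le> t" and A: "A \<in> sets (\<F> s)" and ab: "a \<in> S" "b \<in> S"
  shows "measure P {\<omega> \<in> A. X s \<omega> = a \<and> X (s + t) \<omega> = b} = measure P {\<omega> \<in> A. X s \<omega> = a} * p t a b"
proof -
  have AP: "A \<in> sets P" "A \<subseteq> cadlag M d" using A sets_filtration sets.sets_into_space space_filtration by blast+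
  have pt: "{\<omega> \<in> cadlag M d. \<omega> t = emb b} \<in> sets P" if "b \<in> S" "0 \<le> t" for b t
    using filtration_point[of t t] sets_filtration that emb_M by blast
  have m1: "{\<omega> \<in> A. \<omega> s = emb a \<and> \<omega> (s + t) = emb b} \<in> sets P"
  proof -
    have "A \<inter> {\<omega> \<in> cadlag M d. \<omega> s = emb a} \<inter> {\<omega> \<in> cadlag M d. \<omega> (s + t) = emb b} \<in> sets P"
      using pt AP st ab by auto
    then show ?thesis by (rule back_subst[where P = "\<lambda>A. A \<in> sets P"]) (use AP in auto)
  qed
  have m2: "{\<omega> \<in> A. \<omega> s = emb a} \<in> sets P"
  proof -
    have "A \<inter> {\<omega> \<in> cadlag M d. \<omega> s = emb a} \<in> sets P" using pt AP st ab by auto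
    then show ?thesis by (rule back_subst[where P = "\<lambda>A. A \<in> sets P"]) (use AP in auto)
  qed
  have ev: "{\<omega> \<in> space P. X t \<omega> = b} \<in> sets P" if "0 \<le> t" for t b
    using X_event[OF that order.refl] sets_filtration by blast
  have m3: "{\<omega> \<in> A. X s \<omega> = a \<and> X (s + t) \<omega> = b} \<in> sets P"
  proof -
    have "A \<inter> {\<omega> \<in> space P. X s \<omega> = a} \<inter> {\<omega> \<in> space P. X (s + t) \<omega> = b} \<in> sets P"
      using ev AP st by auto
    then show ?thesis by (rule back_subst[where P = "\<lambda>A. A \<in> sets P"]) (use AP in \<open>auto simp: space_P\<close>)
  qed
  have m4: "{\<omega> \<in> A. X s \<omega> = a} \<in> sets P"
  proof -
    have "A \<inter> {\<omega> \<in> space P. X s \<omega> = a} \<in> sets P" using ev AP st by auto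
    then show ?thesis by (rule back_subst[where P = "\<lambda>A. A \<in> sets P"]) (use AP in \<open>auto simp: space_P\<close>)
  qed
  have "AE \<omega> in P. \<omega> \<in> {\<omega> \<in> A. X s \<omega> = a \<and> X (s + t) \<omega> = b} \<longleftrightarrow>
      \<omega> \<in> {\<omega> \<in> A. \<omega> s = emb a \<and> \<omega> (s + t) = emb b}"
    using AE_regular by eventually_elim (use X_eq_iff ab st in \<open>auto simp: regular_def\<close>)
  from measure_eq_AE[OF this m3 m1]
  have 1: "measure P {\<omega> \<in> A. X s \<omega> = a \<and> X (s + t) \<omega> = b} =
      measure P {\<omega> \<in> A. \<omega> s = emb a \<and> \<omega> (s + t) = emb b}" .
  have "AE \<omega> in P. \<omega> \<in> {\<omega> \<in> A. X s \<omega> = a} \<longleftrightarrow> \<omega> \<in> {\<omega> \<in> A. \<omega> s = emb a}"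
    using AE_regular by eventually_elim (use X_eq_iff ab st in \<open>auto simp: regular_def\<close>)
  from measure_eq_AE[OF this m4 m2]
  have 2: "measure P {\<omega> \<in> A. X s \<omega> = a} = measure P {\<omega> \<in> A. \<omega> s = emb a}" .
  show ?thesis unfolding 1 2 using law st A ab by (simp add: markov_jump_law_def)
qed

text \<open>Conditioning on \<open>X s = a\<close> freezes the first argument of \<open>g\<close>.
  Displacements and positive increments from the current state are therefore covered.\<close>

lemma expectation_markov:
  fixes g :: "'s \<Rightarrow> 's \<Rightarrow> real"
  assumes st: "0 \<le> s" "0 \<le> t" and A: "A \<in> sets (\<F> s)"
  shows "(LINT \<omega>|P. indicator A \<omega> * g (X s \<omega>) (X (s + t) \<omega>)) =
    (\<Sum>a\<in>S. measure P {\<omega> \<in> A. X s \<omega> = a} * E t (g a) a)"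
proof -
  have AP: "A \<in> sets P" "A \<subseteq> space P" using A sets_filtration sets.sets_into_space space_filtration space_P by blast+
  let ?B = "\<lambda>a b. {\<omega> \<in> A. X s \<omega> = a \<and> X (s + t) \<omega> = b}"
  have ev: "{\<omega> \<in> space P. X t \<omega> = b} \<in> sets P" if "0 \<le> t" for t b
    using X_event[OF that order.refl] sets_filtration by blast
  have B: "?B a b \<in> sets P" for a b
  proof -
    have "A \<inter> {\<omega> \<in> space P. X s \<omega> = a} \<inter> {\<omega> \<in> space P. X (s + t) \<omega> = b} \<in> sets P"
      using ev AP st by auto
    then show ?thesis by (rule back_subst[where P = "\<lambda>A. A \<in> sets P"]) (use AP in auto)
  qed
  have eq: "indicator A \<omega> * g (X s \<omega>) (X (s + t) \<omega>) = (\<Sum>a\<in>S. \<Sum>b\<in>S. g a b * indicator (?B a b) \<omega>)" for \<omega>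
  proof -
    have "(\<Sum>a\<in>S. \<Sum>b\<in>S. g a b * indicator (?B a b) \<omega>) =
        (\<Sum>a\<in>S. if X s \<omega> = a then (\<Sum>b\<in>S. if X (s + t) \<omega> = b then g a b * indicator A \<omega> else 0) else 0)"
      by (intro sum.cong refl) (auto simp: indicator_def intro!: sum.neutral sum.cong)
    then show ?thesis using X_S finite_S by (simp add: sum.delta' mult.commute)
  qed
  have "(LINT \<omega>|P. indicator A \<omega> * g (X s \<omega>) (X (s + t) \<omega>)) = (\<Sum>a\<in>S. \<Sum>b\<in>S. g a b * measure P (?B a b))"
    unfolding eq using B
    by (subst Bochner_Integration.integral_sum; (intro Bochner_Integration.integrable_sum integrable_mult_right integrable_real_indicator)?)
      (auto simp: Bochner_Integration.integral_sum emeasure_eq_measure intro!: sum.cong)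
  also have "\<dots> = (\<Sum>a\<in>S. measure P {\<omega> \<in> A. X s \<omega> = a} * E t (g a) a)"
    by (intro sum.cong refl, subst semigroup_sum) (auto simp: sum_distrib_left markov[OF st A] mult_ac intro!: sum.cong)
  finally show ?thesis .
qed

subsection \<open>Drift estimates\<close>

definition reached :: "'s \<Rightarrow> bool" where
  "reached a \<longleftrightarrow> a \<in> S \<and> (\<exists>s\<ge>0. 0 < measure P {\<omega> \<in> space P. X s \<omega> = a})"

text \<open>Positivity of the transition probabilities is not proved from the power series: it is
  inherited from the law, which suffices for the states that carry mass.\<close>

lemma p_nonneg:
  assumes "reached a" "0 \<le> t" "b \<in> S" shows "0 \<le> p t a b"
proof -
  obtain s where s: "0 \<le> s" "0 < measure P {\<omega> \<in> space P. X s \<omega> = a}" and a: "a \<in> S"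
    using assms(1) by (auto simp: reached_def)
  have "space P \<in> sets (\<F> s)" using sets.top[of "\<F> s"] by (simp add: space_filtration space_P)
  note m = markov[OF s(1) assms(2) this a assms(3)]
  have "0 \<le> measure P {\<omega> \<in> space P. X s \<omega> = a \<and> X (s + t) \<omega> = b}" by (rule measure_nonneg)
  then have "0 \<le> measure P {\<omega> \<in> space P. X s \<omega> = a} * p t a b" unfolding m .
  then show ?thesis using s(2) by (simp add: zero_le_mult_iff)
qed

lemma E_mono:
  assumes "reached a" "0 \<le> t" "\<And>c. c \<in> S \<Longrightarrow> G c \<le> H c"
  shows "E t G a \<le> E t H a"
proof -
  have a: "a \<in> S" using assms(1) by (simp add: reached_def)
  have "(\<Sum>b\<in>S. p t a b * G b) \<le> (\<Sum>b\<in>S. p t a b * H b)"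
    using assms p_nonneg by (intro sum_mono mult_left_mono) auto
  then show ?thesis using semigroup_sum[OF a, of t G] semigroup_sum[OF a, of t H] by simp
qed

lemma E_mult:
  assumes "a \<in> S" shows "E t (\<lambda>c. k * G c) a = k * E t G a"
proof -
  have "(\<Sum>b\<in>S. p t a b * (k * G b)) = k * (\<Sum>b\<in>S. p t a b * G b)"
    by (simp add: sum_distrib_left mult_ac)
  then show ?thesis using semigroup_sum[OF assms, of t G] semigroup_sum[OF assms, of t "\<lambda>c. k * G c"] by simp
qed

lemma E_drift:
  assumes a: "a \<in> S" and t: "0 \<le> t" and B: "\<And>s. 0 \<le> s \<Longrightarrow> s \<le> t \<Longrightarrow> E s (Q G) a \<le> B"
  shows "E t G a \<le> G a + B * t"
proof -
  have "B * 0 - E 0 G a \<le> B * t - E t G a"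
  proof (rule DERIV_nonneg_imp_nondecreasing[OF t])
    fix s assume s: "0 \<le> s" "s \<le> t"
    have "((\<lambda>s. B * s - E s G a) has_real_derivative (B - E s (Q G) a)) (at s)"
      by (auto intro!: derivative_eq_intros semigroup_deriv[OF a])
    then show "\<exists>y. ((\<lambda>s. B * s - E s G a) has_real_derivative y) (at s) \<and> 0 \<le> y"
      using B[OF s] by auto
  qed
  then show ?thesis by (simp add: semigroup_0)
qed

text \<open>Gronwall: \<open>exp (- A * t) * E t G a\<close> is nonincreasing in
  \<open>t\<close>.\<close>

lemma E_growth:
  assumes a: "reached a" and t: "0 \<le> t" and A: "\<And>c. c \<in> S \<Longrightarrow> Q G c \<le> A * G c"
  shows "E t G a \<le> exp (A * t) * G a"
proof -
  have aS: "a \<in> S" using a by (simp add: reached_def)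
  have "- (exp (- A * 0) * E 0 G a) \<le> - (exp (- A * t) * E t G a)"
  proof (rule DERIV_nonneg_imp_nondecreasing[OF t])
    fix s assume s: "0 \<le> s" "s \<le> t"
    have "((\<lambda>s. - (exp (- A * s) * E s G a)) has_real_derivative
        exp (- A * s) * (A * E s G a - E s (Q G) a)) (at s)"
      by (auto intro!: derivative_eq_intros semigroup_deriv[OF aS] simp: algebra_simps)
    moreover have "E s (Q G) a \<le> E s (\<lambda>c. A * G c) a" using s A by (intro E_mono a) auto
    then have "0 \<le> exp (- A * s) * (A * E s G a - E s (Q G) a)" by (simp add: E_mult[OF aS])
    ultimately show "\<exists>y. ((\<lambda>s. - (exp (- A * s) * E s G a)) has_real_derivative y) (at s) \<and> 0 \<le> y"
      by blast
  qed
  then have "exp (- A * t) * E t G a \<le> G a" by (simp add: semigroup_0)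
  then have "exp (A * t) * (exp (- A * t) * E t G a) \<le> exp (A * t) * G a" by (intro mult_left_mono) auto
  then show ?thesis by (simp add: mult.assoc[symmetric] exp_add[symmetric])
qed

text \<open>A state of positive mass under \<open>A\<close> at time \<open>s\<close> is reached, and
  the others contribute 0; so a semigroup bound at reached states is enough.\<close>

lemma expectation_le:
  fixes g :: "'s \<Rightarrow> 's \<Rightarrow> real"
  assumes st: "0 \<le> s" "0 \<le> t" and A: "A \<in> sets (\<F> s)" and B: "\<And>a. reached a \<Longrightarrow> E t (g a) a \<le> B a"
  shows "(LINT \<omega>|P. indicator A \<omega> * g (X s \<omega>) (X (s + t) \<omega>)) \<le> (LINT \<omega>|P. indicator A \<omega> * B (X s \<omega>))"
proof -
  have AP: "A \<subseteq> space P" "A \<in> sets P" using A sets_filtration sets.sets_into_space space_filtration space_P by blast+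
  have ev: "{\<omega> \<in> space P. X s \<omega> = b} \<in> sets P" for b
    using X_event[OF st(1) order.refl] sets_filtration by blast
  have "(\<Sum>a\<in>S. measure P {\<omega> \<in> A. X s \<omega> = a} * E t (g a) a) \<le> (\<Sum>a\<in>S. measure P {\<omega> \<in> A. X s \<omega> = a} * B a)"
  proof (rule sum_mono)
    fix a assume a: "a \<in> S"
    show "measure P {\<omega> \<in> A. X s \<omega> = a} * E t (g a) a \<le> measure P {\<omega> \<in> A. X s \<omega> = a} * B a"
    proof (cases "measure P {\<omega> \<in> A. X s \<omega> = a} = 0")
      case False
      have "measure P {\<omega> \<in> A. X s \<omega> = a} \<le> measure P {\<omega> \<in> space P. X s \<omega> = a}"
        using AP ev by (intro finite_measure_mono) auto
      moreover have "0 < measure P {\<omega> \<in> A. X s \<omega> = a}" using False by (simp add: zero_less_measure_iff)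
      ultimately have "0 < measure P {\<omega> \<in> space P. X s \<omega> = a}" by linarith
      then have "reached a" using a st(1) by (auto simp: reached_def)
      then show ?thesis using B by (intro mult_left_mono) auto
    qed simp
  qed
  also have "\<dots> = (LINT \<omega>|P. indicator A \<omega> * B (X s \<omega>))"
    using expectation_markov[OF st(1) order.refl A, of "\<lambda>a _. B a"] by (simp add: semigroup_0)
  finally show ?thesis unfolding expectation_markov[OF st A] .
qed

lemma space_in_filtration: "space P \<in> sets (\<F> s)"
  using sets.top[of "\<F> s"] by (simp add: space_filtration space_P)

lemma expectation_le':
  fixes g :: "'s \<Rightarrow> 's \<Rightarrow> real"
  assumes st: "0 \<le> s" "0 \<le> t" and B: "\<And>a. reached a \<Longrightarrow> E t (g a) a \<le> B a"
  shows "(LINT \<omega>|P. g (X s \<omega>) (X (s + t) \<omega>)) \<le> (LINT \<omega>|P. B (X s \<omega>))"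
proof -
  have "(LINT \<omega>|P. indicator (space P) \<omega> * g (X s \<omega>) (X (s + t) \<omega>)) = (LINT \<omega>|P. g (X s \<omega>) (X (s + t) \<omega>))"
    "(LINT \<omega>|P. indicator (space P) \<omega> * B (X s \<omega>)) = (LINT \<omega>|P. B (X s \<omega>))"
    by (auto intro!: Bochner_Integration.integral_cong)
  then show ?thesis using expectation_le[OF st space_in_filtration B] by simp
qed

definition dS :: "'s \<Rightarrow> 's \<Rightarrow> real" where "dS a b = d (emb a) (emb b)"

lemma dS_triangle: "a \<in> S \<Longrightarrow> b \<in> S \<Longrightarrow> c \<in> S \<Longrightarrow> dS a c \<le> dS a b + dS b c"
  unfolding dS_def using emb_M by (intro triangle) auto

lemma dS_nonneg: "0 \<le> dS a b" by (simp add: dS_def)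

lemma dS_self: "a \<in> S \<Longrightarrow> dS a a = 0" using emb_M by (auto simp: dS_def)

text \<open>By the triangle inequality, \<open>Q\<close> applied to the distance from the starting
  point is at most the displacement rate, wherever the process currently is.\<close>

lemma E_dist:
  assumes C: "\<And>c. c \<in> S \<Longrightarrow> (\<Sum>j\<in>J. r c j * dS c (\<tau> c j)) \<le> C" and a: "reached a" and t: "0 \<le> t"
  shows "E t (dS a) a \<le> C * t"
proof -
  have aS: "a \<in> S" using a by (simp add: reached_def)
  have "Q (dS a) c \<le> C" if c: "c \<in> S" for c
  proof -
    have "Q (dS a) c \<le> (\<Sum>j\<in>J. r c j * dS c (\<tau> c j))"
      using dS_triangle[OF aS c] \<tau>_S[OF c] by (intro Q_mono[OF c]) (simp add: diff_le_eq add.commute)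
    then show ?thesis using C[OF c] by linarith
  qed
  then have "E s (Q (dS a)) a \<le> C" if "0 \<le> s" for s
    using E_mono[OF a that, of "Q (dS a)" "\<lambda>_. C"] semigroup_const[OF aS] by simp
  from E_drift[OF aS t this] show ?thesis by (simp add: dS_self[OF aS])
qed

lemma expectation_dist:
  assumes C: "\<And>c. c \<in> S \<Longrightarrow> (\<Sum>j\<in>J. r c j * dS c (\<tau> c j)) \<le> C" and st: "0 \<le> s" "0 \<le> t" "A \<in> sets (\<F> s)"
  shows "(LINT \<omega>|P. indicator A \<omega> * dS (X s \<omega>) (X (s + t) \<omega>)) \<le> C * t * measure P A"
proof -
  have "A \<in> sets P" using st sets_filtration by blast
  have "(LINT \<omega>|P. indicator A \<omega> * dS (X s \<omega>) (X (s + t) \<omega>)) \<le> (LINT \<omega>|P. indicator A \<omega> * (C * t))"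
    using E_dist[OF C _ st(2)] by (intro expectation_le[OF st]) auto
  then show ?thesis using \<open>A \<in> sets P\<close> by (simp add: mult.commute)
qed

lemma C_nonneg:
  assumes C: "\<And>c. c \<in> S \<Longrightarrow> (\<Sum>j\<in>J. r c j * dS c (\<tau> c j)) \<le> C" shows "0 \<le> C"
proof -
  obtain c where c: "c \<in> S" using S_nonempty by blast
  have "0 \<le> (\<Sum>j\<in>J. r c j * dS c (\<tau> c j))" using r_nonneg c dS_nonneg by (intro sum_nonneg mult_nonneg_nonneg) auto
  then show ?thesis using C[OF c] by linarith
qed

lemma expectation_dist1:
  assumes C: "\<And>c. c \<in> S \<Longrightarrow> (\<Sum>j\<in>J. r c j * dS c (\<tau> c j)) \<le> C" and st: "0 \<le> s" "0 \<le> t"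
  shows "(LINT \<omega>|P. dS (X s \<omega>) (X (s + t) \<omega>)) \<le> C * t"
proof -
  have "(LINT \<omega>|P. dS (X s \<omega>) (X (s + t) \<omega>)) \<le> (LINT \<omega>|P. C * t)"
    using E_dist[OF C _ st(2)] by (intro expectation_le'[OF st]) auto
  then show ?thesis by (simp add: prob_space)
qed

text \<open>The first increment is known at time \<open>t\<close> because
  \<open>s + h \<le> t\<close>. Given its two endpoints the second has conditional mean at most
  \<open>C * h\<close>; summing over the endpoints leaves the mean of the first.\<close>

lemma expectation_dist2:
  assumes C: "\<And>c. c \<in> S \<Longrightarrow> (\<Sum>j\<in>J. r c j * dS c (\<tau> c j)) \<le> C" and st: "0 \<le> s" "0 \<le> h" "s + h \<le> t"
  shows "(LINT \<omega>|P. dS (X s \<omega>) (X (s + h) \<omega>) * dS (X t \<omega>) (X (t + h) \<omega>)) \<le> (C * h)\<^sup>2"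
proof -
  let ?A = "\<lambda>a b. {\<omega> \<in> space P. X s \<omega> = a \<and> X (s + h) \<omega> = b}"
  have t: "0 \<le> t" "s \<le> t" using st by linarith+
  have A: "?A a b \<in> sets (\<F> t)" for a b
  proof -
    have "{\<omega> \<in> space P. X s \<omega> = a} \<inter> {\<omega> \<in> space P. X (s + h) \<omega> = b} \<in> sets (\<F> t)"
      using st t by (intro sets.Int X_event) auto
    then show ?thesis by (rule back_subst[where P = "\<lambda>A. A \<in> sets (\<F> t)"]) auto
  qed
  then have AP: "?A a b \<in> sets P" for a b using sets_filtration by blast
  have ind: "(\<Sum>a\<in>S. \<Sum>b\<in>S. f a b * indicator (?A a b) \<omega>) = f (X s \<omega>) (X (s + h) \<omega>)"
    if "\<omega> \<in> space P" for \<omega> and f :: "'s \<Rightarrow> 's \<Rightarrow> real"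
  proof -
    have "(\<Sum>a\<in>S. \<Sum>b\<in>S. f a b * indicator (?A a b) \<omega>) =
        (\<Sum>a\<in>S. if X s \<omega> = a then (\<Sum>b\<in>S. if X (s + h) \<omega> = b then f a b else 0) else 0)"
      using that by (intro sum.cong refl) (auto simp: indicator_def intro!: sum.neutral sum.cong)
    then show ?thesis using X_S finite_S by (simp add: sum.delta')
  qed
  have int: "integrable P (\<lambda>\<omega>. dS a b * (indicator (?A a b) \<omega> * dS (X t \<omega>) (X (t + h) \<omega>)))" for a b
    using AP t st by (intro integrable_mult_right fun2_integrable) auto
  have "(LINT \<omega>|P. dS (X s \<omega>) (X (s + h) \<omega>) * dS (X t \<omega>) (X (t + h) \<omega>)) =
      (LINT \<omega>|P. (\<Sum>a\<in>S. \<Sum>b\<in>S. dS a b * (indicator (?A a b) \<omega> * dS (X t \<omega>) (X (t + h) \<omega>))))"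
    by (intro Bochner_Integration.integral_cong refl)
      (simp add: ind[symmetric] sum_distrib_right mult.assoc)
  also have "\<dots> = (\<Sum>a\<in>S. \<Sum>b\<in>S. dS a b * (LINT \<omega>|P. indicator (?A a b) \<omega> * dS (X t \<omega>) (X (t + h) \<omega>)))"
    using int by (simp add: Bochner_Integration.integral_sum)
  also have "\<dots> \<le> (\<Sum>a\<in>S. \<Sum>b\<in>S. dS a b * (C * h * measure P (?A a b)))"
    using expectation_dist[OF C t(1) st(2) A] dS_nonneg by (intro sum_mono mult_left_mono) auto
  also have "\<dots> = C * h * (\<Sum>a\<in>S. \<Sum>b\<in>S. dS a b * measure P (?A a b))"
    by (simp add: sum_distrib_left mult_ac)
  also have "(\<Sum>a\<in>S. \<Sum>b\<in>S. dS a b * measure P (?A a b)) = (LINT \<omega>|P. (\<Sum>a\<in>S. \<Sum>b\<in>S. dS a b * indicator (?A a b) \<omega>))"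
    using AP by (simp add: Bochner_Integration.integral_sum emeasure_eq_measure)
  also have "\<dots> = (LINT \<omega>|P. dS (X s \<omega>) (X (s + h) \<omega>))"
    by (intro Bochner_Integration.integral_cong refl) (rule ind)
  also have "C * h * \<dots> \<le> C * h * (C * h)"
    using expectation_dist1[OF C st(1,2)] C_nonneg[OF C] st by (intro mult_left_mono) auto
  finally show ?thesis by (simp add: power2_eq_square)
qed

subsection \<open>Exceptional events on dyadic grids\<close>

definition grid :: "real \<Rightarrow> real \<Rightarrow> nat \<Rightarrow> nat \<Rightarrow> real" where
  "grid a l m i = a + l * real i / 2 ^ m"

lemma grid_nonneg: "0 \<le> a \<Longrightarrow> 0 \<le> l \<Longrightarrow> 0 \<le> grid a l m i" by (simp add: grid_def)

lemma grid_Suc: "grid a l m (Suc i) = grid a l m i + l / 2 ^ m" by (simp add: grid_def field_simps)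

lemma grid_refine: "grid a l (Suc m) (2 * i) = grid a l m i" by (simp add: grid_def)

lemma grid_mono: "0 \<le> l \<Longrightarrow> i \<le> j \<Longrightarrow> grid a l m i \<le> grid a l m j"
  by (simp add: grid_def divide_right_mono mult_left_mono)

lemma grid_hit:
  assumes "0 < l" "a \<le> t" "t < a + l" "0 < h"
  obtains m0 where "\<And>m. m0 \<le> m \<Longrightarrow> \<exists>i\<le>2 ^ m. t \<le> grid a l m i \<and> grid a l m i < t + h"
proof -
  obtain m0 :: nat where m0: "l / h < 2 ^ m0" using real_arch_pow[of 2 "l / h"] by auto
  show ?thesis
  proof (rule that)
    fix m assume "m0 \<le> m"
    then have "l / h < 2 ^ m" using m0 power_increasing[of m0 m "2::real"] by linarith
    then have lh: "l / 2 ^ m < h" using assms(4) by (simp add: field_simps)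
    define i where "i = nat \<lceil>(t - a) * 2 ^ m / l\<rceil>"
    have i: "(t - a) * 2 ^ m / l \<le> real i" "real i < (t - a) * 2 ^ m / l + 1"
      using assms by (auto simp: i_def ceiling_correct) linarith
    have "(t - a) * 2 ^ m \<le> l * 2 ^ m" using assms by (intro mult_right_mono) auto
    then have "(t - a) * 2 ^ m / l \<le> 2 ^ m" using assms by (simp add: pos_divide_le_eq mult.commute)
    then have "(t - a) * 2 ^ m / l \<le> real_of_int (2 ^ m)" by simp
    then have "\<lceil>(t - a) * 2 ^ m / l\<rceil> \<le> 2 ^ m" by (rule ceiling_le)
    then have "i \<le> 2 ^ m" unfolding i_def by (simp add: nat_le_iff)
    moreover have "t \<le> grid a l m i" using i(1) assms(1) by (simp add: grid_def field_simps)
    moreover have "grid a l m i < t + h"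
    proof -
      have "l * real i / 2 ^ m < l * ((t - a) * 2 ^ m / l + 1) / 2 ^ m"
        using i(2) assms(1) by (intro divide_strict_right_mono mult_strict_left_mono) auto
      also have "\<dots> = (t - a) + l / 2 ^ m" using assms(1) by (simp add: field_simps)
      finally show ?thesis using lh by (simp add: grid_def)
    qed
    ultimately show "\<exists>i\<le>2 ^ m. t \<le> grid a l m i \<and> grid a l m i < t + h" by blast
  qed
qed

text \<open>The finitely many other states are at a positive minimal distance from the current one,
  so right continuity forces constancy.\<close>

lemma regular_right_const:
  assumes "regular \<omega>" "0 \<le> t"
  obtains h where "h > 0" "\<And>s. t \<le> s \<Longrightarrow> s < t + h \<Longrightarrow> X s \<omega> = X t \<omega>"
proof -
  have \<omega>: "\<omega> \<in> cadlag M d" "\<And>t. 0 \<le> t \<Longrightarrow> \<omega> t \<in> emb ` S" using assms by (auto simp: regular_def)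
  let ?D = "(\<lambda>b. dS (X t \<omega>) b) ` (S - {X t \<omega>})"
  have pos: "0 < x" if x: "x \<in> ?D" for x
  proof -
    from x obtain b where b: "b \<in> S" "b \<noteq> X t \<omega>" "x = dS (X t \<omega>) b" by auto
    then have "emb b \<noteq> emb (X t \<omega>)" using X_S inj_emb by (auto simp: inj_on_def)
    then show ?thesis using b emb_M X_S by (auto simp: dS_def image_subset_iff less_le)
  qed
  \<comment> \<open>The element 1 keeps the minimum defined when \<open>S\<close> is a
    singleton.\<close>
  define e where "e = Min (insert 1 ?D)"
  have e: "0 < e" "\<And>x. x \<in> ?D \<Longrightarrow> e \<le> x"
    using finite_S pos by (auto simp: e_def)
  obtain h where h: "h > 0" "\<And>s. t \<le> s \<Longrightarrow> s < t + h \<Longrightarrow> d (\<omega> t) (\<omega> s) < e"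
    using cadlag_right[OF \<omega>(1) assms(2) e(1)] by metis
  show ?thesis
  proof (rule that[OF h(1)], rule ccontr)
    fix s assume s: "t \<le> s" "s < t + h" and ne: "X s \<omega> \<noteq> X t \<omega>"
    have "dS (X t \<omega>) (X s \<omega>) < e" using h(2)[OF s] s assms \<omega>(2) by (simp add: dS_def emb_X)
    moreover have "e \<le> dS (X t \<omega>) (X s \<omega>)" using ne X_S by (intro e(2)) auto
    ultimately show False by simp
  qed
qed

text \<open>Passage from grids to continuous time. The dyadic grids are nested, so the bad events
  increase and their common bound passes to the union. A violation at three real times also occurs
  on a fine grid, because paths are constant just to the right of each of them.\<close>

lemma grid_exception:
  fixes R :: "'s \<Rightarrow> 's \<Rightarrow> 's \<Rightarrow> bool"
  defines "B \<equiv> \<lambda>a l m. {\<omega> \<in> space P. \<exists>i j k. i < j \<and> j < k \<and> k \<le> 2 ^ m \<and>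
    R (X (grid a l m i) \<omega>) (X (grid a l m j) \<omega>) (X (grid a l m k) \<omega>)}"
  assumes al: "0 \<le> a" "0 < l" and b: "\<And>m. B a l m \<in> sets P \<Longrightarrow> measure P (B a l m) \<le> b"
  obtains N where "N \<in> sets P" "measure P N \<le> b"
    "\<And>\<omega> s t u. regular \<omega> \<Longrightarrow> \<omega> \<notin> N \<Longrightarrow> a \<le> s \<Longrightarrow> s < t \<Longrightarrow> t < u \<Longrightarrow> u < a + l \<Longrightarrow>
      \<not> R (X s \<omega>) (X t \<omega>) (X u \<omega>)"
proof -
  have sets: "B a l m \<in> sets P" for m
  proof -
    have ev: "{\<omega> \<in> space P. X (grid a l m i) \<omega> = c} \<in> sets P" for i c
      using X_event[OF grid_nonneg[OF al(1) less_imp_le[OF al(2)]] order.refl] sets_filtration by blast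
    have "(\<Union>(i, j, k)\<in>{(i, j, k). i < j \<and> j < k \<and> k \<le> 2 ^ m}. \<Union>(x, y, z)\<in>{(x, y, z) \<in> S \<times> S \<times> S. R x y z}.
        {\<omega> \<in> space P. X (grid a l m i) \<omega> = x} \<inter> {\<omega> \<in> space P. X (grid a l m j) \<omega> = y} \<inter>
        {\<omega> \<in> space P. X (grid a l m k) \<omega> = z}) \<in> sets P"
    proof (rule sets.finite_UN)
      have "{(i, j, k). i < j \<and> j < k \<and> k \<le> (2::nat) ^ m} \<subseteq> {..2 ^ m} \<times> {..2 ^ m} \<times> {..2 ^ m}" by auto
      then show "finite {(i, j, k). i < j \<and> j < k \<and> k \<le> (2::nat) ^ m}" by (rule finite_subset) auto
      have fin: "finite {(x, y, z) \<in> S \<times> S \<times> S. R x y z}"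
        by (rule finite_subset[of _ "S \<times> S \<times> S"]) (auto simp: finite_S)
      fix q :: "nat \<times> nat \<times> nat"
      obtain i j k where q: "q = (i, j, k)" by (cases q)
      show "(case q of (i, j, k) \<Rightarrow> \<Union>(x, y, z)\<in>{(x, y, z) \<in> S \<times> S \<times> S. R x y z}.
        {\<omega> \<in> space P. X (grid a l m i) \<omega> = x} \<inter> {\<omega> \<in> space P. X (grid a l m j) \<omega> = y} \<inter>
        {\<omega> \<in> space P. X (grid a l m k) \<omega> = z}) \<in> sets P"
        unfolding q prod.case by (intro sets.finite_UN[OF fin]) (auto intro: ev)
    qed
    moreover have "B a l m = (\<Union>(i, j, k)\<in>{(i, j, k). i < j \<and> j < k \<and> k \<le> 2 ^ m}. \<Union>(x, y, z)\<in>{(x, y, z) \<in> S \<times> S \<times> S. R x y z}.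
        {\<omega> \<in> space P. X (grid a l m i) \<omega> = x} \<inter> {\<omega> \<in> space P. X (grid a l m j) \<omega> = y} \<inter>
        {\<omega> \<in> space P. X (grid a l m k) \<omega> = z})"
      unfolding B_def using X_S by (auto 4 4)
    ultimately show ?thesis by simp
  qed
  have inc: "incseq (B a l)"
  proof (rule incseq_SucI, rule subsetI)
    fix m \<omega> assume "\<omega> \<in> B a l m"
    then obtain i j k where "\<omega> \<in> space P" "i < j" "j < k" "k \<le> 2 ^ m"
      "R (X (grid a l m i) \<omega>) (X (grid a l m j) \<omega>) (X (grid a l m k) \<omega>)" unfolding B_def by blast
    then show "\<omega> \<in> B a l (Suc m)"
      unfolding B_def by (intro CollectI conjI exI[of _ "2 * i"] exI[of _ "2 * j"] exI[of _ "2 * k"]) (auto simp: grid_refine)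
  qed
  show ?thesis
  proof (rule that)
    show "(\<Union>m. B a l m) \<in> sets P" using sets by auto
    have "(\<lambda>m. measure P (B a l m)) \<longlonglongrightarrow> measure P (\<Union>m. B a l m)"
      using sets inc by (intro finite_Lim_measure_incseq) auto
    then show "measure P (\<Union>m. B a l m) \<le> b" using b[OF sets] by (intro LIMSEQ_le_const2) auto
    fix \<omega> s t u
    assume \<omega>: "regular \<omega>" "\<omega> \<notin> (\<Union>m. B a l m)" and stu: "a \<le> s" "s < t" "t < u" "u < a + l"
    have nn: "0 \<le> s" "0 \<le> t" "0 \<le> u" using stu al by linarith+
    obtain h1 where h1: "h1 > 0" "\<And>v. s \<le> v \<Longrightarrow> v < s + h1 \<Longrightarrow> X v \<omega> = X s \<omega>"
      using regular_right_const[OF \<omega>(1) nn(1)] by metis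
    obtain h2 where h2: "h2 > 0" "\<And>v. t \<le> v \<Longrightarrow> v < t + h2 \<Longrightarrow> X v \<omega> = X t \<omega>"
      using regular_right_const[OF \<omega>(1) nn(2)] by metis
    obtain h3 where h3: "h3 > 0" "\<And>v. u \<le> v \<Longrightarrow> v < u + h3 \<Longrightarrow> X v \<omega> = X u \<omega>"
      using regular_right_const[OF \<omega>(1) nn(3)] by metis
    \<comment> \<open>Staying below the next time keeps the three grid points in strict
      order.\<close>
    obtain m1 where m1: "\<And>m. m1 \<le> m \<Longrightarrow> \<exists>i\<le>2 ^ m. s \<le> grid a l m i \<and> grid a l m i < s + min h1 (t - s)"
      using grid_hit[of l a s "min h1 (t - s)"] al stu h1 by auto
    obtain m2 where m2: "\<And>m. m2 \<le> m \<Longrightarrow> \<exists>i\<le>2 ^ m. t \<le> grid a l m i \<and> grid a l m i < t + min h2 (u - t)"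
      using grid_hit[of l a t "min h2 (u - t)"] al stu h2 by auto
    obtain m3 where m3: "\<And>m. m3 \<le> m \<Longrightarrow> \<exists>i\<le>2 ^ m. u \<le> grid a l m i \<and> grid a l m i < u + h3"
      using grid_hit[of l a u h3] al stu h3 by auto
    define m where "m = max m1 (max m2 m3)"
    have mm: "m1 \<le> m" "m2 \<le> m" "m3 \<le> m" by (auto simp: m_def)
    obtain i where i: "i \<le> 2 ^ m" "s \<le> grid a l m i" "grid a l m i < s + min h1 (t - s)" using m1[OF mm(1)] by blast
    obtain j where j: "j \<le> 2 ^ m" "t \<le> grid a l m j" "grid a l m j < t + min h2 (u - t)" using m2[OF mm(2)] by blast
    obtain k where k: "k \<le> 2 ^ m" "u \<le> grid a l m k" "grid a l m k < u + h3" using m3[OF mm(3)] by blast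
    have "i < j" using i j grid_mono[of l j i a m] al by (force simp: not_less[symmetric])
    moreover have "j < k" using j k grid_mono[of l k j a m] al by (force simp: not_less[symmetric])
    moreover have Xeq: "X (grid a l m i) \<omega> = X s \<omega>" "X (grid a l m j) \<omega> = X t \<omega>" "X (grid a l m k) \<omega> = X u \<omega>"
      using h1(2)[of "grid a l m i"] h2(2)[of "grid a l m j"] h3(2)[of "grid a l m k"] i j k by auto
    moreover have "\<omega> \<in> space P" using \<omega>(1) unfolding regular_def space_P by (rule conjunct1)
    ultimately have in_B: "\<omega> \<in> B a l m" if "R (X s \<omega>) (X t \<omega>) (X u \<omega>)"
      unfolding B_def using k(1) that
      by (intro CollectI conjI exI[of _ i] exI[of _ j] exI[of _ k]) (simp_all only: Xeq)
    show "\<not> R (X s \<omega>) (X t \<omega>) (X u \<omega>)"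
    proof
      assume "R (X s \<omega>) (X t \<omega>) (X u \<omega>)"
      from in_B[OF this] show False using \<omega>(2) by (simp add: UN_iff)
    qed
  qed
qed

lemma markov_bound:
  assumes "integrable P f" "\<And>\<omega>. 0 \<le> f \<omega>" "0 < c" "\<And>\<omega>. \<omega> \<in> B \<Longrightarrow> c \<le> f \<omega>" "B \<in> sets P" "(LINT \<omega>|P. f \<omega>) \<le> b"
  shows "measure P B \<le> b / c"
proof -
  have [measurable]: "f \<in> borel_measurable P" using assms(1) by simp
  have "measure P B \<le> measure P {\<omega> \<in> space P. c \<le> f \<omega>}"
    using assms(4) sets.sets_into_space[OF assms(5)] by (intro finite_measure_mono) auto
  also have "\<dots> \<le> (LINT \<omega>|P. f \<omega>) / c"
    using assms by (intro integral_Markov_inequality_measure[of _ _ "{}"]) auto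
  also have "\<dots> \<le> b / c" using assms by (intro divide_right_mono) auto
  finally show ?thesis .
qed

lemma dS_sum:
  assumes "i \<le> j" shows "dS (X (g i) \<omega>) (X (g j) \<omega>) \<le> (\<Sum>k=i..<j. dS (X (g k) \<omega>) (X (g (Suc k)) \<omega>))"
  using assms
proof (induction j rule: dec_induct)
  case base then show ?case by (simp add: dS_self X_S)
next
  case (step j)
  have "dS (X (g i) \<omega>) (X (g (Suc j)) \<omega>) \<le> dS (X (g i) \<omega>) (X (g j) \<omega>) + dS (X (g j) \<omega>) (X (g (Suc j)) \<omega>)"
    by (intro dS_triangle X_S)
  then show ?case using step by simp
qed

text \<open>If two consecutive grid increments exceed \<eta>, the product of the corresponding sums
  of one-step displacements exceeds \<open>\<eta>\<^sup>2\<close>. Its index ranges are disjoint and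
  ordered, so it is dominated by \<open>D\<close>, the sum over pairs \<open>i < j\<close>. The
  bound on the expectation of \<open>D\<close> does not depend on the mesh, and Markov's inequality
  concludes.\<close>

lemma triple_exception:
  assumes C: "\<And>c. c \<in> S \<Longrightarrow> (\<Sum>j\<in>J. r c j * dS c (\<tau> c j)) \<le> C" and al: "0 \<le> a" "0 < l" and \<eta>: "0 < \<eta>"
  obtains N where "N \<in> sets P" "measure P N \<le> (C * l)\<^sup>2 / \<eta>\<^sup>2"
    "\<And>\<omega> s t u. regular \<omega> \<Longrightarrow> \<omega> \<notin> N \<Longrightarrow> a \<le> s \<Longrightarrow> s < t \<Longrightarrow> t < u \<Longrightarrow> u < a + l \<Longrightarrow>
      d (\<omega> s) (\<omega> t) \<le> \<eta> \<or> d (\<omega> t) (\<omega> u) \<le> \<eta>"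
proof -
  let ?R = "\<lambda>x y z. \<eta> < dS x y \<and> \<eta> < dS y z"
  obtain N where N: "N \<in> sets P" "measure P N \<le> (C * l)\<^sup>2 / \<eta>\<^sup>2"
    "\<And>\<omega> s t u. regular \<omega> \<Longrightarrow> \<omega> \<notin> N \<Longrightarrow> a \<le> s \<Longrightarrow> s < t \<Longrightarrow> t < u \<Longrightarrow> u < a + l \<Longrightarrow>
      \<not> ?R (X s \<omega>) (X t \<omega>) (X u \<omega>)"
  proof (rule grid_exception[OF al, of ?R "(C * l)\<^sup>2 / \<eta>\<^sup>2"])
    fix m
    let ?g = "grid a l m" and ?h = "l / 2 ^ m" and ?n = "2 ^ m :: nat"
    let ?w = "\<lambda>i \<omega>. dS (X (?g i) \<omega>) (X (?g (Suc i)) \<omega>)"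
    let ?I = "{(i, j). i < j \<and> j < ?n}"
    let ?B = "{\<omega> \<in> space P. \<exists>i j k. i < j \<and> j < k \<and> k \<le> ?n \<and> ?R (X (?g i) \<omega>) (X (?g j) \<omega>) (X (?g k) \<omega>)}"
    assume B: "?B \<in> sets P"
    have finI: "finite ?I" by (rule finite_subset[of _ "{..<?n} \<times> {..<?n}"]) auto
    have cardI: "real (card ?I) \<le> (2 ^ m)\<^sup>2"
    proof -
      have "card ?I \<le> card ({..<?n} \<times> {..<?n})" by (intro card_mono) auto
      then have "card ?I \<le> ?n * ?n" by simp
      then have "real (card ?I) \<le> real (?n * ?n)" by (rule of_nat_mono)
      then show ?thesis by (simp add: power2_eq_square)
    qed
    have gnn: "0 \<le> ?g i" for i using al by (simp add: grid_nonneg)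
    define D where "D \<omega> = (\<Sum>(i, j)\<in>?I. ?w i \<omega> * ?w j \<omega>)" for \<omega>
    have meas: "?w i \<in> borel_measurable P" for i using gnn by measurable
    have wb: "\<bar>?w i \<omega>\<bar> \<le> (\<Sum>a\<in>S. \<Sum>b\<in>S. \<bar>dS a b\<bar>)" (is "_ \<le> ?b") for i \<omega> by (rule fun2_bound)
    have intw: "integrable P (\<lambda>\<omega>. ?w i \<omega> * ?w j \<omega>)" for i j
    proof (rule bounded_integrable)
      show "(\<lambda>\<omega>. ?w i \<omega> * ?w j \<omega>) \<in> borel_measurable P" using meas by measurable
      show "\<bar>?w i \<omega> * ?w j \<omega>\<bar> \<le> ?b * ?b" for \<omega>
        unfolding abs_mult by (intro mult_mono wb) (auto intro!: sum_nonneg)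
    qed
    have intD: "integrable P D" unfolding D_def using intw by (auto simp: case_prod_unfold)
    have h: "0 \<le> ?h" using al by simp
    have ED: "(LINT \<omega>|P. D \<omega>) \<le> (C * l)\<^sup>2"
    proof -
      have "(LINT \<omega>|P. D \<omega>) = (\<Sum>(i, j)\<in>?I. LINT \<omega>|P. ?w i \<omega> * ?w j \<omega>)"
        unfolding D_def using intw by (simp add: case_prod_unfold Bochner_Integration.integral_sum)
      also have "\<dots> \<le> (\<Sum>(i, j)\<in>?I. (C * ?h)\<^sup>2)"
      proof (intro sum_mono, clarify)
        fix i j :: nat assume "i < j" "j < ?n"
        then have "?g i + ?h \<le> ?g j" using grid_mono[of l "Suc i" j a m] al by (simp add: grid_Suc)
        then show "(LINT \<omega>|P. ?w i \<omega> * ?w j \<omega>) \<le> (C * ?h)\<^sup>2"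
          unfolding grid_Suc by (intro expectation_dist2 C gnn h)
      qed
      also have "\<dots> = real (card ?I) * (C * ?h)\<^sup>2" by simp
      also have "\<dots> \<le> (2 ^ m)\<^sup>2 * (C * ?h)\<^sup>2" using cardI by (intro mult_right_mono) auto
      also have "\<dots> = (C * l)\<^sup>2" by (simp add: power_mult_distrib power_divide)
      finally show ?thesis .
    qed
    have D0: "0 \<le> D \<omega>" for \<omega> unfolding D_def by (intro sum_nonneg) (auto simp: dS_nonneg)
    show "measure P ?B \<le> (C * l)\<^sup>2 / \<eta>\<^sup>2"
    proof (rule markov_bound[OF intD D0 _ _ B ED])
      show "0 < \<eta>\<^sup>2" using \<eta> by simp
      fix \<omega> assume "\<omega> \<in> ?B"
      then obtain i j k where ijk: "i < j" "j < k" "k \<le> ?n" "?R (X (?g i) \<omega>) (X (?g j) \<omega>) (X (?g k) \<omega>)" by blast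
      have 1: "\<eta> \<le> (\<Sum>q=i..<j. ?w q \<omega>)" "\<eta> \<le> (\<Sum>q=j..<k. ?w q \<omega>)"
        using dS_sum[of i j ?g \<omega>] dS_sum[of j k ?g \<omega>] ijk by linarith+
      have "\<eta>\<^sup>2 \<le> (\<Sum>q=i..<j. ?w q \<omega>) * (\<Sum>q=j..<k. ?w q \<omega>)"
        unfolding power2_eq_square using 1 \<eta> by (intro mult_mono) auto
      also have "\<dots> = (\<Sum>(q, q')\<in>{i..<j} \<times> {j..<k}. ?w q \<omega> * ?w q' \<omega>)"
        by (simp add: sum_product sum.cartesian_product)
      also have "\<dots> \<le> D \<omega>"
        unfolding D_def using ijk by (intro sum_mono2 finI) (auto simp: dS_nonneg)
      finally show "\<eta>\<^sup>2 \<le> D \<omega>" .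
    qed
  qed (use that in blast)
  show ?thesis
  proof (rule that[OF N(1,2)])
    fix \<omega> s t u
    assume *: "regular \<omega>" "\<omega> \<notin> N" "a \<le> s" "s < t" "t < u" "u < a + l"
    then have "\<omega> s \<in> emb ` S" "\<omega> t \<in> emb ` S" "\<omega> u \<in> emb ` S" using al by (auto simp: regular_def)
    then show "d (\<omega> s) (\<omega> t) \<le> \<eta> \<or> d (\<omega> t) (\<omega> u) \<le> \<eta>"
      using N(3)[OF *] by (auto simp: dS_def emb_X not_less)
  qed
qed

text \<open>The node 0 is prescribed, so a jump just after it cannot be isolated by choosing another
  node. This occurs in one window only, where the first-order bound is small enough.\<close>

lemma start_exception:
  assumes C: "\<And>c. c \<in> S \<Longrightarrow> (\<Sum>j\<in>J. r c j * dS c (\<tau> c j)) \<le> C" and l: "0 < l" and \<eta>: "0 < \<eta>"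
  obtains N where "N \<in> sets P" "measure P N \<le> C * l / \<eta>"
    "\<And>\<omega> t. regular \<omega> \<Longrightarrow> \<omega> \<notin> N \<Longrightarrow> 0 \<le> t \<Longrightarrow> t < l \<Longrightarrow> d (\<omega> 0) (\<omega> t) \<le> \<eta>"
proof -
  let ?R = "\<lambda>x y z. \<eta> < dS x y"
  obtain N where N: "N \<in> sets P" "measure P N \<le> C * l / \<eta>"
    "\<And>\<omega> s t u. regular \<omega> \<Longrightarrow> \<omega> \<notin> N \<Longrightarrow> 0 \<le> s \<Longrightarrow> s < t \<Longrightarrow> t < u \<Longrightarrow> u < 0 + l \<Longrightarrow>
      \<not> ?R (X s \<omega>) (X t \<omega>) (X u \<omega>)"
  proof (rule grid_exception[OF order.refl l, of ?R "C * l / \<eta>"])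
    fix m
    let ?g = "grid 0 l m" and ?h = "l / 2 ^ m" and ?n = "2 ^ m :: nat"
    let ?w = "\<lambda>i \<omega>. dS (X (?g i) \<omega>) (X (?g (Suc i)) \<omega>)"
    let ?B = "{\<omega> \<in> space P. \<exists>i j k. i < j \<and> j < k \<and> k \<le> ?n \<and> ?R (X (?g i) \<omega>) (X (?g j) \<omega>) (X (?g k) \<omega>)}"
    assume B: "?B \<in> sets P"
    have gnn: "0 \<le> ?g i" for i using l by (simp add: grid_nonneg)
    have int: "integrable P (?w i)" for i using gnn by (intro fun2_integrable')
    show "measure P ?B \<le> C * l / \<eta>"
    proof (rule markov_bound[OF _ _ \<eta> _ B])
      show "integrable P (\<lambda>\<omega>. \<Sum>i<?n. ?w i \<omega>)" using int by auto
      show "0 \<le> (\<Sum>i<?n. ?w i \<omega>)" for \<omega> by (intro sum_nonneg dS_nonneg)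
      have "(LINT \<omega>|P. (\<Sum>i<?n. ?w i \<omega>)) = (\<Sum>i<?n. LINT \<omega>|P. ?w i \<omega>)"
        using int by (simp add: Bochner_Integration.integral_sum)
      also have "\<dots> \<le> (\<Sum>i<?n. C * ?h)"
        using expectation_dist1[OF C gnn, of ?h] l by (intro sum_mono) (simp add: grid_Suc)
      also have "\<dots> = C * l" by simp
      finally show "(LINT \<omega>|P. (\<Sum>i<?n. ?w i \<omega>)) \<le> C * l" .
      fix \<omega> assume "\<omega> \<in> ?B"
      then obtain i j k where ijk: "i < j" "j < k" "k \<le> ?n" "?R (X (?g i) \<omega>) (X (?g j) \<omega>) (X (?g k) \<omega>)" by blast
      have "\<eta> \<le> (\<Sum>q=i..<j. ?w q \<omega>)" using dS_sum[of i j ?g \<omega>] ijk by linarith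
      also have "\<dots> \<le> (\<Sum>q<?n. ?w q \<omega>)" using ijk by (intro sum_mono2) (auto simp: dS_nonneg)
      finally show "\<eta> \<le> (\<Sum>i<?n. ?w i \<omega>)" .
    qed
  qed (use that in blast)
  show ?thesis
  proof (rule that[OF N(1,2)])
    fix \<omega> t assume *: "regular \<omega>" "\<omega> \<notin> N" "0 \<le> t" "t < l"
    then have \<omega>: "\<omega> 0 \<in> emb ` S" "\<omega> t \<in> emb ` S" by (auto simp: regular_def)
    show "d (\<omega> 0) (\<omega> t) \<le> \<eta>"
    proof (cases "t = 0")
      case True then show ?thesis using \<omega> emb_M \<eta> by auto
    next
      case False
      \<comment> \<open>\<open>(t + l) / 2\<close> completes the pattern of three times demanded by
        \<open>grid_exception\<close>.\<close>
      then have "\<not> ?R (X 0 \<omega>) (X t \<omega>) (X ((t + l) / 2) \<omega>)" using * N(3)[of \<omega> 0 t "(t + l) / 2"] by auto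
      then show ?thesis using \<omega> by (simp add: dS_def emb_X not_less)
    qed
  qed
qed

text \<open>No maximal inequality is needed: on a grid, \<open>F\<close> stays below its initial value plus the sum of
  its positive increments, and the expectation of that sum is bounded uniformly in the mesh.\<close>

lemma moment_exception:
  assumes F: "\<And>c. c \<in> S \<Longrightarrow> 0 \<le> F c" and A: "0 \<le> A"
    and drift: "\<And>c. c \<in> S \<Longrightarrow> (\<Sum>j\<in>J. r c j * max 0 (F (\<tau> c j) - F c)) \<le> A * (1 + F c)"
    and init: "(LINT \<omega>|P. F (X 0 \<omega>)) \<le> m0" and l: "0 < l" and R: "0 < R"
  obtains N where "N \<in> sets P" "measure P N \<le> (m0 + A * l * exp (A * l) * (1 + m0)) / R"
    "\<And>\<omega> t. regular \<omega> \<Longrightarrow> \<omega> \<notin> N \<Longrightarrow> 0 \<le> t \<Longrightarrow> t < l \<Longrightarrow> F (X t \<omega>) \<le> R"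
proof -
  let ?R = "\<lambda>x y z. R < F x" and ?c = "m0 + A * l * exp (A * l) * (1 + m0)"
  \<comment> \<open>The constant 1 turns the affine drift bound into a linear one, as
    \<open>E_growth\<close> requires.\<close>
  have H: "Q (\<lambda>c. 1 + F c) c \<le> A * (1 + F c)" if c: "c \<in> S" for c
    using Q_mono[OF c, of "\<lambda>c. 1 + F c" "\<lambda>j. max 0 (F (\<tau> c j) - F c)"] drift[OF c] by simp
  have E_H: "E t (\<lambda>c. 1 + F c) a \<le> exp (A * t) * (1 + F a)" if "reached a" "0 \<le> t" for a t
    using E_growth[OF that H] by simp
  have EF: "(LINT \<omega>|P. 1 + F (X s \<omega>)) \<le> exp (A * s) * (1 + m0)" if s: "0 \<le> s" for s
  proof -
    have "(LINT \<omega>|P. 1 + F (X (0 + s) \<omega>)) \<le> (LINT \<omega>|P. exp (A * s) * (1 + F (X 0 \<omega>)))"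
      using E_H s by (intro expectation_le'[of 0 s "\<lambda>a b. 1 + F b"]) auto
    also have "\<dots> = exp (A * s) * (1 + (LINT \<omega>|P. F (X 0 \<omega>)))"
      using fun2_integrable'[of 0 0 "\<lambda>a b. F a"] by (simp add: prob_space)
    also have "\<dots> \<le> exp (A * s) * (1 + m0)" using init by (intro mult_left_mono) auto
    finally show ?thesis by simp
  qed
  \<comment> \<open>The positive part of the increment from a frozen state \<open>a\<close> grows
    under a jump by at most the positive part of the jump of \<open>F\<close>, so the drift bound
    applies without reference to \<open>a\<close>.\<close>
  have inc: "E t (\<lambda>b. max 0 (F b - F a)) a \<le> A * t * exp (A * t) * (1 + F a)" if a: "reached a" and t: "0 \<le> t" for a t
  proof -
    have aS: "a \<in> S" using a by (simp add: reached_def)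
    have "E s (Q (\<lambda>b. max 0 (F b - F a))) a \<le> A * (exp (A * t) * (1 + F a))" if s: "0 \<le> s" "s \<le> t" for s
    proof -
      have "E s (Q (\<lambda>b. max 0 (F b - F a))) a \<le> E s (\<lambda>c. A * (1 + F c)) a"
      proof (rule E_mono[OF a s(1)])
        fix c assume c: "c \<in> S"
        have "Q (\<lambda>b. max 0 (F b - F a)) c \<le> (\<Sum>j\<in>J. r c j * max 0 (F (\<tau> c j) - F c))"
          by (intro Q_mono[OF c]) auto
        then show "Q (\<lambda>b. max 0 (F b - F a)) c \<le> A * (1 + F c)" using drift[OF c] by linarith
      qed
      also have "\<dots> = A * E s (\<lambda>c. 1 + F c) a" by (rule E_mult[OF aS])
      also have "\<dots> \<le> A * (exp (A * s) * (1 + F a))" using A E_H[OF a s(1)] by (intro mult_left_mono)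
      also have "\<dots> \<le> A * (exp (A * t) * (1 + F a))"
        using A s F[OF aS] by (intro mult_left_mono mult_right_mono) (auto intro!: mult_left_mono)
      finally show ?thesis .
    qed
    from E_drift[OF aS t this] show ?thesis by (simp add: mult_ac)
  qed
  have m0: "0 \<le> m0"
  proof -
    have "0 \<le> (LINT \<omega>|P. F (X 0 \<omega>))" using F X_S by (intro integral_nonneg_AE) auto
    then show ?thesis using init by linarith
  qed
  obtain N where N: "N \<in> sets P" "measure P N \<le> ?c / R"
    "\<And>\<omega> s t u. regular \<omega> \<Longrightarrow> \<omega> \<notin> N \<Longrightarrow> 0 \<le> s \<Longrightarrow> s < t \<Longrightarrow> t < u \<Longrightarrow> u < 0 + l \<Longrightarrow>
      \<not> ?R (X s \<omega>) (X t \<omega>) (X u \<omega>)"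
  proof (rule grid_exception[OF order.refl l, of ?R "?c / R"])
    fix m
    let ?g = "grid 0 l m" and ?h = "l / 2 ^ m" and ?n = "2 ^ m :: nat"
    let ?w = "\<lambda>i \<omega>. max 0 (F (X (?g (Suc i)) \<omega>) - F (X (?g i) \<omega>))"
    let ?B = "{\<omega> \<in> space P. \<exists>i j k. i < j \<and> j < k \<and> k \<le> ?n \<and> ?R (X (?g i) \<omega>) (X (?g j) \<omega>) (X (?g k) \<omega>)}"
    assume B: "?B \<in> sets P"
    have gnn: "0 \<le> ?g i" for i using l by (simp add: grid_nonneg)
    have int: "integrable P (?w i)" for i
      using gnn by (intro fun2_integrable'[of _ _ "\<lambda>a b. max 0 (F b - F a)"])
    have int0: "integrable P (\<lambda>\<omega>. F (X 0 \<omega>))" using fun2_integrable'[of 0 0 "\<lambda>a b. F a"] by simp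
    show "measure P ?B \<le> ?c / R"
    proof (rule markov_bound[OF _ _ R _ B])
      show "integrable P (\<lambda>\<omega>. F (X 0 \<omega>) + (\<Sum>i<?n. ?w i \<omega>))" using int int0 by auto
      show "0 \<le> F (X 0 \<omega>) + (\<Sum>i<?n. ?w i \<omega>)" for \<omega> using F X_S by (intro add_nonneg_nonneg sum_nonneg) auto
      have "(LINT \<omega>|P. F (X 0 \<omega>) + (\<Sum>i<?n. ?w i \<omega>)) = (LINT \<omega>|P. F (X 0 \<omega>)) + (\<Sum>i<?n. LINT \<omega>|P. ?w i \<omega>)"
        using int int0 by (simp add: Bochner_Integration.integral_sum)
      also have "\<dots> \<le> m0 + (\<Sum>i<?n. A * ?h * exp (A * l) * (1 + m0))"
      proof (intro add_mono init sum_mono)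
        fix i assume i: "i \<in> {..<?n}"
        have h: "0 \<le> ?h" using l by simp
        have "(LINT \<omega>|P. ?w i \<omega>) \<le> (LINT \<omega>|P. A * ?h * exp (A * ?h) * (1 + F (X (?g i) \<omega>)))"
          using expectation_le'[OF gnn h, of "\<lambda>a b. max 0 (F b - F a)" "\<lambda>a. A * ?h * exp (A * ?h) * (1 + F a)" i] inc[OF _ h]
          by (simp add: grid_Suc)
        also have "\<dots> = A * ?h * exp (A * ?h) * (LINT \<omega>|P. 1 + F (X (?g i) \<omega>))" by simp
        also have "\<dots> \<le> A * ?h * exp (A * ?h) * (exp (A * ?g i) * (1 + m0))"
          using A h EF[OF gnn] by (intro mult_left_mono mult_nonneg_nonneg[OF mult_nonneg_nonneg[OF A h]]) auto
        \<comment> \<open>The growth factor over one step and the one up to the grid point combine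
          into the factor at the next grid point, which does not exceed
          \<open>exp (A * l)\<close>.\<close>
        also have "\<dots> = A * ?h * (1 + m0) * exp (A * ?g (Suc i))"
          by (simp add: grid_Suc distrib_left exp_add mult_ac)
        also have "\<dots> \<le> A * ?h * (1 + m0) * exp (A * l)"
        proof (rule mult_left_mono)
          have "?g (Suc i) \<le> ?g ?n" using i l by (intro grid_mono) auto
          also have "\<dots> = l" by (simp add: grid_def)
          finally show "exp (A * ?g (Suc i)) \<le> exp (A * l)" using A by (simp add: mult_left_mono)
          show "0 \<le> A * ?h * (1 + m0)" using m0 by (intro mult_nonneg_nonneg[OF mult_nonneg_nonneg[OF A h]]) auto
        qed
        finally show "(LINT \<omega>|P. ?w i \<omega>) \<le> A * ?h * exp (A * l) * (1 + m0)" by (simp add: mult_ac)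
      qed
      also have "\<dots> = ?c" by simp
      finally show "(LINT \<omega>|P. F (X 0 \<omega>) + (\<Sum>i<?n. ?w i \<omega>)) \<le> ?c" .
      fix \<omega> assume "\<omega> \<in> ?B"
      then obtain i j k where ijk: "i < j" "j < k" "k \<le> ?n" "R < F (X (?g i) \<omega>)" by blast
      have "F (X (?g i) \<omega>) \<le> F (X (?g 0) \<omega>) + (\<Sum>q<i. ?w q \<omega>)" for i by (induction i) auto
      then have "R \<le> F (X 0 \<omega>) + (\<Sum>q<i. ?w q \<omega>)" using ijk(4) by (simp add: grid_def) (meson less_imp_le order_less_le_trans)
      also have "\<dots> \<le> F (X 0 \<omega>) + (\<Sum>q<?n. ?w q \<omega>)" using ijk by (intro add_left_mono sum_mono2) auto
      finally show "R \<le> F (X 0 \<omega>) + (\<Sum>i<?n. ?w i \<omega>)" .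
    qed
  qed (use that in blast)
  show ?thesis
  proof (rule that[OF N(1,2)])
    fix \<omega> t assume *: "regular \<omega>" "\<omega> \<notin> N" "0 \<le> t" "t < l"
    then have "\<not> ?R (X t \<omega>) (X ((2 * t + l) / 3) \<omega>) (X ((t + 2 * l) / 3) \<omega>)" using N(3)[of \<omega> t "(2 * t + l) / 3" "(t + 2 * l) / 3"] by auto
    then show "F (X t \<omega>) \<le> R" by simp
  qed
qed

end

text \<open>Windows of length \<open>2 * h\<close> start at the multiples of \<open>h\<close>, so
  any triple spanning less than \<open>h\<close> fits into one of them. The partition has parameter
  \<open>h / 3\<close> because \<open>partition_exists\<close> inspects windows of three gaps, and
  \<eta> is half the target because it doubles the bound.\<close>

lemma (in jump_process) exceptional_event:
  fixes k :: nat
  defines "\<eta> \<equiv> 1 / (2 * real (Suc k))"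
  assumes C: "\<And>c. c \<in> S \<Longrightarrow> (\<Sum>j\<in>J. r c j * dS c (\<tau> c j)) \<le> C"
    and F: "\<And>c. c \<in> S \<Longrightarrow> 0 \<le> F c" and A: "0 \<le> A"
    and drift: "\<And>c. c \<in> S \<Longrightarrow> (\<Sum>j\<in>J. r c j * max 0 (F (\<tau> c j) - F c)) \<le> A * (1 + F c)"
    and init: "(LINT \<omega>|P. F (X 0 \<omega>)) \<le> m0" and R: "0 < R" and h: "0 < h" "h \<le> 1"
  obtains N where "N \<in> sets P"
    "measure P N \<le> (m0 + A * (real k + 1) * exp (A * (real k + 1)) * (1 + m0)) / R + C * h / \<eta>
      + (real k + 2) / h * ((C * (2 * h))\<^sup>2 / \<eta>\<^sup>2)"
    "\<And>\<omega> t. regular \<omega> \<Longrightarrow> \<omega> \<notin> N \<Longrightarrow> 0 \<le> t \<Longrightarrow> t \<le> real k \<Longrightarrow> F (X t \<omega>) \<le> R"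
    "\<And>\<omega>. regular \<omega> \<Longrightarrow> \<omega> \<notin> N \<Longrightarrow> \<exists>\<tau>. spaced (h / 3) \<tau> \<and>
      (\<forall>i s. \<tau> i \<le> real k \<longrightarrow> \<tau> i \<le> s \<longrightarrow> s < \<tau> (Suc i) \<longrightarrow> d (\<omega> (\<tau> i)) (\<omega> s) \<le> 1 / real (Suc k))"
proof -
  have \<eta>: "0 < \<eta>" "2 * \<eta> = 1 / real (Suc k)" by (auto simp: \<eta>_def field_simps)
  have k1: "0 < real k + 1" by simp
  obtain N1 where N1: "N1 \<in> sets P"
    "measure P N1 \<le> (m0 + A * (real k + 1) * exp (A * (real k + 1)) * (1 + m0)) / R"
    "\<And>\<omega> t. regular \<omega> \<Longrightarrow> \<omega> \<notin> N1 \<Longrightarrow> 0 \<le> t \<Longrightarrow> t < real k + 1 \<Longrightarrow> F (X t \<omega>) \<le> R"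
    using moment_exception[OF F A drift init k1 R] by metis
  obtain N2 where N2: "N2 \<in> sets P" "measure P N2 \<le> C * h / \<eta>"
    "\<And>\<omega> t. regular \<omega> \<Longrightarrow> \<omega> \<notin> N2 \<Longrightarrow> 0 \<le> t \<Longrightarrow> t < h \<Longrightarrow> d (\<omega> 0) (\<omega> t) \<le> \<eta>"
    using start_exception[OF C h(1) \<eta>(1)] by metis
  have "\<exists>N. N \<in> sets P \<and> measure P N \<le> (C * (2 * h))\<^sup>2 / \<eta>\<^sup>2 \<and>
    (\<forall>\<omega> s t u. regular \<omega> \<longrightarrow> \<omega> \<notin> N \<longrightarrow> real j * h \<le> s \<longrightarrow> s < t \<longrightarrow> t < u \<longrightarrow> u < real j * h + 2 * h \<longrightarrow>
      d (\<omega> s) (\<omega> t) \<le> \<eta> \<or> d (\<omega> t) (\<omega> u) \<le> \<eta>)" for j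
  proof -
    have "0 \<le> real j * h" "0 < 2 * h" using h by auto
    from triple_exception[OF C this \<eta>(1)] show ?thesis by metis
  qed
  then obtain N3 where N3: "\<And>j::nat. N3 j \<in> sets P" "\<And>j. measure P (N3 j) \<le> (C * (2 * h))\<^sup>2 / \<eta>\<^sup>2"
    "\<And>j \<omega> s t u. regular \<omega> \<Longrightarrow> \<omega> \<notin> N3 j \<Longrightarrow> real j * h \<le> s \<Longrightarrow> s < t \<Longrightarrow> t < u \<Longrightarrow> u < real j * h + 2 * h \<Longrightarrow>
      d (\<omega> s) (\<omega> t) \<le> \<eta> \<or> d (\<omega> t) (\<omega> u) \<le> \<eta>" by metis
  \<comment> \<open>Triples start no later than \<open>real k + h \<le> real k + 1\<close>, hence in
    a window of index at most \<open>n\<close>.\<close>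
  define n where "n = nat \<lfloor>(real k + 1) / h\<rfloor>"
  define N where "N = N1 \<union> N2 \<union> (\<Union>j\<le>n. N3 j)"
  have 3: "measure P (\<Union>j\<le>n. N3 j) \<le> (real k + 2) / h * ((C * (2 * h))\<^sup>2 / \<eta>\<^sup>2)"
  proof -
    have "measure P (\<Union>j\<le>n. N3 j) \<le> (\<Sum>j\<le>n. measure P (N3 j))"
      using N3(1) by (intro finite_measure_subadditive_finite) auto
    also have "\<dots> \<le> (\<Sum>j\<le>n. (C * (2 * h))\<^sup>2 / \<eta>\<^sup>2)" by (intro sum_mono N3)
    also have "\<dots> = (real n + 1) * ((C * (2 * h))\<^sup>2 / \<eta>\<^sup>2)" by (simp add: add.commute)
    also have "\<dots> \<le> (real k + 2) / h * ((C * (2 * h))\<^sup>2 / \<eta>\<^sup>2)"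
    proof (rule mult_right_mono)
      have "real n \<le> (real k + 1) / h" using h by (auto simp: n_def)
      moreover have "1 \<le> 1 / h" using h by simp
      ultimately have "real n + 1 \<le> (real k + 1) / h + 1 / h" by linarith
      then show "real n + 1 \<le> (real k + 2) / h" by (simp add: add_divide_distrib[symmetric] add.commute)
    qed simp
    finally show ?thesis .
  qed
  show ?thesis
  proof (rule that)
    show N: "N \<in> sets P" unfolding N_def using N1 N2 N3 by auto
    have "measure P N \<le> measure P (N1 \<union> N2) + measure P (\<Union>j\<le>n. N3 j)"
      unfolding N_def using N1 N2 N3 by (intro measure_Un_le) auto
    moreover have "measure P (N1 \<union> N2) \<le> measure P N1 + measure P N2"
      using N1 N2 by (intro measure_Un_le) auto
    ultimately show "measure P N \<le> (m0 + A * (real k + 1) * exp (A * (real k + 1)) * (1 + m0)) / R + C * h / \<eta>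
      + (real k + 2) / h * ((C * (2 * h))\<^sup>2 / \<eta>\<^sup>2)" using N1(2) N2(2) 3 by linarith
    show "F (X t \<omega>) \<le> R" if "regular \<omega>" "\<omega> \<notin> N" "0 \<le> t" "t \<le> real k" for \<omega> t
      using that by (intro N1(3)) (auto simp: N_def)
    fix \<omega> assume \<omega>: "regular \<omega>" "\<omega> \<notin> N"
    have cad: "\<omega> \<in> cadlag M d" using \<omega> by (simp add: regular_def)
    have "\<exists>\<tau>. spaced (h / 3) \<tau> \<and>
      (\<forall>i s. \<tau> i \<le> real k \<longrightarrow> \<tau> i \<le> s \<longrightarrow> s < \<tau> (Suc i) \<longrightarrow> d (\<omega> (\<tau> i)) (\<omega> s) \<le> 2 * \<eta>)"
    proof (rule partition_exists[OF cad])
      show "0 < h / 3" "0 \<le> \<eta>" using h \<eta> by auto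
      fix t assume "0 \<le> t" "t < h / 3"
      then show "d (\<omega> 0) (\<omega> t) \<le> \<eta>" using \<omega> h by (intro N2(3)) (auto simp: N_def)
    next
      fix s t u assume stu: "0 \<le> s" "s \<le> real k + 3 * (h / 3)" "s < t" "t < u" "u < s + 3 * (h / 3)"
      define j where "j = nat \<lfloor>s / h\<rfloor>"
      have j: "real j \<le> s / h" "s / h < real j + 1" using stu h by (auto simp: j_def)
      then have j': "real j * h \<le> s" "s < real j * h + h" using h by (auto simp: field_simps)
      have "s / h \<le> (real k + 1) / h" using stu h by (intro divide_right_mono) auto
      then have "j \<le> n" unfolding j_def n_def by (intro nat_mono floor_mono)
      then have "\<omega> \<notin> N3 j" using \<omega>(2) by (auto simp: N_def)
      then show "d (\<omega> s) (\<omega> t) \<le> \<eta> \<or> d (\<omega> t) (\<omega> u) \<le> \<eta>"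
        using N3(3)[OF \<omega>(1), of j s t u] j' stu by simp
    qed
    then show "\<exists>\<tau>. spaced (h / 3) \<tau> \<and>
      (\<forall>i s. \<tau> i \<le> real k \<longrightarrow> \<tau> i \<le> s \<longrightarrow> s < \<tau> (Suc i) \<longrightarrow> d (\<omega> (\<tau> i)) (\<omega> s) \<le> 1 / real (Suc k))"
      unfolding \<eta>(2) .
  qed
qed

text \<open>The thresholds depend on \<open>e\<close> and the level \<open>k\<close> but not on the
  process. Each level fails with probability at most \<open>3 * e / 2 ^ (k + 3)\<close>, which sums
  to \<open>3 * e / 4\<close>. Outside these events the path satisfies the compactness criterion at
  all levels.\<close>

theorem jump_processes_tight:
  fixes P :: "'i \<Rightarrow> (real \<Rightarrow> 'a) measure" and \<Phi> :: "'a \<Rightarrow> ennreal"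
  assumes jp: "\<And>i. jump_process M d (S i) emb (J i) (r i) (\<tau> i) (Q i) (P i)"
    and C: "\<And>i c. c \<in> S i \<Longrightarrow> (\<Sum>j\<in>J i. r i c j * d (emb c) (emb (\<tau> i c j))) \<le> C"
    and F: "\<And>i c. c \<in> S i \<Longrightarrow> 0 \<le> F c" and A: "0 \<le> A"
    and drift: "\<And>i c. c \<in> S i \<Longrightarrow> (\<Sum>j\<in>J i. r i c j * max 0 (F (\<tau> i c j) - F c)) \<le> A * (1 + F c)"
    and \<Phi>: "\<And>i c. c \<in> S i \<Longrightarrow> \<Phi> (emb c) = ennreal (F c)"
    and init: "(SUP i. \<integral>\<^sup>+\<omega>. \<Phi> (\<omega> 0) \<partial>P i) < \<infinity>"
    and K: "\<And>R. 0 < R \<Longrightarrow> \<exists>K. compactin (Metric_space.mtopology M d) K \<and>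
      (\<forall>i. \<forall>c\<in>S i. F c \<le> R \<longrightarrow> emb c \<in> K)"
  shows "tight_family (skorokhod_topology M d) P"
proof -
  interpret Metric_space M d using jp unfolding jump_process_def by blast
  interpret sk: Metric_space "cadlag M d" "skorokhod_dist d" by (rule Metric_space_skorokhod)
  obtain m0 where m0: "0 \<le> m0" "(SUP i. \<integral>\<^sup>+\<omega>. \<Phi> (\<omega> 0) \<partial>P i) = ennreal m0"
    using init by (cases "SUP i. \<integral>\<^sup>+\<omega>. \<Phi> (\<omega> 0) \<partial>P i") auto
  have init': "(LINT \<omega>|P i. F (jump_process.X (S i) emb 0 \<omega>)) \<le> m0" for i
  proof -
    interpret jump_process M d "S i" emb "J i" "r i" "\<tau> i" "Q i" "P i" by (rule jp)
    have int: "integrable (P i) (\<lambda>\<omega>. F (X 0 \<omega>))" using fun2_integrable'[of 0 0 "\<lambda>a b. F a"] by simp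
    have "ennreal (LINT \<omega>|P i. F (X 0 \<omega>)) = (\<integral>\<^sup>+\<omega>. ennreal (F (X 0 \<omega>)) \<partial>P i)"
      by (intro nn_integral_eq_integral[symmetric] int AE_I2 F[of _ i] X_S)
    also have "\<dots> = (\<integral>\<^sup>+\<omega>. \<Phi> (\<omega> 0) \<partial>P i)"
    proof (rule nn_integral_cong_AE, use AE_regular in eventually_elim)
      fix \<omega> assume "regular \<omega>"
      then have "\<omega> 0 = emb (X 0 \<omega>)" by (simp add: regular_def emb_X)
      then show "ennreal (F (X 0 \<omega>)) = \<Phi> (\<omega> 0)" using \<Phi>[OF X_S, of 0 \<omega>] by simp
    qed
    also have "\<dots> \<le> ennreal m0" unfolding m0(2)[symmetric] by (rule SUP_upper) simp
    finally show ?thesis using m0(1) by simp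
  qed
  have C0: "0 \<le> C"
  proof -
    interpret jump_process M d "S undefined" emb "J undefined" "r undefined" "\<tau> undefined" "Q undefined" "P undefined" by (rule jp)
    show ?thesis using C[of _ undefined] by (intro C_nonneg) (simp add: dS_def)
  qed
  show ?thesis
    unfolding tight_family_def
  proof (intro allI impI)
    fix e :: real assume e: "0 < e"
    define ek where "ek k = e / 2 ^ (k + 3)" for k :: nat
    define \<eta> where "\<eta> k = 1 / (2 * real (Suc k))" for k :: nat
    define b where "b k = m0 + A * (real k + 1) * exp (A * (real k + 1)) * (1 + m0)" for k :: nat
    \<comment> \<open>The added 1 keeps the level positive when \<open>b k = 0\<close>.\<close>
    define R where "R k = (b k + 1) / ek k" for k
    \<comment> \<open>\<open>h k * (D k - 1)\<close> is exactly the contribution of the start window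
      and of the triples; the summand 1 keeps the divisor positive.\<close>
    define D where "D k = 1 + C / \<eta> k + (real k + 2) * (4 * C\<^sup>2 / (\<eta> k)\<^sup>2)" for k :: nat
    define h where "h k = min 1 (ek k / D k)" for k
    have ek: "0 < ek k" for k using e by (simp add: ek_def)
    have \<eta>: "0 < \<eta> k" for k by (simp add: \<eta>_def)
    have b: "0 \<le> b k" for k using m0(1) A by (simp add: b_def)
    have D: "1 \<le> D k" for k using C0 \<eta>[of k] by (simp add: D_def)
    have R: "0 < R k" "b k / R k \<le> ek k" for k
    proof -
      show "0 < R k" using b[of k] ek[of k] by (simp add: R_def add_nonneg_pos)
      have "b k / (b k + 1) \<le> 1" using b[of k] by simp
      then have "ek k * (b k / (b k + 1)) \<le> ek k * 1" using ek[of k] by (intro mult_left_mono) auto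
      then show "b k / R k \<le> ek k" by (simp add: R_def mult.commute)
    qed
    have h: "0 < h k" "h k \<le> 1" "h k * D k \<le> ek k" for k
    proof -
      show "0 < h k" "h k \<le> 1" using ek[of k] D[of k] by (auto simp: h_def)
      have "h k \<le> ek k / D k" unfolding h_def by (rule min.cobounded2)
      then show "h k * D k \<le> ek k" using D[of k] by (simp add: pos_le_divide_eq)
    qed
    obtain KK where KK: "\<And>k. compactin mtopology (KK k)" "\<And>k i c. c \<in> S i \<Longrightarrow> F c \<le> R k \<Longrightarrow> emb c \<in> KK k"
      using K[OF R(1)] by metis
    define XX where "XX = {\<omega> \<in> cadlag M d. \<forall>k::nat. (\<forall>t. 0 \<le> t \<and> t \<le> real k \<longrightarrow> \<omega> t \<in> KK k) \<and>
      (\<exists>\<tau>. spaced (h k / 3) \<tau> \<and>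
        (\<forall>i s. \<tau> i \<le> real k \<longrightarrow> \<tau> i \<le> s \<longrightarrow> s < \<tau> (Suc i) \<longrightarrow> d (\<omega> (\<tau> i)) (\<omega> s) \<le> 1 / real (Suc k)))}"
    define CC where "CC = sk.mtopology closure_of XX"
    have "compactin sk.mtopology CC"
      unfolding CC_def
    proof (rule skorokhod_relatively_compact[of XX KK "\<lambda>k. h k / 3"])
      show "0 < h k / 3" for k using h by simp
    qed (auto simp: XX_def KK)
    moreover have "1 - e \<le> measure (P i) CC" for i
    proof -
      interpret jump_process M d "S i" emb "J i" "r i" "\<tau> i" "Q i" "P i" by (rule jp)
      have "\<exists>N. N \<in> sets (P i) \<and> measure (P i) N \<le> 3 * ek k \<and>
        (\<forall>\<omega>. regular \<omega> \<longrightarrow> \<omega> \<notin> N \<longrightarrow> (\<forall>t. 0 \<le> t \<and> t \<le> real k \<longrightarrow> F (X t \<omega>) \<le> R k) \<and>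
          (\<exists>\<tau>. spaced (h k / 3) \<tau> \<and>
            (\<forall>i s. \<tau> i \<le> real k \<longrightarrow> \<tau> i \<le> s \<longrightarrow> s < \<tau> (Suc i) \<longrightarrow> d (\<omega> (\<tau> i)) (\<omega> s) \<le> 1 / real (Suc k))))" for k
      proof -
        have C': "(\<Sum>j\<in>J i. r i c j * dS c (\<tau> i c j)) \<le> C" if "c \<in> S i" for c
          using C[OF that] by (simp add: dS_def)
        have Fi: "0 \<le> F c" if "c \<in> S i" for c using F[OF that] .
        have di: "(\<Sum>j\<in>J i. r i c j * max 0 (F (\<tau> i c j) - F c)) \<le> A * (1 + F c)" if "c \<in> S i" for c
          using drift[OF that] .
        obtain N where N: "N \<in> sets (P i)"
          "measure (P i) N \<le> b k / R k + C * h k / \<eta> k + (real k + 2) / h k * ((C * (2 * h k))\<^sup>2 / (\<eta> k)\<^sup>2)"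
          "\<And>\<omega> t. regular \<omega> \<Longrightarrow> \<omega> \<notin> N \<Longrightarrow> 0 \<le> t \<Longrightarrow> t \<le> real k \<Longrightarrow> F (X t \<omega>) \<le> R k"
          "\<And>\<omega>. regular \<omega> \<Longrightarrow> \<omega> \<notin> N \<Longrightarrow> \<exists>\<tau>. spaced (h k / 3) \<tau> \<and>
            (\<forall>i s. \<tau> i \<le> real k \<longrightarrow> \<tau> i \<le> s \<longrightarrow> s < \<tau> (Suc i) \<longrightarrow> d (\<omega> (\<tau> i)) (\<omega> s) \<le> 1 / real (Suc k))"
          using exceptional_event[OF C' Fi A di init' R(1)[of k] h(1,2)[of k], of k]
          unfolding b_def \<eta>_def by metis
        have "C * h k / \<eta> k + (real k + 2) / h k * ((C * (2 * h k))\<^sup>2 / (\<eta> k)\<^sup>2) = h k * (D k - 1)"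
          using h(1)[of k] \<eta>[of k] by (simp add: D_def power_mult_distrib power2_eq_square field_simps)
        also have "\<dots> \<le> h k * D k" using h(1)[of k] by simp
        finally have "measure (P i) N \<le> 3 * ek k" using N(2) R(2)[of k] h(3)[of k] ek[of k] by linarith
        then show ?thesis using N by blast
      qed
      then obtain N where N: "\<And>k::nat. N k \<in> sets (P i)" "\<And>k. measure (P i) (N k) \<le> 3 * ek k"
        "\<And>k \<omega>. regular \<omega> \<Longrightarrow> \<omega> \<notin> N k \<Longrightarrow> (\<forall>t. 0 \<le> t \<and> t \<le> real k \<longrightarrow> F (X t \<omega>) \<le> R k) \<and>
          (\<exists>\<tau>. spaced (h k / 3) \<tau> \<and>
            (\<forall>i s. \<tau> i \<le> real k \<longrightarrow> \<tau> i \<le> s \<longrightarrow> s < \<tau> (Suc i) \<longrightarrow> d (\<omega> (\<tau> i)) (\<omega> s) \<le> 1 / real (Suc k)))"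
        by metis
      have sums: "(\<lambda>k. 3 * ek k) sums (3 * e / 4)"
      proof -
        have "(\<lambda>k. 3 * e / 8 * (1 / 2) ^ k) sums (3 * e / 8 * (1 / (1 - 1 / 2)))"
          by (intro sums_mult geometric_sums) simp
        then show ?thesis by (simp add: ek_def power_add power_divide field_simps)
      qed
      have summ: "summable (\<lambda>k. measure (P i) (N k))"
        by (rule summable_comparison_test'[OF sums_summable[OF sums]]) (use N(2) in auto)
      have "measure (P i) (\<Union>k. N k) \<le> (\<Sum>k. measure (P i) (N k))"
        using N(1) summ by (intro finite_measure_subadditive_countably) auto
      also have "\<dots> \<le> (\<Sum>k. 3 * ek k)" using N(2) summ sums_summable[OF sums] by (intro suminf_le)
      also have "\<dots> = 3 * e / 4" using sums by (simp add: sums_iff)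
      finally have Nb: "measure (P i) (\<Union>k. N k) \<le> 3 * e / 4" .
      \<comment> \<open>The closure is Borel because it is closed; measurability of
        \<open>XX\<close> itself is thereby avoided.\<close>
      have CCs: "CC \<in> sets (P i)" unfolding sets_P CC_def by (intro sets_borel_skorokhod closedin_closure_of)
      have "XX \<subseteq> CC" unfolding CC_def by (rule closure_of_subset) (auto simp: XX_def)
      have "AE \<omega> in P i. \<omega> \<in> (\<Union>k. N k) \<union> CC"
        using AE_regular
      proof eventually_elim
        case (elim \<omega>)
        show ?case
        proof (cases "\<omega> \<in> (\<Union>k. N k)")
          case False
          have "\<omega> \<in> XX"
            unfolding XX_def
          proof (intro CollectI conjI allI impI)
            show "\<omega> \<in> cadlag M d" using elim by (simp add: regular_def)
            fix k :: nat
            have nk: "\<omega> \<notin> N k" using False by blast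
            show "\<exists>\<tau>. spaced (h k / 3) \<tau> \<and>
              (\<forall>i s. \<tau> i \<le> real k \<longrightarrow> \<tau> i \<le> s \<longrightarrow> s < \<tau> (Suc i) \<longrightarrow> d (\<omega> (\<tau> i)) (\<omega> s) \<le> 1 / real (Suc k))"
              using N(3)[OF elim nk] by blast
            fix t assume t: "0 \<le> t \<and> t \<le> real k"
            then have "F (X t \<omega>) \<le> R k" using N(3)[OF elim nk] by blast
            then have "emb (X t \<omega>) \<in> KK k" by (rule KK(2)[OF X_S])
            then show "\<omega> t \<in> KK k" using elim t by (simp add: regular_def emb_X)
          qed
          then show ?thesis using \<open>XX \<subseteq> CC\<close> by blast
        qed simp
      qed
      moreover have NC: "(\<Union>k. N k) \<union> CC \<in> sets (P i)" using N(1) CCs by auto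
      ultimately have "measure (P i) ((\<Union>k. N k) \<union> CC) = 1" using prob_eq_1 by blast
      moreover have "measure (P i) ((\<Union>k. N k) \<union> CC) \<le> measure (P i) (\<Union>k. N k) + measure (P i) CC"
        using N(1) CCs by (intro measure_Un_le) auto
      ultimately show ?thesis using Nb e by linarith
    qed
    ultimately show "\<exists>C. compactin (skorokhod_topology M d) C \<and> (\<forall>i. 1 - e \<le> measure (P i) C)"
      unfolding skorokhod_topology_def by blast
  qed
qed

section \<open>The Wasserstein space\<close>

text \<open>Measures on the half-line are handled through their extension by zero to the real line.
  There \<open>u \<mapsto> M [u, \<infinity>)\<close> is monotone on all of the reals, whereas
  \<open>measure \<mu> {u..}\<close> is a junk value for \<open>u < 0\<close>.\<close>

definition extension :: "real measure \<Rightarrow> real measure" where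
  "extension \<mu> = distr \<mu> borel (\<lambda>x. x)"

lemma
  assumes "prob_space \<mu>" "sets \<mu> = sets borel_nonneg"
  shows space_half_line: "space \<mu> = {0..}"
    and id_measurable_half_line: "(\<lambda>x. x) \<in> measurable \<mu> borel"
    and real_distribution_extension: "real_distribution (extension \<mu>)"
    and measure_extension: "0 \<le> u \<Longrightarrow> measure (extension \<mu>) {u..} = measure \<mu> {u..}"
    and measure_extension_neg: "measure (extension \<mu>) {..<0} = 0"
    and nn_integral_extension: "f \<in> borel_measurable borel \<Longrightarrow> (\<integral>\<^sup>+x. f x \<partial>extension \<mu>) = (\<integral>\<^sup>+x. f x \<partial>\<mu>)"
proof -
  show sp: "space \<mu> = {0..}" using sets_eq_imp_space_eq[OF assms(2)] by (simp add: space_restrict_space)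
  have "(\<lambda>x. x) \<in> measurable borel_nonneg borel" by (rule measurable_restrict_space1) simp
  then show id: "(\<lambda>x. x) \<in> measurable \<mu> borel" using measurable_cong_sets[OF assms(2) refl] by blast
  show "real_distribution (extension \<mu>)"
    unfolding extension_def by (rule prob_space.real_distribution_distr[OF assms(1) id])
  show "measure (extension \<mu>) {u..} = measure \<mu> {u..}" if "0 \<le> u"
    unfolding extension_def using that by (subst measure_distr[OF id]) (auto simp: sp intro!: arg_cong[where f = "measure \<mu>"])
  have "(\<lambda>x. x) -` {..<0} \<inter> space \<mu> = {}" by (auto simp: sp)
  then show "measure (extension \<mu>) {..<0} = 0"
    unfolding extension_def by (subst measure_distr[OF id]) auto
  show "f \<in> borel_measurable borel \<Longrightarrow> (\<integral>\<^sup>+x. f x \<partial>extension \<mu>) = (\<integral>\<^sup>+x. f x \<partial>\<mu>)"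
    unfolding extension_def by (rule nn_integral_distr[OF id]) simp
qed

lemma extension_inj:
  assumes "prob_space \<mu>" "sets \<mu> = sets borel_nonneg" "prob_space \<nu>" "sets \<nu> = sets borel_nonneg"
    and "extension \<mu> = extension \<nu>"
  shows "\<mu> = \<nu>"
proof (rule measure_eqI)
  show "sets \<mu> = sets \<nu>" using assms by simp
  fix A assume A: "A \<in> sets \<mu>"
  then obtain B where B: "B \<in> sets borel" "A = {0..} \<inter> B"
    using assms(2) by (auto simp: sets_restrict_space)
  have "A \<in> sets borel" using B by auto
  then have "emeasure (extension m) A = emeasure m A" if "prob_space m" "sets m = sets borel_nonneg" for m
    unfolding extension_def using B space_half_line[OF that]
    by (subst emeasure_distr[OF id_measurable_half_line[OF that]]) (auto intro!: arg_cong[where f = "emeasure m"])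
  then show "emeasure \<mu> A = emeasure \<nu> A" using assms by metis
qed

context real_distribution
begin

lemma tail_measurable [measurable]: "(\<lambda>u. measure M {u..}) \<in> borel_measurable borel"
proof -
  have "mono (\<lambda>u. - measure M {u..})" by (intro monoI) (auto intro!: finite_measure_mono)
  then have "(\<lambda>u. - measure M {u..}) \<in> borel_measurable borel" by (rule borel_measurable_mono)
  then have "(\<lambda>u. - (- measure M {u..})) \<in> borel_measurable borel" by (rule borel_measurable_uminus)
  then show ?thesis by simp
qed

lemma tail_eq: "measure M {u..} = 1 - measure M {..<u}"
  using prob_compl[of "{..<u}"] by (simp add: Compl_eq_Diff_UNIV[symmetric])

lemma tail_eq_cdf: "measure M {u} = 0 \<Longrightarrow> measure M {u..} = 1 - cdf M u"
proof -
  assume "measure M {u} = 0"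
  moreover have "measure M {..u} = measure M {..<u} + measure M {u}"
    by (subst finite_measure_Union[symmetric]) (auto intro!: arg_cong[where f = "measure M"])
  ultimately show ?thesis by (simp add: tail_eq cdf_def2)
qed

text \<open>Tonelli on the region \<open>a \<le> u \<le> x\<close>. The coercion
  \<open>ennreal\<close> cuts \<open>x - a\<close> off at 0, so the right side is the mean excess
  over \<open>a\<close>.\<close>

lemma layer_cake:
  "(\<integral>\<^sup>+u. ennreal (measure M {u..}) * indicator {a..} u \<partial>lborel) = (\<integral>\<^sup>+x. ennreal (x - a) \<partial>M)"
proof -
  interpret pair_sigma_finite lborel M ..
  let ?f = "\<lambda>u x. indicator {p. a \<le> fst p \<and> fst p \<le> snd p} (u, x) :: ennreal"
  have "{p \<in> space (borel \<Otimes>\<^sub>M borel). a \<le> fst p \<and> fst p \<le> snd p} \<in> sets (borel \<Otimes>\<^sub>M borel :: (real \<times> real) measure)"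
    by measurable
  then have "{p. a \<le> fst p \<and> fst p \<le> snd p} \<in> sets (borel \<Otimes>\<^sub>M borel :: (real \<times> real) measure)"
    by (simp add: space_pair_measure)
  then have m: "{p. a \<le> fst p \<and> fst p \<le> snd p} \<in> sets (lborel \<Otimes>\<^sub>M M)"
    using sets_pair_measure_cong[OF sets_lborel events_eq_borel] by simp
  have "(\<integral>\<^sup>+u. ennreal (measure M {u..}) * indicator {a..} u \<partial>lborel) = (\<integral>\<^sup>+u. \<integral>\<^sup>+x. ?f u x \<partial>M \<partial>lborel)"
  proof (intro nn_integral_cong)
    fix u :: real
    have "(\<integral>\<^sup>+x. ?f u x \<partial>M) = (\<integral>\<^sup>+x. indicator {a..} u * indicator {u..} x \<partial>M)"
      by (intro nn_integral_cong) (auto simp: indicator_def)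
    also have "\<dots> = indicator {a..} u * emeasure M {u..}" by (subst nn_integral_cmult) auto
    finally show "ennreal (measure M {u..}) * indicator {a..} u = (\<integral>\<^sup>+x. ?f u x \<partial>M)"
      by (simp add: emeasure_eq_measure mult.commute)
  qed
  also have "\<dots> = (\<integral>\<^sup>+x. \<integral>\<^sup>+u. ?f u x \<partial>lborel \<partial>M)"
    by (rule Fubini'[symmetric]) (use m in \<open>simp add: case_prod_unfold\<close>)
  also have "\<dots> = (\<integral>\<^sup>+x. ennreal (x - a) \<partial>M)"
  proof (intro nn_integral_cong)
    fix x
    have "(\<integral>\<^sup>+u. ?f u x \<partial>lborel) = (\<integral>\<^sup>+u. indicator {a..x} u \<partial>lborel)"
      by (intro nn_integral_cong) (auto simp: indicator_def)
    then show "(\<integral>\<^sup>+u. ?f u x \<partial>lborel) = ennreal (x - a)"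
      by (cases "a \<le> x") (auto simp: ennreal_neg)
  qed
  finally show ?thesis .
qed

end

lemma AE_lborel_dense:
  fixes x h :: real
  assumes "AE y in lborel. Q y" "0 < h" obtains y where "x < y" "y < x + h" "Q y"
proof (rule ccontr)
  assume "\<not> thesis"
  then have no: "\<And>y. x < y \<Longrightarrow> y < x + h \<Longrightarrow> \<not> Q y" using that by blast
  have "AE y in lborel. y \<notin> {x<..<x + h}" using assms(1) by eventually_elim (use no in auto)
  moreover have "{y \<in> space lborel. y \<in> {x<..<x + h}} = {x<..<x + h}" by auto
  ultimately have "emeasure lborel {x<..<x + h} = 0" using emeasure_eq_0_AE[of "\<lambda>y. y \<in> {x<..<x + h}" lborel] by simp
  then show False using assms(2) by simp
qed

text \<open>Equality is known only almost everywhere. Points of equality occur arbitrarily close to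
  the right of any \<open>x\<close>, and the right-continuous cdf is recovered from them.\<close>

lemma tails_unique:
  assumes M: "real_distribution M" "real_distribution N" and eq: "AE u in lborel. measure M {u..} = measure N {u..}"
  shows "M = N"
proof (rule cdf_unique[OF M], rule ext)
  fix x
  interpret M: real_distribution M by fact
  interpret N: real_distribution N by fact
  have "\<bar>cdf M x - cdf N x\<bar> \<le> e" if e: "0 < e" for e
  proof -
    have near: "\<exists>h>0. \<forall>y. x < y \<and> y < x + h \<longrightarrow> cdf L x \<le> measure L {..<y} \<and> measure L {..<y} \<le> cdf L x + e"
      if "real_distribution L" for L
    proof -
      interpret L: real_distribution L by fact
      have "(cdf L \<longlongrightarrow> cdf L x) (at_right x)" using L.cdf_is_right_cont[of x] by (simp add: continuous_within)
      from order_tendstoD(2)[OF this, of "cdf L x + e"] e obtain b where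
        b: "b > x" "\<And>y. x < y \<Longrightarrow> y < b \<Longrightarrow> cdf L y < cdf L x + e" by (auto simp: eventually_at_right_field)
      have "cdf L x \<le> measure L {..<y}" "measure L {..<y} \<le> cdf L y" if "x < y" for y
        using that unfolding cdf_def2 by (auto intro!: L.finite_measure_mono)
      then show ?thesis using b by (intro exI[of _ "b - x"]) force
    qed
    obtain h1 where h1: "h1 > 0" "\<And>y. x < y \<Longrightarrow> y < x + h1 \<Longrightarrow> cdf M x \<le> measure M {..<y} \<and> measure M {..<y} \<le> cdf M x + e"
      using near[OF M(1)] by blast
    obtain h2 where h2: "h2 > 0" "\<And>y. x < y \<Longrightarrow> y < x + h2 \<Longrightarrow> cdf N x \<le> measure N {..<y} \<and> measure N {..<y} \<le> cdf N x + e"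
      using near[OF M(2)] by blast
    have "0 < min h1 h2" using h1 h2 by simp
    then obtain y where y: "x < y" "y < x + min h1 h2" "measure M {y..} = measure N {y..}"
      using AE_lborel_dense[OF eq] by metis
    then have "measure M {..<y} = measure N {..<y}" by (simp add: M.tail_eq N.tail_eq)
    moreover have "y < x + h1" "y < x + h2" using y(2) by auto
    ultimately show ?thesis using h1(2)[of y] h2(2)[of y] y(1) by linarith
  qed
  then have "\<bar>cdf M x - cdf N x\<bar> \<le> 0" by (rule field_le_epsilon[of _ 0, simplified])
  then show "cdf M x = cdf N x" by simp
qed

section \<open>The metric \<open>W1\<close> on measures with bounded first moment\<close>

lemma P_leD:
  assumes "\<mu> \<in> P_le \<rho>"
  shows "prob_space \<mu>" "sets \<mu> = sets borel_nonneg" "(\<integral>\<^sup>+x. ennreal x \<partial>\<mu>) \<le> ennreal \<rho>"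
proof -
  from assms show *: "prob_space \<mu>" "sets \<mu> = sets borel_nonneg" by (auto simp: P_le_def P1_def)
  have int: "integrable \<mu> (\<lambda>x. x)" "(LINT x|\<mu>. x) \<le> \<rho>" using assms by (auto simp: P_le_def P1_def)
  have "(\<integral>\<^sup>+x. ennreal x \<partial>\<mu>) = ennreal (LINT x|\<mu>. x)"
    using space_half_line[OF *] by (intro nn_integral_eq_integral int(1) AE_I2) auto
  then show "(\<integral>\<^sup>+x. ennreal x \<partial>\<mu>) \<le> ennreal \<rho>" using int(2) by (simp add: ennreal_leI)
qed

lemma P_leI:
  assumes \<mu>: "prob_space \<mu>" "sets \<mu> = sets borel_nonneg" and "(\<integral>\<^sup>+x. ennreal x \<partial>\<mu>) \<le> ennreal \<rho>" "0 \<le> \<rho>"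
  shows "\<mu> \<in> P_le \<rho>"
proof -
  have nn: "AE x in \<mu>. 0 \<le> x" using space_half_line[OF \<mu>] by (intro AE_I2) auto
  have "(\<integral>\<^sup>+x. ennreal x \<partial>\<mu>) < \<infinity>" using assms(3) by (auto simp: le_less_trans)
  then have int: "integrable \<mu> (\<lambda>x. x)"
    using nn id_measurable_half_line[OF \<mu>] by (intro integrableI_nonneg) auto
  have "ennreal (LINT x|\<mu>. x) \<le> ennreal \<rho>" using assms(3) nn_integral_eq_integral[OF int nn] by simp
  then have "(LINT x|\<mu>. x) \<le> \<rho>" using assms(4) by simp
  then show ?thesis using \<mu> int by (simp add: P_le_def P1_def)
qed

lemma P_le_tail:
  assumes "\<mu> \<in> P_le \<rho>"
  shows "set_integrable lborel {0..} (\<lambda>u. measure \<mu> {u..})"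
    and "(\<integral>\<^sup>+u. ennreal (measure (extension \<mu>) {u..}) * indicator {a..} u \<partial>lborel) = (\<integral>\<^sup>+x. ennreal (x - a) \<partial>\<mu>)"
proof -
  note \<mu> = P_leD[OF assms]
  interpret real_distribution "extension \<mu>" by (rule real_distribution_extension[OF \<mu>(1,2)])
  show lc: "(\<integral>\<^sup>+u. ennreal (measure (extension \<mu>) {u..}) * indicator {a..} u \<partial>lborel) = (\<integral>\<^sup>+x. ennreal (x - a) \<partial>\<mu>)" for a
    unfolding layer_cake by (rule nn_integral_extension[OF \<mu>(1,2)]) simp
  have eq: "(\<lambda>u. indicator {0..} u *\<^sub>R measure \<mu> {u..}) = (\<lambda>u. indicator {0..} u * measure (extension \<mu>) {u..})"
    using measure_extension[OF \<mu>(1,2)] by (auto simp: indicator_def)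
  show "set_integrable lborel {0..} (\<lambda>u. measure \<mu> {u..})"
    unfolding set_integrable_def eq
  proof (rule integrableI_nonneg)
    have "(\<integral>\<^sup>+u. ennreal (indicator {0..} u * measure (extension \<mu>) {u..}) \<partial>lborel) = (\<integral>\<^sup>+x. ennreal (x - 0) \<partial>\<mu>)"
      unfolding lc[of 0, symmetric] by (intro nn_integral_cong) (auto simp: indicator_def)
    also have "\<dots> < \<infinity>" using \<mu>(3) by (auto simp: le_less_trans)
    finally show "(\<integral>\<^sup>+u. ennreal (indicator {0..} u * measure (extension \<mu>) {u..}) \<partial>lborel) < \<infinity>" .
  qed auto
qed

lemma W1_integrable:
  assumes "\<mu> \<in> P_le \<rho>" "\<nu> \<in> P_le \<rho>"
  shows "set_integrable lborel {0..} (\<lambda>u. \<bar>measure \<mu> {u..} - measure \<nu> {u..}\<bar>)"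
  using set_integral_diff(1)[OF P_le_tail(1)[OF assms(1)] P_le_tail(1)[OF assms(2)]]
  by (rule set_integrable_abs)

lemma W1_nn_integral:
  assumes "\<mu> \<in> P_le \<rho>" "\<nu> \<in> P_le \<rho>"
  shows "ennreal (W1 \<mu> \<nu>) = (\<integral>\<^sup>+u. ennreal \<bar>measure (extension \<mu>) {u..} - measure (extension \<nu>) {u..}\<bar> * indicator {0..} u \<partial>lborel)"
proof -
  note \<mu> = P_leD[OF assms(1)] and \<nu> = P_leD[OF assms(2)]
  have "ennreal (W1 \<mu> \<nu>) = (\<integral>\<^sup>+u. ennreal (indicator {0..} u *\<^sub>R \<bar>measure \<mu> {u..} - measure \<nu> {u..}\<bar>) \<partial>lborel)"
    unfolding W1_def set_lebesgue_integral_def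
    by (intro nn_integral_eq_integral[symmetric] W1_integrable[OF assms, unfolded set_integrable_def]) auto
  also have "\<dots> = (\<integral>\<^sup>+u. ennreal \<bar>measure (extension \<mu>) {u..} - measure (extension \<nu>) {u..}\<bar> * indicator {0..} u \<partial>lborel)"
    using measure_extension[OF \<mu>(1,2)] measure_extension[OF \<nu>(1,2)]
    by (intro nn_integral_cong) (auto simp: indicator_def)
  finally show ?thesis .
qed

lemma W1_nonneg: "0 \<le> W1 \<mu> \<nu>"
  unfolding W1_def set_lebesgue_integral_def by (intro integral_nonneg_AE) auto

text \<open>Only definiteness takes work: distance 0 gives equal tails almost everywhere on the
  half-line, and below 0 both extensions have tail 1, so \<open>tails_unique\<close>
  applies.\<close>

lemma Metric_space_W1: "Metric_space (P_le \<rho>) W1"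
proof
  show "0 \<le> W1 \<mu> \<nu>" for \<mu> \<nu> by (rule W1_nonneg)
  show "W1 \<mu> \<nu> = W1 \<nu> \<mu>" for \<mu> \<nu> by (simp add: W1_def abs_minus_commute)
next
  fix \<mu> \<nu> assume in_P: "\<mu> \<in> P_le \<rho>" "\<nu> \<in> P_le \<rho>"
  note \<mu> = P_leD[OF in_P(1)] and \<nu> = P_leD[OF in_P(2)]
  interpret M: real_distribution "extension \<mu>" by (rule real_distribution_extension[OF \<mu>(1,2)])
  interpret N: real_distribution "extension \<nu>" by (rule real_distribution_extension[OF \<nu>(1,2)])
  show "W1 \<mu> \<nu> = 0 \<longleftrightarrow> \<mu> = \<nu>"
  proof
    assume "W1 \<mu> \<nu> = 0"
    then have "(\<integral>\<^sup>+u. ennreal \<bar>measure (extension \<mu>) {u..} - measure (extension \<nu>) {u..}\<bar> * indicator {0..} u \<partial>lborel) = 0"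
      using W1_nn_integral[OF in_P] by simp
    then have "AE u in lborel. ennreal \<bar>measure (extension \<mu>) {u..} - measure (extension \<nu>) {u..}\<bar> * indicator {0..} u = 0"
      by (subst (asm) nn_integral_0_iff_AE) auto
    then have "AE u in lborel. measure (extension \<mu>) {u..} = measure (extension \<nu>) {u..}"
    proof eventually_elim
      case (elim u)
      show ?case
      proof (cases "0 \<le> u")
        case True then show ?thesis using elim by (simp add: ennreal_eq_0_iff)
      next
        case False
        have "measure L {..<u} = 0" if "real_distribution L" "measure L {..<0} = 0" for L
        proof -
          interpret L: real_distribution L by fact
          have "measure L {..<u} \<le> measure L {..<0}" using False by (intro L.finite_measure_mono) auto
          then show ?thesis using that(2) measure_nonneg[of L "{..<u}"] by linarith
        qed
        from this[OF M.real_distribution_axioms measure_extension_neg[OF \<mu>(1,2)]]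
          this[OF N.real_distribution_axioms measure_extension_neg[OF \<nu>(1,2)]]
        show ?thesis by (simp add: M.tail_eq N.tail_eq)
      qed
    qed
    then have "extension \<mu> = extension \<nu>"
      by (rule tails_unique[OF M.real_distribution_axioms N.real_distribution_axioms])
    then show "\<mu> = \<nu>" by (rule extension_inj[OF \<mu>(1,2) \<nu>(1,2)])
  qed (simp add: W1_def set_lebesgue_integral_def)
next
  fix \<mu> \<nu> \<pi> assume P: "\<mu> \<in> P_le \<rho>" "\<nu> \<in> P_le \<rho>" "\<pi> \<in> P_le \<rho>"
  have "W1 \<mu> \<pi> \<le> (LINT u:{0..}|lborel. \<bar>measure \<mu> {u..} - measure \<nu> {u..}\<bar> + \<bar>measure \<nu> {u..} - measure \<pi> {u..}\<bar>)"
    unfolding W1_def using P by (intro set_integral_mono W1_integrable set_integral_add(1)) auto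
  also have "\<dots> = W1 \<mu> \<nu> + W1 \<nu> \<pi>"
    unfolding W1_def by (rule set_integral_add(2)) (use P W1_integrable in auto)
  finally show "W1 \<mu> \<pi> \<le> W1 \<mu> \<nu> + W1 \<nu> \<pi>" .
qed

text \<open>The first moment bound gives tightness and a weakly convergent subsequence. On
  \<open>[0, a]\<close> the tails converge in the mean by dominated convergence. Beyond
  \<open>a\<close> their integral is at most \<open>R / B\<close> for every member by superlinearity
  of \<open>f\<close>, and Fatou's lemma passes this, like the first moment bound, to the
  limit.\<close>

lemma superlinear_moment_compact:
  fixes f :: "real \<Rightarrow> real"
  assumes \<rho>: "0 \<le> \<rho>" and R: "0 \<le> R"
    and super: "\<And>B. \<exists>a\<ge>0. \<forall>x\<ge>a. B * x \<le> f x"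
  shows "\<exists>K. compactin (Metric_space.mtopology (P_le \<rho>) W1) K \<and>
    {\<mu> \<in> P_le \<rho>. moment f \<mu> \<le> ennreal R} \<subseteq> K"
proof -
  interpret W: Metric_space "P_le \<rho>" W1 by (rule Metric_space_W1)
  let ?S = "{\<mu> \<in> P_le \<rho>. moment f \<mu> \<le> ennreal R}"
  have "\<exists>l r. l \<in> P_le \<rho> \<and> strict_mono r \<and> limitin W.mtopology (\<sigma> \<circ> r) l sequentially"
    if \<sigma>: "range \<sigma> \<subseteq> ?S" for \<sigma> :: "nat \<Rightarrow> real measure"
  proof -
    have \<sigma>P: "\<sigma> n \<in> P_le \<rho>" and \<sigma>f: "moment f (\<sigma> n) \<le> ennreal R" for n using \<sigma> by auto
    note D = P_leD[OF \<sigma>P]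
    define \<nu> where "\<nu> n = extension (\<sigma> n)" for n
    have rd: "real_distribution (\<nu> n)" for n unfolding \<nu>_def by (rule real_distribution_extension[OF D(1,2)])
    have low: "measure (\<nu> n) {..<0} = 0" for n unfolding \<nu>_def by (rule measure_extension_neg[OF D(1,2)])
    have tail: "(\<integral>\<^sup>+u. ennreal (measure (\<nu> n) {u..}) * indicator {a..} u \<partial>lborel) = (\<integral>\<^sup>+x. ennreal (x - a) \<partial>\<sigma> n)" for n a
      unfolding \<nu>_def by (rule P_le_tail(2)[OF \<sigma>P])
    have "tight \<nu>"
      unfolding tight_def
    proof (intro conjI allI impI rd)
      fix e :: real assume e: "0 < e"
      \<comment> \<open>Markov's inequality puts mass at most \<open>\<rho> / b < e\<close> beyond
        \<open>b\<close>; the added 1 makes this strict and \<open>b\<close> positive.\<close>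
      define b where "b = (\<rho> + 1) / e"
      have b: "0 < b" using \<rho> e by (simp add: b_def)
      \<comment> \<open>The interval is open on the left, so it starts below 0 in order to contain
        an atom at 0.\<close>
      have "1 - e < measure (\<nu> n) {-1<..b}" for n
      proof -
        interpret N: real_distribution "\<nu> n" by (rule rd)
        have "ennreal b * emeasure (\<nu> n) {b..} = (\<integral>\<^sup>+x. ennreal b * indicator {b..} x \<partial>\<nu> n)"
          by (subst nn_integral_cmult_indicator) auto
        also have "\<dots> \<le> (\<integral>\<^sup>+x. ennreal x \<partial>\<nu> n)"
          by (intro nn_integral_mono) (auto simp: indicator_def ennreal_leI)
        also have "\<dots> \<le> ennreal \<rho>" using D(3)[of n] nn_integral_extension[OF D(1,2), of "\<lambda>x. ennreal x"] by (simp add: \<nu>_def)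
        finally have "b * measure (\<nu> n) {b..} \<le> \<rho>"
          using b \<rho> by (simp add: N.emeasure_eq_measure ennreal_mult[symmetric])
        also have "\<rho> < b * e" using e by (simp add: b_def)
        finally have tb: "measure (\<nu> n) {b..} < e" using b by simp
        have "measure (\<nu> n) {..-1} \<le> measure (\<nu> n) {..<0}" by (intro N.finite_measure_mono) auto
        then have l0: "measure (\<nu> n) {..-1} \<le> 0" using low by simp
        have "1 = measure (\<nu> n) (({..-1} \<union> {b..}) \<union> {-1<..b})"
          using N.prob_space b by (subst sup_commute) (auto intro!: arg_cong[where f = "measure (\<nu> n)"] simp flip: N.prob_space)
        also have "\<dots> \<le> measure (\<nu> n) ({..-1} \<union> {b..}) + measure (\<nu> n) {-1<..b}" by (intro measure_Un_le) auto
        also have "measure (\<nu> n) ({..-1} \<union> {b..}) \<le> measure (\<nu> n) {..-1} + measure (\<nu> n) {b..}" by (intro measure_Un_le) auto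
        finally show ?thesis using tb l0 by linarith
      qed
      then show "\<exists>a b. a < b \<and> (\<forall>n. 1 - e < measure (\<nu> n) {a<..b})"
        using b by (intro exI[of _ "-1"] exI[of _ b]) auto
    qed
    from tight_imp_convergent_subsubsequence[OF this strict_mono_id] obtain r M where
      r: "strict_mono (r :: nat \<Rightarrow> nat)" and M: "real_distribution M" and conv: "weak_conv_m (\<nu> \<circ> r) M"
      by (auto simp: o_def id_def)
    interpret M: real_distribution M by fact
    have cl: "(\<lambda>n. cdf (\<nu> (r n)) x) \<longlonglongrightarrow> cdf M x" if "measure M {x} = 0" for x
      using conv that unfolding weak_conv_m_def weak_conv_def by (simp add: M.isCont_cdf)
    have atoms: "AE u in lborel. measure L {u} = 0" if "real_distribution L" for L
    proof -
      interpret L: real_distribution L by fact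
      have "{u. measure L {u} > 0} \<in> null_sets lborel" by (intro countable_imp_null_set_lborel L.countable_atoms)
      from AE_not_in[OF this] show ?thesis by eventually_elim (simp add: less_le)
    qed
    \<comment> \<open>Weak convergence speaks about the cdf off the atoms of the limit. All but
      countably many \<open>u\<close> avoid the atoms of \<open>M\<close> and of every member, and
      there the tail is 1 minus the cdf.\<close>
    have tl: "AE u in lborel. (\<lambda>n. measure (\<nu> (r n)) {u..}) \<longlonglongrightarrow> measure M {u..}"
    proof -
      have "AE u in lborel. \<forall>n. measure (\<nu> n) {u} = 0" unfolding AE_all_countable using atoms rd by blast
      with atoms[OF M] show ?thesis
      proof eventually_elim
        case (elim u)
        have "(\<lambda>n. 1 - cdf (\<nu> (r n)) u) \<longlonglongrightarrow> 1 - cdf M u" using cl elim by (intro tendsto_diff) auto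
        then show ?case using elim M.tail_eq_cdf real_distribution.tail_eq_cdf[OF rd] by simp
      qed
    qed
    have Mlow: "measure M {..<0} = 0"
    proof -
      have "cdf M x = 0" if x: "x < 0" for x
      proof -
        have "0 < - x" using x by simp
        from AE_lborel_dense[OF atoms[OF M] this, of x] obtain y where y: "x < y" "y < 0" "measure M {y} = 0" by auto
        have "cdf (\<nu> n) y = 0" for n
        proof -
          interpret N: real_distribution "\<nu> n" by (rule rd)
          have "measure (\<nu> n) {..y} \<le> measure (\<nu> n) {..<0}" using y by (intro N.finite_measure_mono) auto
          then show ?thesis using low measure_nonneg[of "\<nu> n" "{..y}"] by (simp add: cdf_def2)
        qed
        then have "cdf M y = 0" using cl[OF y(3)] by (simp add: LIMSEQ_const_iff)
        then show ?thesis using M.cdf_nondecreasing[of x y] M.cdf_nonneg[of x] y by simp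
      qed
      then have "\<forall>\<^sub>F x in at_left 0. cdf M x = 0" by (auto simp: eventually_at_left_field intro: exI[of _ "-1"])
      then have "(cdf M \<longlongrightarrow> 0) (at_left 0)" by (rule tendsto_eventually)
      from tendsto_unique[OF _ M.cdf_at_left this] show ?thesis by simp
    qed
    \<comment> \<open>Returns the limit to the half-line; since \<open>M\<close> gives no mass to
      negative points, the cut-off at 0 changes nothing almost surely.\<close>
    define \<mu> where "\<mu> = distr M borel_nonneg (\<lambda>x. max 0 x)"
    have mx: "(\<lambda>x. max 0 x) \<in> measurable M borel_nonneg"
      by (intro measurable_restrict_space2) auto
    have \<mu>: "prob_space \<mu>" "sets \<mu> = sets borel_nonneg"
      unfolding \<mu>_def by (auto intro!: M.prob_space_distr mx)
    have ext: "extension \<mu> = M"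
    proof (rule tails_unique[OF real_distribution_extension[OF \<mu>] M])
      interpret E: real_distribution "extension \<mu>" by (rule real_distribution_extension[OF \<mu>])
      have "measure (extension \<mu>) {u..} = measure M {u..}" for u
      proof (cases "0 < u")
        case True
        then have "{u..} \<in> sets borel_nonneg" by (auto simp: sets_restrict_space intro!: image_eqI[of _ _ "{u..}"])
        then have "measure \<mu> {u..} = measure M {u..}"
          using True unfolding \<mu>_def by (subst measure_distr[OF mx]) (auto intro!: arg_cong[where f = "measure M"])
        then show ?thesis using measure_extension[OF \<mu> less_imp_le[OF True]] by simp
      next
        case False
        have "measure L {..<u} = 0" if "real_distribution L" "measure L {..<0} = 0" for L
        proof -
          interpret L: real_distribution L by fact
          have "measure L {..<u} \<le> measure L {..<0}" using False by (intro L.finite_measure_mono) auto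
          then show ?thesis using that(2) measure_nonneg[of L "{..<u}"] by linarith
        qed
        from this[OF M Mlow] this[OF E.real_distribution_axioms measure_extension_neg[OF \<mu>]]
        show ?thesis by (simp add: M.tail_eq E.tail_eq)
      qed
      then show "AE u in lborel. measure (extension \<mu>) {u..} = measure M {u..}" by simp
    qed
    have fatou: "(\<integral>\<^sup>+u. ennreal (measure M {u..}) * indicator {a..} u \<partial>lborel) \<le> c"
      if c: "\<And>n. (\<integral>\<^sup>+u. ennreal (measure (\<nu> n) {u..}) * indicator {a..} u \<partial>lborel) \<le> c" for a c
    proof -
      have [measurable]: "(\<lambda>u. measure (\<nu> n) {u..}) \<in> borel_measurable borel" for n
        by (rule real_distribution.tail_measurable[OF rd])
      have "(\<integral>\<^sup>+u. ennreal (measure M {u..}) * indicator {a..} u \<partial>lborel) =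
          (\<integral>\<^sup>+u. liminf (\<lambda>n. ennreal (measure (\<nu> (r n)) {u..}) * indicator {a..} u) \<partial>lborel)"
      proof (rule nn_integral_cong_AE, use tl in eventually_elim)
        fix u assume "(\<lambda>n. measure (\<nu> (r n)) {u..}) \<longlonglongrightarrow> measure M {u..}"
        then have "(\<lambda>n. ennreal (measure (\<nu> (r n)) {u..}) * indicator {a..} u) \<longlonglongrightarrow> ennreal (measure M {u..}) * indicator {a..} u"
          by (cases "a \<le> u") (auto intro: tendsto_ennrealI)
        from lim_imp_Liminf[OF _ this]
        show "ennreal (measure M {u..}) * indicator {a..} u = liminf (\<lambda>n. ennreal (measure (\<nu> (r n)) {u..}) * indicator {a..} u)" by simp
      qed
      also have "\<dots> \<le> liminf (\<lambda>n. \<integral>\<^sup>+u. ennreal (measure (\<nu> (r n)) {u..}) * indicator {a..} u \<partial>lborel)"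
        by (intro nn_integral_liminf) measurable
      also have "\<dots> \<le> c" using c by (intro Liminf_le) auto
      finally show ?thesis .
    qed
    have \<mu>P: "\<mu> \<in> P_le \<rho>"
    proof (rule P_leI[OF \<mu> _ \<rho>])
      have "(\<integral>\<^sup>+x. ennreal x \<partial>\<mu>) = (\<integral>\<^sup>+x. ennreal (x - 0) \<partial>M)"
        using nn_integral_extension[OF \<mu>, of "\<lambda>x. ennreal x"] by (simp add: ext)
      also have "\<dots> \<le> ennreal \<rho>"
        unfolding M.layer_cake[symmetric] using tail[of _ 0] D(3) by (intro fatou) simp
      finally show "(\<integral>\<^sup>+x. ennreal x \<partial>\<mu>) \<le> ennreal \<rho>" .
    qed
    have "(\<lambda>n. W1 (\<sigma> (r n)) \<mu>) \<longlonglongrightarrow> 0"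
    proof (rule tendstoI)
      fix e :: real assume e: "0 < e"
      \<comment> \<open>Makes each of the two tail integrals beyond \<open>a\<close> smaller than
        \<open>e / 3\<close>.\<close>
      define B where "B = 3 * (R + 1) / e"
      have B: "0 < B" "R / B < e / 3"
        using R e by (auto simp: B_def field_simps)
      obtain a where a: "0 \<le> a" "\<And>x. a \<le> x \<Longrightarrow> B * x \<le> f x" using super by blast
      have tn: "(\<integral>\<^sup>+u. ennreal (measure (\<nu> n) {u..}) * indicator {a..} u \<partial>lborel) \<le> ennreal (R / B)" for n
      proof -
        have idm: "(\<lambda>x. ennreal (x - a)) \<in> borel_measurable (\<sigma> n)"
          using measurable_compose[OF id_measurable_half_line[OF D(1,2)], of "\<lambda>x. ennreal (x - a)" borel] by simp
        have "ennreal B * (\<integral>\<^sup>+x. ennreal (x - a) \<partial>\<sigma> n) = (\<integral>\<^sup>+x. ennreal B * ennreal (x - a) \<partial>\<sigma> n)"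
          by (rule nn_integral_cmult[symmetric, OF idm])
        also have "\<dots> \<le> moment f (\<sigma> n)"
          unfolding moment_def
        proof (rule nn_integral_mono)
          fix x
          show "ennreal B * ennreal (x - a) \<le> ennreal (f x)"
          proof (cases "a \<le> x")
            case True
            have "B * (x - a) \<le> B * x" using B a(1) by (intro mult_left_mono) auto
            then have "B * (x - a) \<le> f x" using a(2)[OF True] by linarith
            then show ?thesis using True B by (simp add: ennreal_mult[symmetric] ennreal_leI)
          qed (simp add: ennreal_neg)
        qed
        also have "\<dots> \<le> ennreal R" by (rule \<sigma>f)
        finally have "ennreal (1 / B) * (ennreal B * (\<integral>\<^sup>+x. ennreal (x - a) \<partial>\<sigma> n)) \<le> ennreal (1 / B) * ennreal R"
          by (rule mult_left_mono) simp
        then show ?thesis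
          unfolding tail using B R by (simp add: mult.assoc[symmetric] ennreal_mult[symmetric])
      qed
      note tM = fatou[OF tn]
      have [measurable]: "(\<lambda>u. measure (\<nu> n) {u..}) \<in> borel_measurable borel" for n
        by (rule real_distribution.tail_measurable[OF rd])
      let ?g = "\<lambda>n u. ennreal \<bar>measure (\<nu> (r n)) {u..} - measure M {u..}\<bar> * indicator {0..a} u"
      have "(\<lambda>n. \<integral>\<^sup>+u. ?g n u \<partial>lborel) \<longlonglongrightarrow> (\<integral>\<^sup>+u. 0 \<partial>(lborel :: real measure))"
      proof (rule nn_integral_dominated_convergence[where u = ?g and u' = "\<lambda>_. 0" and w = "indicator {0..a}"])
        fix n
        have "\<bar>measure (\<nu> (r n)) {u..} - measure M {u..}\<bar> \<le> 1" for u
        proof -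
          interpret N: real_distribution "\<nu> (r n)" by (rule rd)
          show ?thesis using N.prob_le_1[of "{u..}"] M.prob_le_1[of "{u..}"]
            measure_nonneg[of "\<nu> (r n)" "{u..}"] measure_nonneg[of M "{u..}"] by linarith
        qed
        then show "AE u in lborel. ?g n u \<le> indicator {0..a} u"
          by (auto simp: indicator_def)
      next
        show "AE u in lborel. (\<lambda>n. ?g n u) \<longlonglongrightarrow> 0"
          using tl
        proof eventually_elim
          case (elim u)
          then have "(\<lambda>n. \<bar>measure (\<nu> (r n)) {u..} - measure M {u..}\<bar>) \<longlonglongrightarrow> 0"
            using tendsto_diff[OF elim tendsto_const[of "measure M {u..}"]] by (intro tendsto_rabs_zero) simp
          then have "(\<lambda>n. ennreal \<bar>measure (\<nu> (r n)) {u..} - measure M {u..}\<bar>) \<longlonglongrightarrow> 0"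
            using tendsto_ennrealI by fastforce
          then show ?case by (cases "u \<in> {0..a}") auto
        qed
      qed (use a in \<open>measurable, auto simp: emeasure_lborel_Icc_eq\<close>)
      then have "\<forall>\<^sub>F n in sequentially. (\<integral>\<^sup>+u. ?g n u \<partial>lborel) < ennreal (e / 3)"
        using e by (intro order_tendstoD(2)) auto
      then show "\<forall>\<^sub>F n in sequentially. dist (W1 (\<sigma> (r n)) \<mu>) 0 < e"
      proof eventually_elim
        case (elim n)
        have "ennreal (W1 (\<sigma> (r n)) \<mu>) =
            (\<integral>\<^sup>+u. ennreal \<bar>measure (\<nu> (r n)) {u..} - measure M {u..}\<bar> * indicator {0..} u \<partial>lborel)"
          unfolding W1_nn_integral[OF \<sigma>P \<mu>P] ext \<nu>_def ..
        also have "\<dots> \<le> (\<integral>\<^sup>+u. ?g n u + (ennreal (measure (\<nu> (r n)) {u..}) * indicator {a..} u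
            + ennreal (measure M {u..}) * indicator {a..} u) \<partial>lborel)"
        proof (rule nn_integral_mono)
          fix u
          have "ennreal \<bar>measure (\<nu> (r n)) {u..} - measure M {u..}\<bar> \<le> ennreal (measure (\<nu> (r n)) {u..}) + ennreal (measure M {u..})"
          proof -
            have "\<bar>measure (\<nu> (r n)) {u..} - measure M {u..}\<bar> \<le> measure (\<nu> (r n)) {u..} + measure M {u..}"
              using measure_nonneg[of "\<nu> (r n)" "{u..}"] measure_nonneg[of M "{u..}"] by linarith
            from ennreal_leI[OF this] show ?thesis by (simp add: ennreal_plus)
          qed
          then show "ennreal \<bar>measure (\<nu> (r n)) {u..} - measure M {u..}\<bar> * indicator {0..} u \<le> ?g n u +
              (ennreal (measure (\<nu> (r n)) {u..}) * indicator {a..} u + ennreal (measure M {u..}) * indicator {a..} u)"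
            by (auto simp: indicator_def)
        qed
        also have "\<dots> = (\<integral>\<^sup>+u. ?g n u \<partial>lborel) + ((\<integral>\<^sup>+u. ennreal (measure (\<nu> (r n)) {u..}) * indicator {a..} u \<partial>lborel)
            + (\<integral>\<^sup>+u. ennreal (measure M {u..}) * indicator {a..} u \<partial>lborel))"
        proof -
          have m: "(\<lambda>u. ennreal (measure (\<nu> (r n)) {u..}) * indicator {a..} u) \<in> borel_measurable lborel"
            "(\<lambda>u. ennreal (measure M {u..}) * indicator {a..} u) \<in> borel_measurable lborel"
            "?g n \<in> borel_measurable lborel" by measurable
          show ?thesis using nn_integral_add[OF m(3) borel_measurable_add[OF m(1,2)]] nn_integral_add[OF m(1,2)] by simp
        qed
        also have "\<dots> < ennreal (e / 3) + (ennreal (e / 3) + ennreal (e / 3))"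
        proof (intro add_strict_mono elim)
          have "ennreal (R / B) < ennreal (e / 3)" using B(2) e by (intro ennreal_lessI) auto
          then show "(\<integral>\<^sup>+u. ennreal (measure (\<nu> (r n)) {u..}) * indicator {a..} u \<partial>lborel) < ennreal (e / 3)"
            "(\<integral>\<^sup>+u. ennreal (measure M {u..}) * indicator {a..} u \<partial>lborel) < ennreal (e / 3)"
            using tn[of "r n"] tM by auto
        qed
        also have "\<dots> = ennreal e" using e by (simp add: ennreal_plus[symmetric] del: ennreal_plus)
        finally have "W1 (\<sigma> (r n)) \<mu> < e" using W1_nonneg e by (simp add: ennreal_less_iff)
        then show ?case using W1_nonneg[of "\<sigma> (r n)" \<mu>] by (simp add: dist_real_def)
      qed
    qed
    then have "limitin W.mtopology (\<sigma> \<circ> r) \<mu> sequentially"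
      unfolding W.limitin_metric_dist_null using \<mu>P \<sigma>P by (simp add: o_def)
    then show ?thesis using \<mu>P r by blast
  qed
  moreover have sub: "?S \<subseteq> P_le \<rho>" by blast
  ultimately have "\<forall>T. T \<subseteq> ?S \<and> infinite T \<longrightarrow> P_le \<rho> \<inter> W.mtopology derived_set_of T \<noteq> {}"
    using W.Bolzano_Weierstrass_property[OF sub sub] by blast
  then have "compactin W.mtopology (W.mtopology closure_of ?S)"
    unfolding W.compact_closure_of_eq_Bolzano_Weierstrass by blast
  moreover have "?S \<subseteq> W.mtopology closure_of ?S" by (rule closure_of_subset) auto
  ultimately show ?thesis by blast
qed

section \<open>Moduli and Riemann sums\<close>

text \<open>\<open>modulus\<close> is a supremum in the reals, so boundedness has to be shown first:
  a distance \<delta> is covered by finitely many steps of length \<open>g / 2\<close>, each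
  changing \<open>h\<close> by less than 1.\<close>

lemma modulus_upper:
  assumes "uniformly_continuous_on {0..} h" "0 \<le> z" "0 \<le> z'" "\<bar>z - z'\<bar> \<le> \<delta>"
  shows "\<bar>h z - h z'\<bar> \<le> modulus h \<delta>"
proof -
  obtain g where g: "0 < g" "\<And>x x'. 0 \<le> x \<Longrightarrow> 0 \<le> x' \<Longrightarrow> \<bar>x' - x\<bar> < g \<Longrightarrow> \<bar>h x' - h x\<bar> < 1"
  proof -
    have "\<exists>g>0. \<forall>x\<in>{0..}. \<forall>x'\<in>{0..}. dist x' x < g \<longrightarrow> dist (h x') (h x) < 1"
      using assms(1) zero_less_one unfolding uniformly_continuous_on_def by blast
    then show ?thesis using that unfolding dist_real_def by (metis atLeast_iff)
  qed
  have chain: "\<bar>h (x + t) - h x\<bar> \<le> real n" if "0 \<le> x" "0 \<le> t" "t \<le> real n * (g / 2)" for x t n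
    using that
  proof (induction n arbitrary: t)
    case 0 then show ?case by simp
  next
    case (Suc n)
    define t' where "t' = min t (real n * (g / 2))"
    have t': "0 \<le> t'" "t' \<le> real n * (g / 2)" "t' \<le> t" "t - t' \<le> g / 2"
      using Suc.prems g(1) by (auto simp: t'_def min_def algebra_simps)
    have "\<bar>h (x + t') - h x\<bar> \<le> real n" using Suc.IH[OF Suc.prems(1) t'(1,2)] .
    moreover have "\<bar>h (x + t) - h (x + t')\<bar> < 1" using t' Suc.prems g(1) by (intro g(2)) auto
    ultimately show ?case by simp
  qed
  obtain n :: nat where n: "\<delta> < real n * (g / 2)" using reals_Archimedean3[of "g / 2"] g(1) by auto
  have b: "\<bar>h z - h z'\<bar> \<le> real n" if "0 \<le> z" "0 \<le> z'" "\<bar>z - z'\<bar> \<le> \<delta>" for z z'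
  proof (cases "z' \<le> z")
    case True
    then show ?thesis using chain[of z' "z - z'" n] that n by auto
  next
    case False
    then show ?thesis using chain[of z "z' - z" n] that n by (auto simp: abs_minus_commute)
  qed
  have "bdd_above {\<bar>h z - h z'\<bar> |z z'. 0 \<le> z \<and> 0 \<le> z' \<and> \<bar>z - z'\<bar> \<le> \<delta>}"
    by (rule bdd_aboveI[of _ "real n"]) (use b in auto)
  then show ?thesis unfolding modulus_def by (intro cSup_upper) (use assms in auto)
qed

text \<open>On each cell the right endpoint value exceeds the mean by at most the modulus at mesh
  \<epsilon>. The \<open>N\<close> cells accumulate an error of \<open>N * \<epsilon>\<close> times
  the modulus, which is where the speed of \<epsilon> enters.\<close>

lemma riemann_sum_le:
  assumes uc: "uniformly_continuous_on {0..} h" and int: "set_integrable lborel {0..} h"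
    and nn: "\<And>x. 0 \<le> x \<Longrightarrow> 0 \<le> h x" and \<epsilon>: "0 < \<epsilon>"
  shows "(\<Sum>d=1..N. \<epsilon> * h (real d * \<epsilon>)) \<le> (LINT u:{0..}|lborel. h u) + real N * \<epsilon> * modulus h \<epsilon>"
proof -
  have sub: "set_integrable lborel {a<..b} h" if "0 \<le> a" for a b
    by (rule set_integrable_subset[OF int]) (use that in auto)
  have "(\<Sum>d=1..N. \<epsilon> * h (real d * \<epsilon>)) \<le> (LINT u:{0<..real N * \<epsilon>}|lborel. h u) + real N * \<epsilon> * modulus h \<epsilon>"
  proof (induction N)
    case 0 then show ?case by (simp add: set_lebesgue_integral_def)
  next
    case (Suc N)
    let ?a = "real N * \<epsilon>" and ?b = "real (Suc N) * \<epsilon>"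
    have a: "0 \<le> ?a" "?a \<le> ?b" "?b - ?a = \<epsilon>" using \<epsilon> by (auto simp: algebra_simps)
    have split: "(LINT u:{0<..?b}|lborel. h u) = (LINT u:{0<..?a}|lborel. h u) + (LINT u:{?a<..?b}|lborel. h u)"
    proof -
      have "{0<..?b} = {0<..?a} \<union> {?a<..?b}" using ivl_disj_un_two(6)[OF a(1,2)] by simp
      then show ?thesis by (simp only:) (rule set_integral_Un[OF _ sub sub], use a in auto)
    qed
    have "\<epsilon> * (h ?b - modulus h \<epsilon>) = (LINT u:{?a<..?b}|lborel. h ?b - modulus h \<epsilon>)"
      using a by (simp add: set_lebesgue_integral_def)
    also have "\<dots> \<le> (LINT u:{?a<..?b}|lborel. h u)"
    proof (rule set_integral_mono[OF _ sub[OF a(1)]])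
      show "set_integrable lborel {?a<..?b} (\<lambda>u. h ?b - modulus h \<epsilon>)"
        unfolding set_integrable_def using a by (auto intro!: integrable_real_indicator integrable_mult_left)
      fix u assume u: "u \<in> {?a<..?b}"
      then have "?a < u" "u \<le> ?b" by simp_all
      then have "0 \<le> ?b" "0 \<le> u" "\<bar>?b - u\<bar> \<le> \<epsilon>" using a by linarith+
      then have "\<bar>h ?b - h u\<bar> \<le> modulus h \<epsilon>" by (rule modulus_upper[OF uc])
      then show "h ?b - modulus h \<epsilon> \<le> h u" by linarith
    qed
    finally show ?case using Suc.IH split by (simp add: algebra_simps)
  qed
  also have "(LINT u:{0<..real N * \<epsilon>}|lborel. h u) \<le> (LINT u:{0..}|lborel. h u)"
    unfolding set_lebesgue_integral_def
    by (rule integral_mono) (use sub[of 0] int nn in \<open>auto simp: set_integrable_def indicator_def\<close>)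
  finally show ?thesis by simp
qed

section \<open>States as finitely supported measures\<close>

text \<open>Summing over the support instead of the grid makes the functional independent of
  \<open>N\<close> and \<epsilon>, so that one \<open>F\<close> serves the whole sequence.\<close>

definition state_sum :: "(real \<Rightarrow> real) \<Rightarrow> (real \<Rightarrow> real) \<Rightarrow> real" where
  "state_sum g c = (\<Sum>x | c x \<noteq> 0. c x * g x)"

definition cluster_grid :: "nat \<Rightarrow> real \<Rightarrow> real set" where
  "cluster_grid N \<epsilon> = (\<lambda>k. real k * \<epsilon>) ` {..N}"

lemma finite_cluster_grid [simp]: "finite (cluster_grid N \<epsilon>)"
  by (simp add: cluster_grid_def)

lemma cluster_grid_mem [simp]: "k \<le> N \<Longrightarrow> real k * \<epsilon> \<in> cluster_grid N \<epsilon>"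
  by (auto simp: cluster_grid_def)

lemma sum_cluster_grid: "0 < \<epsilon> \<Longrightarrow> sum g (cluster_grid N \<epsilon>) = (\<Sum>k\<le>N. g (real k * \<epsilon>))"
  unfolding cluster_grid_def by (subst sum.reindex) (auto simp: inj_on_def)

lemma configs_eq:
  "configs N L \<epsilon> = {\<eta> \<in> {1..L} \<rightarrow>\<^sub>E cluster_grid N \<epsilon>. (\<Sum>i=1..L. \<eta> i) = real N * \<epsilon>}"
proof -
  have "{real k * \<epsilon> |k. k \<le> N} = cluster_grid N \<epsilon>" by (auto simp: cluster_grid_def)
  then show ?thesis by (simp add: configs_def)
qed

lemma finite_states: "finite (states N L \<epsilon>)"
proof -
  have "finite ({1..L} \<rightarrow>\<^sub>E cluster_grid N \<epsilon>)" by (intro finite_PiE) auto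
  then show ?thesis unfolding states_def configs_eq by (auto intro: finite_subset)
qed

lemma states_facts:
  assumes c: "c \<in> states N L \<epsilon>" and L: "0 < L" and \<epsilon>: "0 < \<epsilon>"
  shows state_nonneg: "0 \<le> c x"
    and state_support: "{x. c x \<noteq> 0} \<subseteq> cluster_grid N \<epsilon>"
    and state_sum_grid: "state_sum g c = (\<Sum>x\<in>cluster_grid N \<epsilon>. c x * g x)"
    and state_mass: "(\<Sum>x\<in>cluster_grid N \<epsilon>. c x) = 1"
    and state_mean: "(\<Sum>x\<in>cluster_grid N \<epsilon>. c x * x) = real N * \<epsilon> / real L"
proof -
  from c obtain \<eta> where \<eta>: "\<eta> \<in> {1..L} \<rightarrow>\<^sub>E cluster_grid N \<epsilon>" "(\<Sum>i=1..L. \<eta> i) = real N * \<epsilon>"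
    and cd: "c = cluster_dist L \<eta>" unfolding states_def configs_eq by auto
  show "0 \<le> c x" for x
    unfolding cd cluster_dist_def by (intro mult_nonneg_nonneg sum_nonneg) (auto simp: kron_def)
  show sup: "{x. c x \<noteq> 0} \<subseteq> cluster_grid N \<epsilon>"
  proof
    fix x assume "x \<in> {x. c x \<noteq> 0}"
    then have "(\<Sum>i=1..L. kron (\<eta> i) x) \<noteq> 0" unfolding cd cluster_dist_def by auto
    then obtain i where "i \<in> {1..L}" "kron (\<eta> i) x \<noteq> 0" by (meson sum.not_neutral_contains_not_neutral)
    then show "x \<in> cluster_grid N \<epsilon>" using \<eta>(1) by (auto simp: kron_def split: if_splits)
  qed
  show "state_sum g c = (\<Sum>x\<in>cluster_grid N \<epsilon>. c x * g x)" for g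
    unfolding state_sum_def using sup by (intro sum.mono_neutral_left) auto
  \<comment> \<open>Integrals against \<open>c\<close> are averages over the \<open>L\<close> sites
    of an underlying configuration; mass and mean are special cases.\<close>
  have sm: "(\<Sum>x\<in>cluster_grid N \<epsilon>. c x * g x) = (\<Sum>i=1..L. g (\<eta> i)) / real L" for g
  proof -
    have "(\<Sum>x\<in>cluster_grid N \<epsilon>. c x * g x) = (\<Sum>x\<in>cluster_grid N \<epsilon>. \<Sum>i=1..L. kron (\<eta> i) x * g x / real L)"
      unfolding cd cluster_dist_def by (simp add: sum_distrib_left sum_distrib_right sum_divide_distrib)
    also have "\<dots> = (\<Sum>i=1..L. \<Sum>x\<in>cluster_grid N \<epsilon>. kron (\<eta> i) x * g x / real L)" by (rule sum.swap)
    also have "\<dots> = (\<Sum>i=1..L. g (\<eta> i) / real L)"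
    proof (rule sum.cong[OF refl])
      fix i assume "i \<in> {1..L}"
      then have "\<eta> i \<in> cluster_grid N \<epsilon>" using \<eta>(1) by auto
      then show "(\<Sum>x\<in>cluster_grid N \<epsilon>. kron (\<eta> i) x * g x / real L) = g (\<eta> i) / real L"
        by (simp add: kron_def if_distrib[of "\<lambda>t. t * _"] if_distrib[of "\<lambda>t. t / _"] sum.delta cong: if_cong)
    qed
    finally show ?thesis by (simp add: sum_divide_distrib)
  qed
  show "(\<Sum>x\<in>cluster_grid N \<epsilon>. c x) = 1" using sm[of "\<lambda>_. 1"] L by simp
  show "(\<Sum>x\<in>cluster_grid N \<epsilon>. c x * x) = real N * \<epsilon> / real L" using sm[of "\<lambda>x. x"] \<eta>(2) by simp
qed

lemma sum_two_updates:
  fixes g :: "real \<Rightarrow> real"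
  assumes "finite I" "i \<in> I" "j \<in> I" "i \<noteq> j"
  shows "(\<Sum>q\<in>I. g ((\<eta>(i := a, j := b)) q)) = (\<Sum>q\<in>I. g (\<eta> q)) + (g a - g (\<eta> i)) + (g b - g (\<eta> j))"
proof -
  have "(\<Sum>q\<in>I. g ((\<eta>(i := a, j := b)) q) - g (\<eta> q)) = (\<Sum>q\<in>{i, j}. g ((\<eta>(i := a, j := b)) q) - g (\<eta> q))"
    using assms by (intro sum.mono_neutral_right) auto
  also have "\<dots> = (g a - g (\<eta> i)) + (g b - g (\<eta> j))" using assms(4) by simp
  finally show ?thesis by (simp add: sum_subtractf)
qed

text \<open>With \<open>m x\<close> the number of sites of size \<open>x\<close>, the weight times
  \<open>L\<^sup>2\<close> counts ordered pairs of distinct sites of sizes \<open>x\<close> and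
  \<open>y\<close>; the Kronecker term removes a site paired with itself. If it is nonzero, such a
  pair exists and the move is carried out on the configuration.\<close>

lemma
  assumes c: "c \<in> states N L \<epsilon>" and L: "2 \<le> L" and \<epsilon>: "0 < \<epsilon>"
  shows pair_weight_nonneg: "0 \<le> c x * (c y - 1 / real L * kron x y)"
    and states_closed: "c x * (c y - 1 / real L * kron x y) \<noteq> 0 \<Longrightarrow> x - z \<in> cluster_grid N \<epsilon> \<Longrightarrow>
      y + z \<in> cluster_grid N \<epsilon> \<Longrightarrow> (\<lambda>u. c u + 1 / real L * jump x y z u) \<in> states N L \<epsilon>"
proof -
  from c obtain \<eta> where \<eta>: "\<eta> \<in> {1..L} \<rightarrow>\<^sub>E cluster_grid N \<epsilon>" "(\<Sum>i=1..L. \<eta> i) = real N * \<epsilon>"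
    and cd: "c = cluster_dist L \<eta>" unfolding states_def configs_eq by auto
  define m where "m x = card {i \<in> {1..L}. \<eta> i = x}" for x
  have cm: "c x = real (m x) / real L" for x
    unfolding cd cluster_dist_def kron_def m_def by (simp add: sum.If_cases Int_def)
  have w: "c x * (c y - 1 / real L * kron x y) =
      (if x = y then real (m x) * (real (m x) - 1) / (real L)\<^sup>2 else real (m x) * real (m y) / (real L)\<^sup>2)"
    unfolding cm kron_def by (simp add: power2_eq_square diff_divide_distrib[symmetric])
  show "0 \<le> c x * (c y - 1 / real L * kron x y)"
    unfolding w by (cases "m x") auto
  assume nz: "c x * (c y - 1 / real L * kron x y) \<noteq> 0"
    and xz: "x - z \<in> cluster_grid N \<epsilon>" and yz: "y + z \<in> cluster_grid N \<epsilon>"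
  have "\<exists>i j. i \<in> {1..L} \<and> j \<in> {1..L} \<and> i \<noteq> j \<and> \<eta> i = x \<and> \<eta> j = y"
  proof (cases "x = y")
    case True
    then have "m x \<noteq> 0" "m x \<noteq> 1" using nz unfolding w by auto
    then have "2 \<le> card {i \<in> {1..L}. \<eta> i = x}" unfolding m_def by linarith
    then obtain T where T: "T \<subseteq> {i \<in> {1..L}. \<eta> i = x}" "card T = 2" by (meson obtain_subset_with_card_n)
    then obtain i j where "T = {i, j}" "i \<noteq> j" by (auto simp: card_2_iff)
    then show ?thesis using T(1) True by blast
  next
    case False
    then have "m x \<noteq> 0" "m y \<noteq> 0" using nz unfolding w by auto
    then have "{i \<in> {1..L}. \<eta> i = x} \<noteq> {}" "{i \<in> {1..L}. \<eta> i = y} \<noteq> {}" unfolding m_def by (metis card.empty)+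
    then show ?thesis using False by blast
  qed
  then obtain i j where ij: "i \<in> {1..L}" "j \<in> {1..L}" "i \<noteq> j" "\<eta> i = x" "\<eta> j = y" by blast
  let ?\<eta> = "\<eta>(i := x - z, j := y + z)"
  have "?\<eta> \<in> configs N L \<epsilon>"
    unfolding configs_eq
  proof (intro CollectI conjI)
    show "?\<eta> \<in> {1..L} \<rightarrow>\<^sub>E cluster_grid N \<epsilon>" using \<eta>(1) ij xz yz by (auto simp: PiE_iff extensional_def)
    show "(\<Sum>q=1..L. ?\<eta> q) = real N * \<epsilon>"
      using sum_two_updates[of "{1..L}" i j "\<lambda>x. x" \<eta> "x - z" "y + z"] ij \<eta>(2) by simp
  qed
  moreover have "cluster_dist L ?\<eta> = (\<lambda>u. c u + 1 / real L * jump x y z u)"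
  proof
    fix u
    have s: "(\<Sum>q=1..L. kron (?\<eta> q) u) = (\<Sum>q=1..L. kron (\<eta> q) u) + (kron (x - z) u - kron x u) + (kron (y + z) u - kron y u)"
      using sum_two_updates[of "{1..L}" i j "\<lambda>v. kron v u" \<eta> "x - z" "y + z"] ij by simp
    show "cluster_dist L ?\<eta> u = c u + 1 / real L * jump x y z u"
      unfolding cd cluster_dist_def jump_def s by (simp only: distrib_left[symmetric] add_diff_eq diff_add_eq add.assoc)
  qed
  ultimately show "(\<lambda>u. c u + 1 / real L * jump x y z u) \<in> states N L \<epsilon>" unfolding states_def by (metis imageI)
qed

lemma sum_jump:
  assumes "finite G" "x - z \<in> G" "x \<in> G" "y + z \<in> G" "y \<in> G"
  shows "(\<Sum>u\<in>G. (c u + 1 / real L * jump x y z u) * g u) =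
    (\<Sum>u\<in>G. c u * g u) + (g (x - z) - g x + g (y + z) - g y) / real L"
proof -
  have k: "(\<Sum>u\<in>G. kron v u * g u) = g v" if "v \<in> G" for v
    using assms(1) that by (simp add: kron_def if_distrib[of "\<lambda>t. t * _"] sum.delta cong: if_cong)
  have "(\<Sum>u\<in>G. jump x y z u * g u) = g (x - z) - g x + g (y + z) - g y"
    using assms by (simp add: jump_def left_diff_distrib distrib_right sum.distrib sum_subtractf k)
  moreover have "(\<Sum>u\<in>G. (c u + 1 / real L * jump x y z u) * g u) =
      (\<Sum>u\<in>G. c u * g u) + (\<Sum>u\<in>G. jump x y z u * g u) / real L"
    by (simp add: algebra_simps sum.distrib sum_divide_distrib)
  ultimately show ?thesis by simp
qed

section \<open>Embedding of states as probability measures\<close>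

lemma sets_as_measure: "sets (as_measure c) = sets borel_nonneg"
  by (simp add: as_measure_def)

context
  fixes c N L \<epsilon>
  assumes c: "c \<in> states N L \<epsilon>" and L: "0 < L" and \<epsilon>: "0 < \<epsilon>"
begin

lemma cluster_grid_nonneg: "x \<in> cluster_grid N \<epsilon> \<Longrightarrow> 0 \<le> x"
  using \<epsilon> by (auto simp: cluster_grid_def)

lemma nn_integral_as_measure:
  assumes f: "f \<in> borel_measurable borel_nonneg"
  shows "(\<integral>\<^sup>+x. f x \<partial>as_measure c) = (\<Sum>x\<in>cluster_grid N \<epsilon>. ennreal (c x) * f x)"
proof -
  have fin: "finite {x. c x \<noteq> 0}" using state_support[OF c L \<epsilon>] by (rule finite_subset) simp
  have "(\<lambda>x. x) \<in> measurable (point_measure {x. c x \<noteq> 0} (\<lambda>x. ennreal (c x))) borel_nonneg"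
    using state_support[OF c L \<epsilon>] cluster_grid_nonneg
    by (auto simp: measurable_def space_point_measure sets_point_measure space_restrict_space)
  then have "(\<integral>\<^sup>+x. f x \<partial>as_measure c) = (\<integral>\<^sup>+x. f x \<partial>point_measure {x. c x \<noteq> 0} (\<lambda>x. ennreal (c x)))"
    unfolding as_measure_def using f by (subst nn_integral_distr) auto
  also have "\<dots> = (\<Sum>x | c x \<noteq> 0. ennreal (c x) * f x)" by (rule nn_integral_point_measure_finite[OF fin])
  also have "\<dots> = (\<Sum>x\<in>cluster_grid N \<epsilon>. ennreal (c x) * f x)"
    using state_support[OF c L \<epsilon>] by (intro sum.mono_neutral_left) auto
  finally show ?thesis .
qed

lemma nn_integral_as_measure_real:
  assumes "f \<in> borel_measurable borel_nonneg" "\<And>x. 0 \<le> x \<Longrightarrow> 0 \<le> f x"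
  shows "(\<integral>\<^sup>+x. ennreal (f x) \<partial>as_measure c) = ennreal (\<Sum>x\<in>cluster_grid N \<epsilon>. c x * f x)"
proof -
  have "(\<integral>\<^sup>+x. ennreal (f x) \<partial>as_measure c) = (\<Sum>x\<in>cluster_grid N \<epsilon>. ennreal (c x) * ennreal (f x))"
    using assms by (intro nn_integral_as_measure) auto
  also have "\<dots> = (\<Sum>x\<in>cluster_grid N \<epsilon>. ennreal (c x * f x))"
    using state_nonneg[OF c L \<epsilon>] assms(2) cluster_grid_nonneg by (intro sum.cong refl ennreal_mult[symmetric]) auto
  also have "\<dots> = ennreal (\<Sum>x\<in>cluster_grid N \<epsilon>. c x * f x)"
    using state_nonneg[OF c L \<epsilon>] assms(2) cluster_grid_nonneg by (intro sum_ennreal mult_nonneg_nonneg) auto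
  finally show ?thesis .
qed

lemma prob_space_as_measure: "prob_space (as_measure c)"
proof
  have "emeasure (as_measure c) (space (as_measure c)) = (\<integral>\<^sup>+x. ennreal 1 \<partial>as_measure c)" by simp
  also have "\<dots> = 1" by (subst nn_integral_as_measure_real) (simp_all add: state_mass[OF c L \<epsilon>])
  finally show "emeasure (as_measure c) (space (as_measure c)) = 1" .
qed

lemma measure_as_measure:
  assumes "A \<in> sets borel_nonneg"
  shows "measure (as_measure c) A = (\<Sum>x\<in>cluster_grid N \<epsilon>. c x * indicator A x)"
proof -
  have "emeasure (as_measure c) A = (\<integral>\<^sup>+x. ennreal (indicator A x) \<partial>as_measure c)"
    using assms by (subst ennreal_indicator, subst nn_integral_indicator) (auto simp: sets_as_measure)
  also have "\<dots> = ennreal (\<Sum>x\<in>cluster_grid N \<epsilon>. c x * indicator A x)"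
    using assms by (intro nn_integral_as_measure_real) auto
  finally show ?thesis
    unfolding measure_def using state_nonneg[OF c L \<epsilon>] by (simp add: sum_nonneg)
qed

lemma as_measure_P_le:
  assumes "real N * \<epsilon> / real L \<le> \<rho>" shows "as_measure c \<in> P_le \<rho>"
proof (rule P_leI[OF prob_space_as_measure sets_as_measure])
  have "(\<lambda>x::real. x) \<in> borel_measurable borel_nonneg" by (rule measurable_restrict_space1) simp
  then have "(\<integral>\<^sup>+x. ennreal x \<partial>as_measure c) = ennreal (\<Sum>x\<in>cluster_grid N \<epsilon>. c x * x)"
    by (rule nn_integral_as_measure_real)
  then show "(\<integral>\<^sup>+x. ennreal x \<partial>as_measure c) \<le> ennreal \<rho>"
    using assms by (simp add: state_mean[OF c L \<epsilon>] ennreal_leI)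
  have "0 \<le> real N * \<epsilon> / real L" using \<epsilon> by simp
  then show "0 \<le> \<rho>" using assms by linarith
qed

lemma as_measure_point:
  assumes "0 \<le> x" shows "measure (as_measure c) {x} = c x"
proof -
  have "{x} \<in> sets borel_nonneg" using assms by (auto simp: sets_restrict_space intro!: image_eqI[of _ _ "{x}"])
  then have "measure (as_measure c) {x} = (\<Sum>u\<in>cluster_grid N \<epsilon>. if u = x then c x else 0)"
    by (subst measure_as_measure) (auto intro!: sum.cong simp: indicator_def)
  then show ?thesis using state_support[OF c L \<epsilon>] by (auto simp: sum.delta)
qed

end

lemma inj_as_measure:
  assumes "0 < L" "0 < \<epsilon>" shows "inj_on as_measure (states N L \<epsilon>)"
proof (rule inj_onI, rule ext)
  fix c c' x assume c: "c \<in> states N L \<epsilon>" "c' \<in> states N L \<epsilon>" "as_measure c = as_measure c'"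
  show "c x = c' x"
  proof (cases "0 \<le> x")
    case True
    then show ?thesis using as_measure_point[OF c(1) assms True] as_measure_point[OF c(2) assms True] c(3) by simp
  next
    case False
    then have "x \<notin> cluster_grid N \<epsilon>" using assms by (auto simp: cluster_grid_def mult_less_0_iff not_le)
    then have "\<not> c x \<noteq> 0" "\<not> c' x \<noteq> 0"
      using state_support[OF c(1) assms] state_support[OF c(2) assms] by blast+
    then show ?thesis by simp
  qed
qed

text \<open>The tails change only on \<open>(x - z, x]\<close> and \<open>(y, y + z]\<close>, two
  intervals of length \<open>z\<close>, by at most \<open>1 / L\<close> for each interval.\<close>

lemma W1_jump_le:
  assumes c: "c \<in> states N L \<epsilon>" and c': "(\<lambda>u. c u + 1 / real L * jump x y z u) \<in> states N L \<epsilon>" (is "?c' \<in> _")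
    and L: "0 < L" and \<epsilon>: "0 < \<epsilon>" and z: "0 \<le> z"
    and G: "x - z \<in> cluster_grid N \<epsilon>" "x \<in> cluster_grid N \<epsilon>" "y + z \<in> cluster_grid N \<epsilon>" "y \<in> cluster_grid N \<epsilon>"
  shows "W1 (as_measure c) (as_measure ?c') \<le> 2 * z / real L"
proof -
  let ?\<rho> = "real N * \<epsilon> / real L"
  have P: "as_measure c \<in> P_le ?\<rho>" "as_measure ?c' \<in> P_le ?\<rho>"
    using as_measure_P_le[OF c L \<epsilon>] as_measure_P_le[OF c' L \<epsilon>] by auto
  let ?g = "\<lambda>u. (indicator {x - z<..x} u + indicator {y<..y + z} u) / real L :: real"
  have ig: "integrable lborel ?g"
    by (intro integrable_divide Bochner_Integration.integrable_add integrable_real_indicator) (use z in auto)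
  have "(\<integral>u. ?g u \<partial>lborel) = 2 * z / real L" using z by simp
  moreover have "W1 (as_measure c) (as_measure ?c') \<le> (\<integral>u. ?g u \<partial>lborel)"
    unfolding W1_def set_lebesgue_integral_def
  proof (rule integral_mono[OF W1_integrable[OF P, unfolded set_integrable_def] ig])
    fix u :: real
    show "indicator {0..} u *\<^sub>R \<bar>measure (as_measure c) {u..} - measure (as_measure ?c') {u..}\<bar> \<le> ?g u"
    proof (cases "0 \<le> u")
      case True
      then have A: "{u..} \<in> sets borel_nonneg" by (auto simp: sets_restrict_space intro!: image_eqI[of _ _ "{u..}"])
      have "measure (as_measure ?c') {u..} - measure (as_measure c) {u..} =
          (indicator {u..} (x - z) - indicator {u..} x + indicator {u..} (y + z) - indicator {u..} y) / real L"
        unfolding measure_as_measure[OF c L \<epsilon> A] measure_as_measure[OF c' L \<epsilon> A]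
        by (subst sum_jump) (use G in auto)
      then have "\<bar>measure (as_measure c) {u..} - measure (as_measure ?c') {u..}\<bar> =
          \<bar>indicator {u..} (x - z) - indicator {u..} x + indicator {u..} (y + z) - indicator {u..} y\<bar> / real L"
        by (subst abs_minus_commute) simp
      also have "\<dots> \<le> ?g u" using z L by (intro divide_right_mono) (auto simp: indicator_def)
      finally show ?thesis using True by simp
    qed (auto simp: indicator_def)
  qed
  ultimately show ?thesis by linarith
qed

section \<open>The particle system as a finite jump process\<close>

definition jumps :: "nat \<Rightarrow> (nat \<times> nat \<times> nat) set" where
  "jumps N = (SIGMA k:{1..N}. SIGMA l:{0..N - k}. {1..k})"

definition jump_rate ::
  "(real \<Rightarrow> real \<Rightarrow> real \<Rightarrow> real) \<Rightarrow> nat \<Rightarrow> real \<Rightarrow> (real \<Rightarrow> real) \<Rightarrow> nat \<times> nat \<times> nat \<Rightarrow> real" where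
  "jump_rate K L \<epsilon> c = (\<lambda>(k, l, m). real L * rate K L \<epsilon> c (real k * \<epsilon>) (real l * \<epsilon>) (real m * \<epsilon>))"

definition jump_target :: "nat \<Rightarrow> real \<Rightarrow> (real \<Rightarrow> real) \<Rightarrow> nat \<times> nat \<times> nat \<Rightarrow> real \<Rightarrow> real" where
  "jump_target L \<epsilon> c = (\<lambda>(k, l, m) u. c u + 1 / real L * jump (real k * \<epsilon>) (real l * \<epsilon>) (real m * \<epsilon>) u)"

lemma gen_eq:
  "gen K N L \<epsilon> G c = (\<Sum>j\<in>jumps N. jump_rate K L \<epsilon> c j * (G (jump_target L \<epsilon> c j) - G c))"
proof -
  have "(\<Sum>j\<in>jumps N. h j) = (\<Sum>k=1..N. \<Sum>l=0..N - k. \<Sum>m=1..k. h (k, l, m))" for h :: "_ \<Rightarrow> real"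
    unfolding jumps_def by (simp add: sum.Sigma case_prod_unfold)
  then show ?thesis
    unfolding gen_def by (simp only: sum_distrib_left jump_rate_def jump_target_def prod.case mult.assoc)
qed

lemma jumps_grid:
  assumes "(k, l, m) \<in> jumps N"
  shows "real k * \<epsilon> - real m * \<epsilon> \<in> cluster_grid N \<epsilon>" "real l * \<epsilon> + real m * \<epsilon> \<in> cluster_grid N \<epsilon>"
    "real k * \<epsilon> \<in> cluster_grid N \<epsilon>" "real l * \<epsilon> \<in> cluster_grid N \<epsilon>"
proof -
  have b: "1 \<le> k" "k \<le> N" "l \<le> N - k" "1 \<le> m" "m \<le> k" using assms by (auto simp: jumps_def)
  have "real (k - m) * \<epsilon> \<in> cluster_grid N \<epsilon>" "real (l + m) * \<epsilon> \<in> cluster_grid N \<epsilon>"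
    using b by (intro cluster_grid_mem; simp)+
  then show "real k * \<epsilon> - real m * \<epsilon> \<in> cluster_grid N \<epsilon>" "real l * \<epsilon> + real m * \<epsilon> \<in> cluster_grid N \<epsilon>"
    using b by (simp_all add: of_nat_diff algebra_simps)
  show "real k * \<epsilon> \<in> cluster_grid N \<epsilon>" "real l * \<epsilon> \<in> cluster_grid N \<epsilon>" using b by auto
qed

text \<open>Relaxing the constraints between the three indices factorises a sum of nonnegative
  products.\<close>

lemma sum_jumps_le:
  fixes a b e :: "nat \<Rightarrow> real"
  assumes "\<And>k l m. (k, l, m) \<in> jumps N \<Longrightarrow> t (k, l, m) \<le> a k * b l * e m"
    and nn: "\<And>k. 0 \<le> a k" "\<And>k. 0 \<le> b k" "\<And>k. 0 \<le> e k"
  shows "(\<Sum>j\<in>jumps N. t j) \<le> (\<Sum>k\<le>N. a k) * (\<Sum>l\<le>N. b l) * (\<Sum>m=1..N. e m)"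
proof -
  have "(\<Sum>j\<in>jumps N. t j) \<le> (\<Sum>(k, l, m)\<in>jumps N. a k * b l * e m)"
    using assms(1) by (intro sum_mono) auto
  also have "\<dots> \<le> (\<Sum>(k, l, m)\<in>{..N} \<times> {..N} \<times> {1..N}. a k * b l * e m)"
    by (intro sum_mono2) (auto simp: jumps_def nn)
  also have "\<dots> = (\<Sum>k\<le>N. \<Sum>l\<le>N. \<Sum>m=1..N. a k * b l * e m)"
    by (simp add: sum.cartesian_product)
  also have "\<dots> = (\<Sum>k\<le>N. a k) * (\<Sum>l\<le>N. b l) * (\<Sum>m=1..N. e m)"
    by (simp add: sum_distrib_left[symmetric] sum_distrib_right[symmetric])
  finally show ?thesis .
qed

lemma jump_rate_bounds:
  assumes K: "\<forall>x>0. \<forall>y\<ge>0. \<forall>z\<ge>0. 0 \<le> K x y z \<and> K x y z \<le> C\<^sub>K * (1 + x) * (1 + y) * \<phi> z"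
    and \<phi>: "\<forall>z\<ge>0. 0 \<le> \<phi> z" and C\<^sub>K: "0 \<le> C\<^sub>K"
    and c: "c \<in> states N L \<epsilon>" and L: "2 \<le> L" and \<epsilon>: "0 < \<epsilon>" and j: "(k, l, m) \<in> jumps N"
  shows "0 \<le> jump_rate K L \<epsilon> c (k, l, m)"
    and "jump_rate K L \<epsilon> c (k, l, m) \<le> real L * (2 * C\<^sub>K * ((1 + real k * \<epsilon>) * c (real k * \<epsilon>)) *
      ((1 + real l * \<epsilon>) * c (real l * \<epsilon>)) * (\<epsilon> * \<phi> (real m * \<epsilon>)))"
    and "jump_rate K L \<epsilon> c (k, l, m) \<noteq> 0 \<Longrightarrow> jump_target L \<epsilon> c (k, l, m) \<in> states N L \<epsilon>"
proof -
  let ?x = "real k * \<epsilon>" and ?y = "real l * \<epsilon>" and ?z = "real m * \<epsilon>"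
  have L0: "0 < L" using L by simp
  have kx: "0 < ?x" "0 \<le> ?y" "0 \<le> ?z" using j \<epsilon> by (auto simp: jumps_def)
  have K': "0 \<le> K ?x ?y ?z" "K ?x ?y ?z \<le> C\<^sub>K * (1 + ?x) * (1 + ?y) * \<phi> ?z" and \<phi>': "0 \<le> \<phi> ?z"
    using K \<phi> kx by auto
  define w where "w = c ?x * (c ?y - 1 / real L * kron ?x ?y)"
  have w: "0 \<le> w" unfolding w_def by (rule pair_weight_nonneg[OF c L \<epsilon>])
  have wle: "w \<le> c ?x * c ?y"
    unfolding w_def using state_nonneg[OF c L0 \<epsilon>] by (intro mult_left_mono) (auto simp: kron_def)
  \<comment> \<open>The normalisation of the rates is at most 2 because \<open>L\<close> is at least
    2.\<close>
  have q: "0 \<le> real L / (real L - 1)" "real L / (real L - 1) \<le> 2" using L by (auto simp: field_simps)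
  have eq: "jump_rate K L \<epsilon> c (k, l, m) = real L * (real L / (real L - 1) * K ?x ?y ?z * \<epsilon> * w)"
    unfolding jump_rate_def rate_def w_def by (simp add: mult.assoc)
  show "0 \<le> jump_rate K L \<epsilon> c (k, l, m)"
    unfolding eq using q w K' \<epsilon> by (intro mult_nonneg_nonneg) auto
  have "real L / (real L - 1) * K ?x ?y ?z * \<epsilon> * w \<le> 2 * (C\<^sub>K * (1 + ?x) * (1 + ?y) * \<phi> ?z) * \<epsilon> * (c ?x * c ?y)"
    using q w wle K' \<epsilon> C\<^sub>K kx \<phi>' by (intro mult_mono mult_nonneg_nonneg) auto
  then have "real L * (real L / (real L - 1) * K ?x ?y ?z * \<epsilon> * w) \<le>
      real L * (2 * (C\<^sub>K * (1 + ?x) * (1 + ?y) * \<phi> ?z) * \<epsilon> * (c ?x * c ?y))" by (intro mult_left_mono) auto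
  then show "jump_rate K L \<epsilon> c (k, l, m) \<le> real L * (2 * C\<^sub>K * ((1 + ?x) * c ?x) * ((1 + ?y) * c ?y) * (\<epsilon> * \<phi> ?z))"
    unfolding eq by (simp only: mult_ac)
  assume "jump_rate K L \<epsilon> c (k, l, m) \<noteq> 0"
  then have "w \<noteq> 0" unfolding eq by auto
  then show "jump_target L \<epsilon> c (k, l, m) \<in> states N L \<epsilon>"
    unfolding jump_target_def prod.case w_def by (intro states_closed[OF c L \<epsilon>] jumps_grid[OF j])
qed

text \<open>Common core of the two moment assumptions. The weight \<psi> majorises
  \<open>z * \<phi> z\<close> for displacements and enters the growth bound on \<open>f\<close>;
  \<open>D\<close> bounds its Riemann sums uniformly.\<close>

theorem particle_systems_tight:
  fixes N L :: "nat \<Rightarrow> nat"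
  assumes kernel: "existence_kernel K \<phi>"
    and L: "\<And>n. 2 \<le> L n" and \<epsilon>: "\<And>n. 0 < \<epsilon> n"
    and \<rho>: "\<And>n. real (N n) * \<epsilon> n / real (L n) \<le> \<rho>"
    and law: "\<And>n. markov_jump_law (P_le \<rho>) W1 (states (N n) (L n) (\<epsilon> n)) as_measure
                (gen K (N n) (L n) (\<epsilon> n)) (P n)"
    and D: "\<And>n. (\<Sum>m=1..N n. \<epsilon> n * \<psi> (real m * \<epsilon> n)) \<le> D"
    and \<psi>: "\<And>z. 0 \<le> z \<Longrightarrow> z * \<phi> z \<le> \<psi> z"
    and f: "continuous_on {0..} f" "\<And>x. 0 \<le> x \<Longrightarrow> 0 \<le> f x" "\<And>B. \<exists>a\<ge>0. \<forall>x\<ge>a. B * x \<le> f x"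
    and B: "0 \<le> B" "\<And>x y z. 0 \<le> y \<Longrightarrow> 0 < z \<Longrightarrow> z \<le> x \<Longrightarrow>
      \<phi> z * ((1 + y) * max 0 (f (x - z) - f x + f (y + z) - f y)) \<le> B * ((1 + y + f y) * \<psi> z)"
    and init: "(SUP n. \<integral>\<^sup>+\<omega>. moment f (\<omega> 0) \<partial>P n) < \<infinity>"
  shows "tight_family (skorokhod_topology (P_le \<rho>) W1) P"
proof -
  note k = kernel[unfolded existence_kernel_def]
  have K0: "\<And>x y z. 0 < x \<Longrightarrow> 0 \<le> y \<Longrightarrow> 0 \<le> z \<Longrightarrow> 0 \<le> K x y z" and \<phi>0: "\<And>z. 0 \<le> z \<Longrightarrow> 0 \<le> \<phi> z"
    using k by simp_all
  from k obtain C where "\<forall>x>0. \<forall>y\<ge>0. \<forall>z\<ge>0. K x y z \<le> C * (1 + x) * (1 + y) * \<phi> z"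
    by (elim conjE exE)
  then have C': "\<And>x y z. 0 < x \<Longrightarrow> 0 \<le> y \<Longrightarrow> 0 \<le> z \<Longrightarrow> K x y z \<le> C * (1 + x) * (1 + y) * \<phi> z"
    by simp
  \<comment> \<open>The kernel constant is not known to be nonnegative; its absolute value is a
    valid replacement.\<close>
  define C\<^sub>K where "C\<^sub>K = \<bar>C\<bar>"
  have K: "0 \<le> K x y z \<and> K x y z \<le> C\<^sub>K * (1 + x) * (1 + y) * \<phi> z" if "0 < x" "0 \<le> y" "0 \<le> z" for x y z
  proof -
    have "C * ((1 + x) * (1 + y) * \<phi> z) \<le> C\<^sub>K * ((1 + x) * (1 + y) * \<phi> z)"
      using that \<phi>0 by (intro mult_right_mono mult_nonneg_nonneg) (auto simp: C\<^sub>K_def)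
    then show ?thesis using C'[OF that] K0[OF that] by (simp add: mult.assoc)
  qed
  then have KA: "\<forall>x>0. \<forall>y\<ge>0. \<forall>z\<ge>0. 0 \<le> K x y z \<and> K x y z \<le> C\<^sub>K * (1 + x) * (1 + y) * \<phi> z" by blast
  have \<phi>A: "\<forall>z\<ge>0. 0 \<le> \<phi> z" using \<phi>0 by blast
  have CK0: "0 \<le> C\<^sub>K" by (simp add: C\<^sub>K_def)
  have L0: "0 < L n" for n using L[of n] by simp
  have \<rho>0: "0 \<le> \<rho>"
  proof -
    have "0 \<le> real (N 0) * \<epsilon> 0 / real (L 0)" using \<epsilon>[of 0] by simp
    then show ?thesis using \<rho>[of 0] by linarith
  qed
  have \<psi>0: "0 \<le> \<psi> z" if "0 \<le> z" for z
    using \<psi>[OF that] mult_nonneg_nonneg[OF that \<phi>0[OF that]] by linarith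
  have D0: "0 \<le> D"
  proof -
    have "0 \<le> (\<Sum>m=1..N 0. \<epsilon> 0 * \<psi> (real m * \<epsilon> 0))"
      using \<epsilon>[of 0] by (intro sum_nonneg mult_nonneg_nonneg \<psi>0) auto
    then show ?thesis using D[of 0] by linarith
  qed
  let ?S = "\<lambda>n. states (N n) (L n) (\<epsilon> n)"
  let ?r = "\<lambda>n. jump_rate K (L n) (\<epsilon> n)" and ?\<tau> = "\<lambda>n. jump_target (L n) (\<epsilon> n)"
  define F where "F = state_sum f"
  have F: "F c = (\<Sum>x\<in>cluster_grid (N n) (\<epsilon> n). c x * f x)" if "c \<in> ?S n" for n c
    unfolding F_def by (rule state_sum_grid[OF that L0 \<epsilon>])
  have gnn: "0 \<le> x" if "x \<in> cluster_grid (N n) (\<epsilon> n)" for x n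
    using that \<epsilon>[of n] by (auto simp: cluster_grid_def)
  have F0: "0 \<le> F c" if "c \<in> ?S n" for n c
    unfolding F[OF that] using state_nonneg[OF that L0 \<epsilon>] f(2) gnn by (intro sum_nonneg mult_nonneg_nonneg) auto
  have mass1: "(\<Sum>k\<le>N n. (1 + real k * \<epsilon> n) * c (real k * \<epsilon> n)) \<le> 1 + \<rho>" if c: "c \<in> ?S n" for n c
  proof -
    have "(\<Sum>k\<le>N n. (1 + real k * \<epsilon> n) * c (real k * \<epsilon> n)) = (\<Sum>x\<in>cluster_grid (N n) (\<epsilon> n). (1 + x) * c x)"
      by (rule sum_cluster_grid[OF \<epsilon>, symmetric])
    also have "\<dots> = (\<Sum>x\<in>cluster_grid (N n) (\<epsilon> n). c x) + (\<Sum>x\<in>cluster_grid (N n) (\<epsilon> n). c x * x)"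
      by (simp add: sum.distrib[symmetric] algebra_simps)
    also have "\<dots> \<le> 1 + \<rho>" using state_mass[OF c L0 \<epsilon>] state_mean[OF c L0 \<epsilon>] \<rho>[of n] by simp
    finally show ?thesis .
  qed
  have mass2: "(\<Sum>l\<le>N n. (1 + real l * \<epsilon> n + f (real l * \<epsilon> n)) * c (real l * \<epsilon> n)) \<le> 1 + \<rho> + F c" if c: "c \<in> ?S n" for n c
  proof -
    have "(\<Sum>x\<in>cluster_grid (N n) (\<epsilon> n). c x * f x) = (\<Sum>l\<le>N n. c (real l * \<epsilon> n) * f (real l * \<epsilon> n))"
      by (rule sum_cluster_grid[OF \<epsilon>])
    moreover have "(\<Sum>l\<le>N n. (1 + real l * \<epsilon> n + f (real l * \<epsilon> n)) * c (real l * \<epsilon> n)) =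
        (\<Sum>k\<le>N n. (1 + real k * \<epsilon> n) * c (real k * \<epsilon> n)) + (\<Sum>l\<le>N n. c (real l * \<epsilon> n) * f (real l * \<epsilon> n))"
      by (simp add: sum.distrib[symmetric] algebra_simps)
    ultimately show ?thesis using mass1[OF c] F[OF c] by linarith
  qed
  have mass_nn: "0 \<le> (1 + real k * \<epsilon> n) * c (real k * \<epsilon> n)" "0 \<le> (1 + real k * \<epsilon> n + f (real k * \<epsilon> n)) * c (real k * \<epsilon> n)"
    if c: "c \<in> ?S n" for n c and k :: nat
    using state_nonneg[OF c L0 \<epsilon>] f(2)[of "real k * \<epsilon> n"] \<epsilon>[of n] by (auto intro!: mult_nonneg_nonneg)
  have f_meas: "f \<in> borel_measurable borel_nonneg" by (rule borel_measurable_continuous_on_restrict[OF f(1)])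
  have mom: "moment f (as_measure c) = ennreal (F c)" if c: "c \<in> ?S n" for n c
    unfolding moment_def F[OF c] by (rule nn_integral_as_measure_real[OF c L0 \<epsilon> f_meas f(2)])
  show ?thesis
  \<comment> \<open>In \<open>C\<close>, one factor 2 comes from the normalisation of the rates and
    one from the displacement \<open>2 * z / L\<close>. The squares of \<open>1 + \<rho>\<close>
    arise from the \<open>(1 + x)\<close>-mass of a state, used twice for \<open>C\<close>; for
    \<open>A\<close> it is used once and the second factor comes from
    \<open>1 + \<rho> + F c \<le> (1 + \<rho>) * (1 + F c)\<close>.\<close>
  proof (rule jump_processes_tight[where S = ?S and emb = as_measure and J = "\<lambda>n. jumps (N n)" and r = ?r
        and \<tau> = ?\<tau> and Q = "\<lambda>n. gen K (N n) (L n) (\<epsilon> n)" and F = F and \<Phi> = "moment f"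
        and C = "4 * C\<^sub>K * (1 + \<rho>)\<^sup>2 * D" and A = "2 * C\<^sub>K * B * D * (1 + \<rho>)\<^sup>2"])
    fix n
    show "jump_process (P_le \<rho>) W1 (?S n) as_measure (jumps (N n)) (?r n) (?\<tau> n) (gen K (N n) (L n) (\<epsilon> n)) (P n)"
    proof (intro jump_process.intro Metric_space_W1 jump_process_axioms.intro)
      show "as_measure ` ?S n \<subseteq> P_le \<rho>" using as_measure_P_le[OF _ L0 \<epsilon> \<rho>] by blast
      fix c j assume c: "c \<in> ?S n" and j: "j \<in> jumps (N n)"
      obtain k l m where klm: "j = (k, l, m)" by (cases j)
      show "0 \<le> ?r n c j" unfolding klm by (rule jump_rate_bounds(1)[OF KA \<phi>A CK0 c L \<epsilon> j[unfolded klm]])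
      show "?r n c j \<noteq> 0 \<Longrightarrow> ?\<tau> n c j \<in> ?S n"
        unfolding klm by (rule jump_rate_bounds(3)[OF KA \<phi>A CK0 c L \<epsilon> j[unfolded klm]])
    qed (auto simp: finite_states inj_as_measure[OF L0 \<epsilon>] gen_eq law)
  next
    fix n c assume c: "c \<in> ?S n"
    let ?a = "\<lambda>k. 4 * C\<^sub>K * ((1 + real k * \<epsilon> n) * c (real k * \<epsilon> n))"
    let ?b = "\<lambda>l. (1 + real l * \<epsilon> n) * c (real l * \<epsilon> n)"
    let ?e = "\<lambda>m. \<epsilon> n * \<psi> (real m * \<epsilon> n)"
    have ennn: "0 \<le> ?e m" for m using \<epsilon>[of n] by (intro mult_nonneg_nonneg \<psi>0) auto
    have "(\<Sum>j\<in>jumps (N n). ?r n c j * W1 (as_measure c) (as_measure (?\<tau> n c j))) \<le>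
        (\<Sum>k\<le>N n. ?a k) * (\<Sum>l\<le>N n. ?b l) * (\<Sum>m=1..N n. ?e m)"
    proof (rule sum_jumps_le)
      fix k l m assume j: "(k, l, m) \<in> jumps (N n)"
      note rb = jump_rate_bounds[OF KA \<phi>A CK0 c L \<epsilon> j]
      let ?z = "real m * \<epsilon> n"
      have z: "0 \<le> ?z" using \<epsilon>[of n] by simp
      show "?r n c (k, l, m) * W1 (as_measure c) (as_measure (?\<tau> n c (k, l, m))) \<le> ?a k * ?b l * ?e m"
      proof (cases "?r n c (k, l, m) = 0")
        case True
        then show ?thesis using mass_nn(1)[OF c, of k] mass_nn(1)[OF c, of l] ennn[of m] CK0
          by (auto intro!: mult_nonneg_nonneg)
      next
        case False
        have "W1 (as_measure c) (as_measure (?\<tau> n c (k, l, m))) \<le> 2 * ?z / real (L n)"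
          using rb(3)[OF False] unfolding jump_target_def prod.case
          by (intro W1_jump_le[OF c _ L0 \<epsilon> z] jumps_grid[OF j])
        then have "?r n c (k, l, m) * W1 (as_measure c) (as_measure (?\<tau> n c (k, l, m))) \<le>
            (real (L n) * (2 * C\<^sub>K * ((1 + real k * \<epsilon> n) * c (real k * \<epsilon> n)) * ?b l * (\<epsilon> n * \<phi> ?z))) * (2 * ?z / real (L n))"
          by (rule mult_mono[OF rb(2) _ order_trans[OF rb(1) rb(2)] W1_nonneg])
        also have "\<dots> = ?a k * ?b l * (\<epsilon> n * (?z * \<phi> ?z))"
          using L0[of n] by (simp add: field_simps)
        also have "\<dots> \<le> ?a k * ?b l * ?e m"
          using state_nonneg[OF c L0 \<epsilon>] CK0 \<epsilon>[of n] \<psi>[OF z]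
          by (intro mult_left_mono mult_nonneg_nonneg) auto
        finally show ?thesis .
      qed
    qed (use mass_nn(1)[OF c] ennn CK0 in auto)
    also have "\<dots> \<le> (4 * C\<^sub>K * (1 + \<rho>)) * (1 + \<rho>) * D"
    proof (rule mult_mono[OF mult_mono[OF _ mass1[OF c]] D])
      show "(\<Sum>k\<le>N n. ?a k) \<le> 4 * C\<^sub>K * (1 + \<rho>)"
        unfolding sum_distrib_left[symmetric] using mass1[OF c] CK0 by (intro mult_left_mono) auto
      show "0 \<le> (\<Sum>l\<le>N n. ?b l)" "0 \<le> (\<Sum>m=1..N n. ?e m)"
        by (intro sum_nonneg mass_nn(1)[OF c] ennn)+
    qed (use CK0 \<rho>0 in auto)
    finally show "(\<Sum>j\<in>jumps (N n). ?r n c j * W1 (as_measure c) (as_measure (?\<tau> n c j))) \<le> 4 * C\<^sub>K * (1 + \<rho>)\<^sup>2 * D"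
      by (simp add: power2_eq_square mult.assoc)
  next
    fix n c assume c: "c \<in> ?S n"
    show "0 \<le> F c" by (rule F0[OF c])
    show "moment f (as_measure c) = ennreal (F c)" by (rule mom[OF c])
    let ?a = "\<lambda>k. 2 * C\<^sub>K * B * ((1 + real k * \<epsilon> n) * c (real k * \<epsilon> n))"
    let ?b = "\<lambda>l. (1 + real l * \<epsilon> n + f (real l * \<epsilon> n)) * c (real l * \<epsilon> n)"
    let ?e = "\<lambda>m. \<epsilon> n * \<psi> (real m * \<epsilon> n)"
    have ennn: "0 \<le> ?e m" for m using \<epsilon>[of n] by (intro mult_nonneg_nonneg \<psi>0) auto
    have "(\<Sum>j\<in>jumps (N n). ?r n c j * max 0 (F (?\<tau> n c j) - F c)) \<le>
        (\<Sum>k\<le>N n. ?a k) * (\<Sum>l\<le>N n. ?b l) * (\<Sum>m=1..N n. ?e m)"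
    proof (rule sum_jumps_le)
      fix k l m assume j: "(k, l, m) \<in> jumps (N n)"
      note rb = jump_rate_bounds[OF KA \<phi>A CK0 c L \<epsilon> j]
      let ?x = "real k * \<epsilon> n" and ?y = "real l * \<epsilon> n" and ?z = "real m * \<epsilon> n"
      have z: "0 < ?z" "0 \<le> ?y" "?z \<le> ?x" using \<epsilon>[of n] j by (auto simp: jumps_def)
      show "?r n c (k, l, m) * max 0 (F (?\<tau> n c (k, l, m)) - F c) \<le> ?a k * ?b l * ?e m"
      proof (cases "?r n c (k, l, m) = 0")
        case True
        then show ?thesis using mass_nn(1)[OF c, of k] mass_nn(2)[OF c, of l] ennn[of m] CK0 B(1)
          by (auto intro!: mult_nonneg_nonneg)
      next
        case False
        let ?g = "f (?x - ?z) - f ?x + f (?y + ?z) - f ?y"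
        have "F (?\<tau> n c (k, l, m)) = F c + ?g / real (L n)"
          unfolding F[OF rb(3)[OF False]] F[OF c] unfolding jump_target_def prod.case
          by (rule sum_jump[OF finite_cluster_grid jumps_grid(1,3,2,4)[OF j]])
        then have d: "F (?\<tau> n c (k, l, m)) - F c = ?g / real (L n)" by simp
        have "max 0 (t / real (L n)) = max 0 t / real (L n)" for t
          using L0[of n] by (simp add: max_def zero_le_divide_iff)
        then have "max 0 (F (?\<tau> n c (k, l, m)) - F c) = max 0 ?g / real (L n)" unfolding d .
        then have "?r n c (k, l, m) * max 0 (F (?\<tau> n c (k, l, m)) - F c) \<le>
            (real (L n) * (2 * C\<^sub>K * ((1 + ?x) * c ?x) * ((1 + ?y) * c ?y) * (\<epsilon> n * \<phi> ?z))) * (max 0 ?g / real (L n))"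
          using mult_mono[OF rb(2) order.refl order_trans[OF rb(1) rb(2)], of "max 0 ?g / real (L n)"] by simp
        also have "\<dots> = 2 * C\<^sub>K * ((1 + ?x) * c ?x) * c ?y * \<epsilon> n * (\<phi> ?z * ((1 + ?y) * max 0 ?g))"
          using L0[of n] by (simp add: field_simps)
        also have "\<dots> \<le> 2 * C\<^sub>K * ((1 + ?x) * c ?x) * c ?y * \<epsilon> n * (B * ((1 + ?y + f ?y) * \<psi> ?z))"
          using mass_nn(1)[OF c, of k] state_nonneg[OF c L0 \<epsilon>] CK0 \<epsilon>[of n] B(2)[OF z(2,1,3)]
          by (intro mult_left_mono mult_nonneg_nonneg) auto
        also have "\<dots> = ?a k * ?b l * ?e m" by (simp only: mult_ac)
        finally show ?thesis .
      qed
    qed (use mass_nn[OF c] ennn CK0 B(1) in auto)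
    also have "\<dots> \<le> (2 * C\<^sub>K * B * (1 + \<rho>)) * (1 + \<rho> + F c) * D"
    proof (rule mult_mono[OF mult_mono[OF _ mass2[OF c]] D])
      show "(\<Sum>k\<le>N n. ?a k) \<le> 2 * C\<^sub>K * B * (1 + \<rho>)"
        unfolding sum_distrib_left[symmetric] using mass1[OF c] CK0 B(1) by (intro mult_left_mono) auto
      show "0 \<le> (\<Sum>l\<le>N n. ?b l)" "0 \<le> (\<Sum>m=1..N n. ?e m)"
        by (intro sum_nonneg mass_nn(2)[OF c] ennn)+
    qed (use CK0 B(1) \<rho>0 F0[OF c] in auto)
    also have "\<dots> \<le> (2 * C\<^sub>K * B * (1 + \<rho>)) * ((1 + \<rho>) * (1 + F c)) * D"
    proof (intro mult_right_mono mult_left_mono D0)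
      show "1 + \<rho> + F c \<le> (1 + \<rho>) * (1 + F c)" using mult_nonneg_nonneg[OF \<rho>0 F0[OF c]] by (simp add: algebra_simps)
    qed (use CK0 B(1) \<rho>0 in auto)
    finally show "(\<Sum>j\<in>jumps (N n). ?r n c j * max 0 (F (?\<tau> n c j) - F c)) \<le> 2 * C\<^sub>K * B * D * (1 + \<rho>)\<^sup>2 * (1 + F c)"
      by (simp add: power2_eq_square mult_ac)
  next
    show "0 \<le> 2 * C\<^sub>K * B * D * (1 + \<rho>)\<^sup>2" using CK0 B(1) D0 by simp
    show "(SUP n. \<integral>\<^sup>+\<omega>. moment f (\<omega> 0) \<partial>P n) < \<infinity>" by (rule init)
    fix R :: real assume "0 < R"
    then obtain KK where KK: "compactin (Metric_space.mtopology (P_le \<rho>) W1) KK"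
      "{\<mu> \<in> P_le \<rho>. moment f \<mu> \<le> ennreal R} \<subseteq> KK"
      using superlinear_moment_compact[OF \<rho>0 _ f(3), of R] by auto
    have "as_measure c \<in> KK" if "c \<in> ?S n" "F c \<le> R" for n c
      using KK(2) as_measure_P_le[OF that(1) L0 \<epsilon> \<rho>] mom[OF that(1)] that(2) by (auto simp: ennreal_leI)
    then show "\<exists>K. compactin (Metric_space.mtopology (P_le \<rho>) W1) K \<and> (\<forall>n. \<forall>c\<in>?S n. F c \<le> R \<longrightarrow> as_measure c \<in> K)"
      using KK(1) by blast
  qed
qed

section \<open>Admissible moments\<close>

lemma mean_value_half_line:
  fixes f g :: "real \<Rightarrow> real"
  assumes "\<forall>x\<ge>0. (f has_real_derivative g x) (at x within {0..})" "0 \<le> a" "a < b"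
  obtains t where "a < t" "t < b" "f b - f a = g t * (b - a)"
proof -
  have cont: "continuous_on {a..b} f"
  proof (rule continuous_on_subset)
    show "continuous_on {0..} f" by (rule DERIV_continuous_on[of _ f g]) (use assms(1) in auto)
  qed (use assms(2) in auto)
  have "(f has_derivative (*) (g x)) (at x)" if "a < x" "x < b" for x
  proof -
    have "at x within {0..} = at x" using that assms by (intro at_within_interior) auto
    moreover have "(f has_real_derivative g x) (at x within {0..})" using assms(1,2) that by simp
    ultimately show ?thesis by (simp add: has_field_derivative_def)
  qed
  from mvt[OF assms(3) cont this] show ?thesis using that by blast
qed

text \<open>For the last bound, the donor's change \<open>f (x - z) - f x\<close> is at most 0 by
  monotonicity. The receiver's gain is at most \<open>z * f' (y + z)\<close> by the mean value
  theorem; the first growth condition separates \<open>y\<close> from \<open>z\<close>, and the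
  second turns \<open>(1 + y) * f' y\<close> and \<open>z * f' z\<close> into moments of
  \<open>f\<close>.\<close>

lemma admissible_properties:
  assumes "f \<in> admissible" and \<phi>: "\<forall>z\<ge>0. 0 \<le> \<phi> z"
  shows "continuous_on {0..} f" "0 \<le> x \<Longrightarrow> 0 \<le> f x" "\<exists>a\<ge>0. \<forall>x\<ge>a. B * x \<le> f x"
    "\<exists>B\<ge>0. \<forall>x y z. 0 \<le> y \<longrightarrow> 0 < z \<longrightarrow> z \<le> x \<longrightarrow>
      \<phi> z * ((1 + y) * max 0 (f (x - z) - f x + f (y + z) - f y)) \<le> B * ((1 + y + f y) * ((1 + z + f z) * \<phi> z))"
proof -
  have lim: "filterlim (deriv f) at_top at_top" and adm0: "f \<in> admissible0"
    using assms(1) by (simp_all add: admissible_def)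
  from adm0 obtain f' f'' where f':
     "(\<forall>x\<ge>0. (f has_real_derivative f' x) (at x within {0..})) \<and>
     (\<forall>x\<ge>0. (f' has_real_derivative f'' x) (at x within {0..})) \<and>
     continuous_on {0..} f'' \<and>
     (\<forall>x\<ge>0. 0 \<le> f x \<and> 0 \<le> f' x \<and> 0 \<le> f'' x) \<and>
     (\<exists>C\<^sub>1\<ge>0. \<forall>x\<ge>0. \<forall>z\<ge>0. f' (x + z) \<le> C\<^sub>1 * (f' x + f' z)) \<and>
     (\<exists>C\<^sub>2\<ge>0. \<forall>x\<ge>0. f' x \<le> C\<^sub>2 * (1 + f x / (1 + x)))"
    unfolding admissible0_def mem_Collect_eq by (elim exE)
  then have D1: "\<forall>x\<ge>0. (f has_real_derivative f' x) (at x within {0..})"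
    and D2: "\<forall>x\<ge>0. (f' has_real_derivative f'' x) (at x within {0..})"
    and d1: "\<And>x. 0 \<le> x \<Longrightarrow> (f has_real_derivative f' x) (at x within {0..})"
    and nn: "\<And>x. 0 \<le> x \<Longrightarrow> 0 \<le> f x \<and> 0 \<le> f' x \<and> 0 \<le> f'' x" by simp_all
  from f' have "\<exists>C\<^sub>1\<ge>0. \<forall>x\<ge>0. \<forall>z\<ge>0. f' (x + z) \<le> C\<^sub>1 * (f' x + f' z)" by (elim conjE)
  then obtain C\<^sub>1 where "0 \<le> C\<^sub>1 \<and> (\<forall>x\<ge>0. \<forall>z\<ge>0. f' (x + z) \<le> C\<^sub>1 * (f' x + f' z))" by (elim exE)
  then have C1: "0 \<le> C\<^sub>1" "\<And>x z. 0 \<le> x \<Longrightarrow> 0 \<le> z \<Longrightarrow> f' (x + z) \<le> C\<^sub>1 * (f' x + f' z)" by simp_all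
  from f' have "\<exists>C\<^sub>2\<ge>0. \<forall>x\<ge>0. f' x \<le> C\<^sub>2 * (1 + f x / (1 + x))" by (elim conjE)
  then obtain C\<^sub>2 where "0 \<le> C\<^sub>2 \<and> (\<forall>x\<ge>0. f' x \<le> C\<^sub>2 * (1 + f x / (1 + x)))" by (elim exE)
  then have C2: "0 \<le> C\<^sub>2" "\<And>x. 0 \<le> x \<Longrightarrow> f' x \<le> C\<^sub>2 * (1 + f x / (1 + x))" by simp_all
  show "continuous_on {0..} f" using d1 by (intro DERIV_continuous_on) auto
  show "0 \<le> x \<Longrightarrow> 0 \<le> f x" using nn by blast
  have mono: "f a \<le> f b" if "0 \<le> a" "a \<le> b" for a b
  proof (cases "a = b")
    case False
    then have ab: "a < b" using that by simp
    obtain t where "a < t" "t < b" "f b - f a = f' t * (b - a)"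
      by (rule mean_value_half_line[OF D1 \<open>0 \<le> a\<close> ab])
    moreover have "0 \<le> f' t * (b - a)" using nn[of t] that \<open>a < t\<close> by auto
    ultimately show ?thesis by linarith
  qed simp
  have mono': "f' a \<le> f' b" if "0 \<le> a" "a \<le> b" for a b
  proof (cases "a = b")
    case False
    then have ab: "a < b" using that by simp
    obtain t where "a < t" "t < b" "f' b - f' a = f'' t * (b - a)"
      by (rule mean_value_half_line[OF D2 \<open>0 \<le> a\<close> ab])
    moreover have "0 \<le> f'' t * (b - a)" using nn[of t] that \<open>a < t\<close> by auto
    ultimately show ?thesis by linarith
  qed simp
  show "\<exists>a\<ge>0. \<forall>x\<ge>a. B * x \<le> f x"
  proof -
    define b where "b = max B 0"
    \<comment> \<open>The slope is doubled because the estimate starts at \<open>a\<close>: for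
      \<open>x \<ge> 2 * a\<close> the length \<open>x - a\<close> is at least half of
      \<open>x\<close>.\<close>
    obtain a0 where a0: "\<And>x. a0 \<le> x \<Longrightarrow> 2 * b \<le> deriv f x"
      using lim unfolding filterlim_at_top eventually_at_top_linorder by blast
    define a where "a = max a0 1"
    have a: "0 < a" "a0 \<le> a" by (auto simp: a_def)
    have "B * x \<le> f x" if x: "2 * a \<le> x" for x
    proof -
      have ax: "0 \<le> a" "a < x" using a x by auto
      obtain t where t: "a < t" "t < x" "f x - f a = f' t * (x - a)"
        by (rule mean_value_half_line[OF D1 ax])
      have "at t within {0..} = at t" using t a by (intro at_within_interior) auto
      then have "deriv f t = f' t" using d1[of t] t a by (auto intro!: DERIV_imp_deriv)
      then have "2 * b \<le> f' t" using a0[of t] t a by simp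
      then have "2 * b * (x - a) \<le> f' t * (x - a)" using t by (intro mult_right_mono) auto
      then have "2 * b * (x - a) \<le> f x" using t(3) nn[of a] a by linarith
      moreover have "b * x \<le> b * (2 * (x - a))" using x by (intro mult_left_mono) (auto simp: b_def)
      moreover have "b * (2 * (x - a)) = 2 * b * (x - a)" by simp
      moreover have "B * x \<le> b * x" using x a by (intro mult_right_mono) (auto simp: b_def)
      ultimately show ?thesis by linarith
    qed
    then show ?thesis using a by (intro exI[of _ "2 * a"]) auto
  qed
  show "\<exists>B\<ge>0. \<forall>x y z. 0 \<le> y \<longrightarrow> 0 < z \<longrightarrow> z \<le> x \<longrightarrow>
      \<phi> z * ((1 + y) * max 0 (f (x - z) - f x + f (y + z) - f y)) \<le> B * ((1 + y + f y) * ((1 + z + f z) * \<phi> z))"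
  \<comment> \<open>The 2 comes from the two products that remain, each bounded by
    \<open>(1 + y + f y) * (1 + z + f z)\<close>.\<close>
  proof (intro exI[of _ "2 * C\<^sub>1 * C\<^sub>2"] conjI allI impI)
    show "0 \<le> 2 * C\<^sub>1 * C\<^sub>2" using C1 C2 by simp
    fix x y z :: real assume y: "0 \<le> y" and z: "0 < z" "z \<le> x"
    have z0: "0 \<le> z" using z by simp
    have fy: "0 \<le> f y" "0 \<le> f z" "0 \<le> f' y" "0 \<le> f' z" using nn y z by auto
    have "f (x - z) \<le> f x" using z by (intro mono) auto
    moreover have "f (y + z) - f y \<le> z * (C\<^sub>1 * (f' y + f' z))"
    proof -
      have yz: "y < y + z" using z by simp
      obtain t where t: "y < t" "t < y + z" "f (y + z) - f y = f' t * (y + z - y)"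
        by (rule mean_value_half_line[OF D1 y yz])
      have "f' t \<le> f' (y + z)" using t y by (intro mono') auto
      also have "\<dots> \<le> C\<^sub>1 * (f' y + f' z)" using C1(2) y z0 by blast
      finally have "z * f' t \<le> z * (C\<^sub>1 * (f' y + f' z))" using z0 by (intro mult_left_mono)
      then show ?thesis using t(3) by (simp add: mult.commute)
    qed
    moreover have "0 \<le> z * (C\<^sub>1 * (f' y + f' z))" using z0 C1 fy by (intro mult_nonneg_nonneg) auto
    ultimately have m: "max 0 (f (x - z) - f x + f (y + z) - f y) \<le> z * (C\<^sub>1 * (f' y + f' z))" by simp
    have g1: "(1 + y) * f' y \<le> C\<^sub>2 * (1 + y + f y)"
    proof -
      have "(1 + y) * f' y \<le> (1 + y) * (C\<^sub>2 * (1 + f y / (1 + y)))" using C2(2)[OF y] y by (intro mult_left_mono) auto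
      also have "\<dots> = C\<^sub>2 * (1 + y + f y)" using y by (simp add: field_simps)
      finally show ?thesis .
    qed
    have g2: "z * f' z \<le> C\<^sub>2 * (z + f z)"
    proof -
      have "z * f' z \<le> z * (C\<^sub>2 * (1 + f z / (1 + z)))" using C2(2)[OF z0] z0 by (intro mult_left_mono) auto
      also have "\<dots> = C\<^sub>2 * (z + f z * (z / (1 + z)))" by (simp add: algebra_simps)
      also have "\<dots> \<le> C\<^sub>2 * (z + f z * 1)"
        using C2(1) fy z0 by (intro mult_left_mono add_left_mono) auto
      finally show ?thesis by simp
    qed
    have p: "0 \<le> \<phi> z" using \<phi> z0 by simp
    have "\<phi> z * ((1 + y) * max 0 (f (x - z) - f x + f (y + z) - f y)) \<le> \<phi> z * ((1 + y) * (z * (C\<^sub>1 * (f' y + f' z))))"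
      using m p y by (intro mult_left_mono) auto
    also have "\<dots> = C\<^sub>1 * \<phi> z * (z * ((1 + y) * f' y) + (1 + y) * (z * f' z))" by (simp add: algebra_simps)
    also have "\<dots> \<le> C\<^sub>1 * \<phi> z * (z * (C\<^sub>2 * (1 + y + f y)) + (1 + y) * (C\<^sub>2 * (z + f z)))"
      using C1(1) p z0 y g1 g2 by (intro mult_left_mono add_mono mult_nonneg_nonneg) auto
    also have "\<dots> = C\<^sub>1 * C\<^sub>2 * \<phi> z * (z * (1 + y + f y) + (1 + y) * (z + f z))" by (simp add: algebra_simps)
    also have "\<dots> \<le> C\<^sub>1 * C\<^sub>2 * \<phi> z * ((1 + z + f z) * (1 + y + f y) + (1 + y + f y) * (1 + z + f z))"
    proof (intro mult_left_mono[OF add_mono])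
      show "z * (1 + y + f y) \<le> (1 + z + f z) * (1 + y + f y)" using y fy by (intro mult_right_mono) auto
      show "(1 + y) * (z + f z) \<le> (1 + y + f y) * (1 + z + f z)" using y z0 fy by (intro mult_mono) auto
    qed (use C1(1) C2(1) p in simp)
    also have "\<dots> = 2 * C\<^sub>1 * C\<^sub>2 * ((1 + y + f y) * ((1 + z + f z) * \<phi> z))" by (simp add: algebra_simps)
    finally show "\<phi> z * ((1 + y) * max 0 (f (x - z) - f x + f (y + z) - f y)) \<le>
        2 * C\<^sub>1 * C\<^sub>2 * ((1 + y + f y) * ((1 + z + f z) * \<phi> z))" .
  qed
qed

text \<open>The receiver gains \<open>2 * z * y + z\<^sup>2\<close> and the donor changes by
  \<open>z\<^sup>2 - 2 * z * x\<close>. Since \<open>z \<le> x\<close>, the quadratic terms in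
  \<open>z\<close> are absorbed and \<open>2 * z * y\<close> remains; hence the weight
  \<open>(1 + z) * \<phi> z\<close> suffices for second moments.\<close>

lemma square_properties:
  fixes x y z :: real
  assumes \<phi>: "0 \<le> \<phi> z" and y: "0 \<le> y" and z: "0 < z" "z \<le> x"
  shows "\<phi> z * ((1 + y) * max 0 ((x - z)\<^sup>2 - x\<^sup>2 + (y + z)\<^sup>2 - y\<^sup>2)) \<le> 2 * ((1 + y + y\<^sup>2) * ((1 + z) * \<phi> z))"
proof -
  have "(x - z)\<^sup>2 - x\<^sup>2 + (y + z)\<^sup>2 - y\<^sup>2 = 2 * z * y + 2 * z * (z - x)"
    by (simp add: power2_eq_square algebra_simps)
  moreover have "2 * z * (z - x) \<le> 0" using z by (simp add: mult_nonneg_nonpos)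
  moreover have "0 \<le> 2 * z * y" using y z by simp
  ultimately have "max 0 ((x - z)\<^sup>2 - x\<^sup>2 + (y + z)\<^sup>2 - y\<^sup>2) \<le> 2 * z * y" by simp
  then have "\<phi> z * ((1 + y) * max 0 ((x - z)\<^sup>2 - x\<^sup>2 + (y + z)\<^sup>2 - y\<^sup>2)) \<le> \<phi> z * ((1 + y) * (2 * z * y))"
    using \<phi> y by (intro mult_left_mono) auto
  also have "\<dots> = 2 * \<phi> z * (z * (y + y\<^sup>2))" by (simp add: power2_eq_square algebra_simps)
  also have "\<dots> \<le> 2 * \<phi> z * ((1 + z) * (1 + y + y\<^sup>2))"
    using \<phi> y z by (intro mult_left_mono mult_mono) auto
  finally show ?thesis by (simp add: mult_ac)
qed

theorem proposition2p1:
  fixes K :: "real \<Rightarrow> real \<Rightarrow> real \<Rightarrow> real" and \<phi> :: "real \<Rightarrow> real"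
    and \<rho> \<rho>' :: real
    and N L :: "nat \<Rightarrow> nat" and \<epsilon> :: "nat \<Rightarrow> real"
    and P :: "nat \<Rightarrow> (real \<Rightarrow> real measure) measure"
  assumes kernel: "existence_kernel K \<phi>"
    and rho: "\<rho> \<ge> 0"
    and L_ge: "\<And>n. L n \<ge> 2"
    and eps_pos: "\<And>n. \<epsilon> n > 0"
    and N_lim: "filterlim N at_top sequentially"
    and L_lim: "filterlim L at_top sequentially"
    and eps_lim: "\<epsilon> \<longlonglongrightarrow> 0"
    and density_lim: "(\<lambda>n. real (N n) * \<epsilon> n / real (L n)) \<longlonglongrightarrow> \<rho>"
    and rho'_def: "\<rho>' = (SUP n. real (N n) * \<epsilon> n / real (L n))"
    and law: "\<And>n. markov_jump_law (P_le \<rho>') W1 (states (N n) (L n) (\<epsilon> n)) as_measure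
                (gen K (N n) (L n) (\<epsilon> n)) (P n)"
    and moments:
      "(SUP n. \<integral>\<^sup>+\<omega>. moment (\<lambda>x. x\<^sup>2) (\<omega> 0) \<partial>P n) < \<infinity> \<and>
       (\<lambda>n. real (L n) * max (modulus (\<lambda>x. (1 + x) * \<phi> x) (\<epsilon> n)) (kernel_modulus K (\<epsilon> n)))
         \<longlonglongrightarrow> 0
       \<or>
       (\<exists>f\<in>admissible.
          uniformly_continuous_on {0..} (\<lambda>x. f x * \<phi> x) \<and>
          set_integrable lborel {0..} (\<lambda>x. f x * \<phi> x) \<and>
          (SUP n. \<integral>\<^sup>+\<omega>. moment f (\<omega> 0) \<partial>P n) < \<infinity> \<and>
          (\<lambda>n. real (L n) *
             max (modulus (\<lambda>x. (1 + x + f x) * \<phi> x) (\<epsilon> n)) (kernel_modulus K (\<epsilon> n)))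
            \<longlonglongrightarrow> 0)"
  shows "tight_family (skorokhod_topology (P_le \<rho>') W1) P"
proof -
  \<comment> \<open>The supremum is taken in the reals; it is an upper bound because a convergent
    sequence is bounded.\<close>
  have \<rho>': "real (N n) * \<epsilon> n / real (L n) \<le> \<rho>'" for n
    unfolding rho'_def
    using convergent_imp_Bseq[OF convergentI[OF density_lim]]
    by (intro cSUP_upper) (auto simp: Bseq_eq_bounded bounded_imp_bdd_above)
  have \<rho>'0: "0 \<le> \<rho>'" using \<rho>'[of 0] eps_pos[of 0] by (smt (verit) divide_nonneg_nonneg mult_nonneg_nonneg of_nat_0_le_iff)
  have \<phi>: "\<And>z. 0 \<le> z \<Longrightarrow> 0 \<le> \<phi> z"
    "uniformly_continuous_on {0..} \<phi>" "set_integrable lborel {0..} \<phi>"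
    "uniformly_continuous_on {0..} (\<lambda>z. z * \<phi> z)" "set_integrable lborel {0..} (\<lambda>z. z * \<phi> z)"
    using kernel unfolding existence_kernel_def by simp_all
  have riemann: "\<exists>D. \<forall>n. (\<Sum>m=1..N n. \<epsilon> n * \<psi> (real m * \<epsilon> n)) \<le> D"
    if uc: "uniformly_continuous_on {0..} \<psi>" and int: "set_integrable lborel {0..} \<psi>"
      and nn: "\<And>x. 0 \<le> x \<Longrightarrow> 0 \<le> \<psi> x"
      and lim: "(\<lambda>n. real (L n) * max (modulus \<psi> (\<epsilon> n)) (kernel_modulus K (\<epsilon> n))) \<longlonglongrightarrow> 0" for \<psi>
  proof -
    obtain b where b: "\<And>n. \<bar>real (L n) * max (modulus \<psi> (\<epsilon> n)) (kernel_modulus K (\<epsilon> n))\<bar> \<le> b"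
      using convergent_imp_Bseq[OF convergentI[OF lim]] unfolding Bseq_def by auto
    have "(\<Sum>m=1..N n. \<epsilon> n * \<psi> (real m * \<epsilon> n)) \<le> (LINT u:{0..}|lborel. \<psi> u) + \<rho>' * b" for n
    proof -
      have "real (L n) * modulus \<psi> (\<epsilon> n) \<le> real (L n) * max (modulus \<psi> (\<epsilon> n)) (kernel_modulus K (\<epsilon> n))"
        by (intro mult_left_mono) auto
      then have Lb: "real (L n) * modulus \<psi> (\<epsilon> n) \<le> b" using b[of n] by linarith
      have m0: "0 \<le> modulus \<psi> (\<epsilon> n)" using modulus_upper[OF uc, of 0 0 "\<epsilon> n"] eps_pos[of n] by simp
      \<comment> \<open>The Riemann error is split into the density, at most \<rho>', and
        \<open>L\<close> times the modulus, at most \<open>b\<close>.\<close>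
      have "real (N n) * \<epsilon> n * modulus \<psi> (\<epsilon> n) = real (N n) * \<epsilon> n / real (L n) * (real (L n) * modulus \<psi> (\<epsilon> n))"
        using L_ge[of n] by simp
      also have "\<dots> \<le> \<rho>' * b" using \<rho>'[of n] Lb m0 \<rho>'0 by (intro mult_mono) auto
      finally have "real (N n) * \<epsilon> n * modulus \<psi> (\<epsilon> n) \<le> \<rho>' * b" .
      moreover have "(\<Sum>m=1..N n. \<epsilon> n * \<psi> (real m * \<epsilon> n)) \<le> (LINT u:{0..}|lborel. \<psi> u) + real (N n) * \<epsilon> n * modulus \<psi> (\<epsilon> n)"
        by (intro riemann_sum_le uc int eps_pos nn)
      ultimately show ?thesis by linarith
    qed
    then show ?thesis by blast
  qed
  have uc1: "uniformly_continuous_on {0..} (\<lambda>x. (1 + x) * \<phi> x)"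
    using uniformly_continuous_on_add[OF \<phi>(2,4)] by (simp add: distrib_right)
  have int1: "set_integrable lborel {0..} (\<lambda>x. (1 + x) * \<phi> x)"
    using set_integral_add(1)[OF \<phi>(3,5)] by (simp add: distrib_right)
  from moments show ?thesis
  proof (elim disjE conjE bexE)
    assume init: "(SUP n. \<integral>\<^sup>+\<omega>. moment (\<lambda>x. x\<^sup>2) (\<omega> 0) \<partial>P n) < \<infinity>"
      and lim: "(\<lambda>n. real (L n) * max (modulus (\<lambda>x. (1 + x) * \<phi> x) (\<epsilon> n)) (kernel_modulus K (\<epsilon> n))) \<longlonglongrightarrow> 0"
    obtain D where D: "\<And>n. (\<Sum>m=1..N n. \<epsilon> n * ((1 + real m * \<epsilon> n) * \<phi> (real m * \<epsilon> n))) \<le> D"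
      using riemann[OF uc1 int1 _ lim] \<phi>(1) by auto
    show ?thesis
    proof (rule particle_systems_tight[OF kernel L_ge eps_pos \<rho>' law D, where f = "\<lambda>x. x\<^sup>2" and B = 2])
      show "z * \<phi> z \<le> (1 + z) * \<phi> z" if "0 \<le> z" for z using \<phi>(1)[OF that] by (intro mult_right_mono) auto
      show "\<exists>a\<ge>0. \<forall>x\<ge>a. B * x \<le> x\<^sup>2" for B :: real
        by (rule exI[of _ "max B 0"]) (auto simp: power2_eq_square intro: mult_right_mono)
      show "\<phi> z * ((1 + y) * max 0 ((x - z)\<^sup>2 - x\<^sup>2 + (y + z)\<^sup>2 - y\<^sup>2)) \<le> 2 * ((1 + y + y\<^sup>2) * ((1 + z) * \<phi> z))"
        if "0 \<le> y" "0 < z" "z \<le> x" for x y z using that \<phi>(1) by (intro square_properties) auto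
    qed (auto intro!: continuous_intros init[simplified])
  next
    fix f assume f: "f \<in> admissible" and ucf: "uniformly_continuous_on {0..} (\<lambda>x. f x * \<phi> x)"
      and intf: "set_integrable lborel {0..} (\<lambda>x. f x * \<phi> x)"
      and init: "(SUP n. \<integral>\<^sup>+\<omega>. moment f (\<omega> 0) \<partial>P n) < \<infinity>"
      and lim: "(\<lambda>n. real (L n) * max (modulus (\<lambda>x. (1 + x + f x) * \<phi> x) (\<epsilon> n)) (kernel_modulus K (\<epsilon> n))) \<longlonglongrightarrow> 0"
    have "\<forall>z\<ge>0. 0 \<le> \<phi> z" using \<phi>(1) by blast
    note adm = admissible_properties[OF f this]
    have uc2: "uniformly_continuous_on {0..} (\<lambda>x. (1 + x + f x) * \<phi> x)"
      using uniformly_continuous_on_add[OF uc1 ucf] by (simp add: distrib_right)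
    have int2: "set_integrable lborel {0..} (\<lambda>x. (1 + x + f x) * \<phi> x)"
      using set_integral_add(1)[OF int1 intf] by (simp add: distrib_right)
    have nn2: "0 \<le> (1 + x + f x) * \<phi> x" if "0 \<le> x" for x using \<phi>(1)[OF that] adm(2)[OF that] that by simp
    obtain D where D: "\<And>n. (\<Sum>m=1..N n. \<epsilon> n * ((1 + real m * \<epsilon> n + f (real m * \<epsilon> n)) * \<phi> (real m * \<epsilon> n))) \<le> D"
      using riemann[OF uc2 int2 nn2 lim] by auto
    obtain B where "0 \<le> B \<and> (\<forall>x y z. 0 \<le> y \<longrightarrow> 0 < z \<longrightarrow> z \<le> x \<longrightarrow>
      \<phi> z * ((1 + y) * max 0 (f (x - z) - f x + f (y + z) - f y)) \<le> B * ((1 + y + f y) * ((1 + z + f z) * \<phi> z)))"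
      using adm(4) by (elim exE)
    then have B: "0 \<le> B" "\<And>x y z. 0 \<le> y \<Longrightarrow> 0 < z \<Longrightarrow> z \<le> x \<Longrightarrow>
      \<phi> z * ((1 + y) * max 0 (f (x - z) - f x + f (y + z) - f y)) \<le> B * ((1 + y + f y) * ((1 + z + f z) * \<phi> z))"
      by simp_all
    show ?thesis
    proof (rule particle_systems_tight[OF kernel L_ge eps_pos \<rho>' law D _ adm(1) adm(2) adm(3) B init])
      show "z * \<phi> z \<le> (1 + z + f z) * \<phi> z" if "0 \<le> z" for z
        using \<phi>(1)[OF that] adm(2)[OF that] by (intro mult_right_mono) auto
    qed
  qed
qed

end
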